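(* Let $n\ge1$ and for each $j=1,\dots,n$ let $\Psi_j^A$ be a quantum channel from $A_0$ to $A_1$ and $\Phi_j^B$ a quantum channel from $B_0$ to $B_1$. Let $R=(R_0,R_1)$ be a third party with $d_{R_0}=d_{B_0}$ and $d_{R_1}=d_{B_1}$. Then there exists a superchannel $\Theta:\mathcal L^A\to\mathcal L^B$ with $\Phi_j^B=\Theta[\Psi_j^A]$ for all $j=1,\dots,n$ if and only if, for every choice of $n$ quantum channels $\Lambda_1^R,\dots,\Lambda_n^R$ from $R_0$ to $R_1$, the tripartite channel $$\Lambda^{ABR}=\frac1n\sum_{j=1}^n\Psi_j^A\otimes\Phi_j^B\otimes\Lambda_j^R$$ satisfies $$H^{\rm ext}_{\min}(R|A)_\Lambda\le H^{\rm ext}_{\min}(R|B)_\Lambda,$$ where the two sides are evaluated on the marginal channels $\Lambda^{AR}=\frac1n\sum_j\Psi_j^A\otimes\Lambda_j^R$ and $\Lambda^{BR}=\frac1n\sum_j\Phi_j^B\otimes\Lambda_j^R$ respectively.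
   Context: All Hilbert spaces are finite-dimensional; $d_S=\dim\mathcal H^S$, and $\mathcal B(\mathcal H)$ is the algebra of operators on $\mathcal H$. Each party $A$ has an input system $A_0$ and an output system $A_1$, and $A$ as a label of operators means the joint system $A_0A_1$. $\mathcal L^A$ is the space of linear maps $\mathcal B(\mathcal H^{A_0})\to\mathcal B(\mathcal H^{A_1})$; $\mathcal L^{AB}=\mathcal L^A\otimes\mathcal L^B$. A quantum channel is a completely positive trace-preserving map. $\mathbb 1^C$ is the identity map on $\mathcal L^C$. Superchannel: a linear map $\Theta:\mathcal L^A\to\mathcal L^B$ such that (i) for every party $C=(C_0,C_1)$, $\mathbb 1^C\otimes\Theta$ sends completely positive maps to completely positive maps, and (ii) $\Theta$ sends trace-preserving maps to trace-preserving maps. Marginals: deleting system labels from an operator denotes partial trace over the deleted systems. $u^S=I^S/d_S$. Extended conditional min-entropy: for a bipartite channel $\Omega^{AB}$ from $A_0B_0$ to $A_1B_1$, let $\omega^{AB}=\frac1{d_{A_0}d_{B_0}}(\mathrm{id}^{A_0B_0}\otimes\Omega^{\tilde A_0\tilde B_0\to A_1B_1})(\phi_+^{A_0\tilde A_0}\otimes\phi_+^{B_0\tilde B_0})$, where $\phi_+^{S\tilde S}=\sum_{i,j}|i\rangle\langle j|^S\otimes|i\rangle\langle j|^{\tilde S}$ and $\tilde S$ is a copy of $S$. Then $$H^{\rm ext}_{\min}(B|A)_\Omega=-\log_2\min\big\{\mathrm{Tr}[\gamma^{AB_0}]:\ \gamma^{AB_0}\otimes I^{B_1}\ge\omega^{AB},\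 \gamma^{A_0B_0}=u^{A_0}\otimes\gamma^{B_0}\big\},$$ the minimum being over Hermitian operators $\gamma^{AB_0}$ on $\mathcal H^{A_0A_1B_0}$. (In the claim, $R$ plays the role of the first argument.) *)

theory Defs
  imports "HOL-Analysis.Analysis" "HOL-Library.Function_Algebras"
begin

section \<open>Operators\<close>

text \<open>
  A Hilbert space with an orthonormal basis indexed by a finite set \<open>S\<close> is represented by \<open>S\<close>, an
  operator on it by its matrix, and tensor products of spaces by Cartesian products of index sets.
  The systems of the parties are given by finite index types, with \<open>S = UNIV\<close>.  Explicit index sets
  are only needed for ancillas, whose dimension is quantified over: an ancilla of dimension \<open>k\<close> has
  the index set \<open>{..<k}\<close>, and its operators are the matrices that vanish outside this set.
\<close>

type_synonym 'i op = "'i \<Rightarrow> 'i \<Rightarrow> complex"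

definition ops :: "'i set \<Rightarrow> 'i op set" where
  "ops S = {X. \<forall>i j. i \<notin> S \<or> j \<notin> S \<longrightarrow> X i j = 0}"

definition oscale :: "complex \<Rightarrow> 'i op \<Rightarrow> 'i op" where
  "oscale c X = (\<lambda>i j. c * X i j)"

definition ident :: "'i op" where
  "ident = (\<lambda>i j. if i = j then 1 else 0)"

definition munit :: "'i \<Rightarrow> 'i \<Rightarrow> 'i op" where
  "munit a b = (\<lambda>i j. if i = a \<and> j = b then 1 else 0)"

definition tr :: "'i::finite op \<Rightarrow> complex" where
  "tr X = (\<Sum>i\<in>UNIV. X i i)"

definition hermitian :: "'i op \<Rightarrow> bool" where
  "hermitian X \<longleftrightarrow> (\<forall>i j. X i j = cnj (X j i))"

definition psd :: "'i set \<Rightarrow> 'i op \<Rightarrow> bool" where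
  "psd S X \<longleftrightarrow> X \<in> ops S \<and>
     (\<forall>v. (\<Sum>i\<in>S. \<Sum>j\<in>S. cnj (v i) * X i j * v j) \<in> nonneg_Reals)"

definition otensor :: "'i op \<Rightarrow> 'j op \<Rightarrow> ('i \<times> 'j) op" where
  "otensor X Y = (\<lambda>(i, k) (j, l). X i j * Y k l)"

definition ptrace_fst :: "('i::finite \<times> 'j) op \<Rightarrow> 'j op" where
  "ptrace_fst X = (\<lambda>k l. \<Sum>i\<in>UNIV. X (i, k) (i, l))"

definition ptrace_snd :: "('i \<times> 'j::finite) op \<Rightarrow> 'i op" where
  "ptrace_snd X = (\<lambda>i j. \<Sum>k\<in>UNIV. X (i, k) (j, k))"

text \<open>Used with a bijection \<open>f\<close> that rearranges the tensor factors.\<close>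

definition reindex :: "('i \<Rightarrow> 'j) \<Rightarrow> 'j op \<Rightarrow> 'i op" where
  "reindex f X = (\<lambda>i j. X (f i) (f j))"

definition max_mixed :: "'i::finite op" where
  "max_mixed = oscale (1 / of_nat CARD('i)) ident"


section \<open>Linear maps between operators and channels\<close>

text \<open>
  For proper subsets \<open>S\<close>, \<open>linmap S T N\<close> constrains \<open>N\<close> on \<open>ops S\<close> only; values elsewhere are
  irrelevant.  For \<open>S = UNIV\<close>, \<open>T = UNIV\<close> it defines exactly the space of linear maps.
\<close>

definition linmap :: "'i set \<Rightarrow> 'k set \<Rightarrow> ('i op \<Rightarrow> 'k op) \<Rightarrow> bool" where
  "linmap S T N \<longleftrightarrow>
     (\<forall>X\<in>ops S. N X \<in> ops T) \<and>
     (\<forall>X\<in>ops S. \<forall>Y\<in>ops S. N (X + Y) = N X + N Y) \<and>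
     (\<forall>c. \<forall>X\<in>ops S. N (oscale c X) = oscale c (N X))"

text \<open>
  The tensor product of \<open>N\<close>, with domain \<open>ops S\<close>, and \<open>M\<close>, with domain \<open>ops S'\<close>: expand the argument
  in products of matrix units, see \<open>ltensor_otensor\<close> below.
\<close>

definition ltensor ::
  "'i set \<Rightarrow> 'j set \<Rightarrow> ('i op \<Rightarrow> 'k op) \<Rightarrow> ('j op \<Rightarrow> 'l op) \<Rightarrow> ('i \<times> 'j) op \<Rightarrow> ('k \<times> 'l) op" where
  "ltensor S S' N M X =
     (\<Sum>(i, k)\<in>S \<times> S'. \<Sum>(j, l)\<in>S \<times> S'.
        oscale (X (i, k) (j, l)) (otensor (N (munit i j)) (M (munit k l))))"

definition cp :: "'i set \<Rightarrow> 'k set \<Rightarrow> ('i op \<Rightarrow> 'k op) \<Rightarrow> bool" where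
  "cp S T N \<longleftrightarrow> linmap S T N \<and>
     (\<forall>(k::nat) X. psd ({..<k} \<times> S) X \<longrightarrow> psd ({..<k} \<times> T) (ltensor {..<k} S id N X))"

definition trace_preserving :: "('i::finite op \<Rightarrow> 'k::finite op) \<Rightarrow> bool" where
  "trace_preserving N \<longleftrightarrow> (\<forall>X. tr (N X) = tr X)"

definition channel :: "('i::finite op \<Rightarrow> 'k::finite op) \<Rightarrow> bool" where
  "channel N \<longleftrightarrow> cp UNIV UNIV N \<and> trace_preserving N"

definition average_tensor ::
  "nat \<Rightarrow> (nat \<Rightarrow> 'i::finite op \<Rightarrow> 'k op) \<Rightarrow> (nat \<Rightarrow> 'j::finite op \<Rightarrow> 'l op)
     \<Rightarrow> ('i \<times> 'j) op \<Rightarrow> ('k \<times> 'l) op" where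
  "average_tensor n \<Psi> \<Lambda> X =
     oscale (1 / of_nat n) (\<Sum>j\<in>{1..n}. ltensor UNIV UNIV (\<Psi> j) (\<Lambda> j) X)"


section \<open>Superchannels\<close>

definition superlinear ::
  "(('a0 op \<Rightarrow> 'a1 op) \<Rightarrow> ('b0 op \<Rightarrow> 'b1 op)) \<Rightarrow> bool" where
  "superlinear \<Theta> \<longleftrightarrow>
     (\<forall>N. linmap UNIV UNIV N \<longrightarrow> linmap UNIV UNIV (\<Theta> N)) \<and>
     (\<forall>N M. linmap UNIV UNIV N \<and> linmap UNIV UNIV M \<longrightarrow> \<Theta> (N + M) = \<Theta> N + \<Theta> M) \<and>
     (\<forall>c N. linmap UNIV UNIV N \<longrightarrow> \<Theta> (\<lambda>X. oscale c (N X)) = (\<lambda>Y. oscale c (\<Theta> N Y)))"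

definition block :: "('c \<times> 'i) op \<Rightarrow> 'c \<Rightarrow> 'c \<Rightarrow> 'i op" where
  "block X k l = (\<lambda>p q. X (k, p) (l, q))"

text \<open>
  The identity on the linear maps of a party \<open>C\<close> with index sets \<open>C0\<close> and \<open>C1\<close>, tensored with \<open>\<Theta>\<close>.
  A linear map \<open>\<Omega>\<close> from \<open>ops (C0 \<times> UNIV)\<close> to \<open>ops (C1 \<times> UNIV)\<close> is the sum over \<open>i\<close>, \<open>j\<close> in \<open>C0\<close> and
  \<open>k\<close>, \<open>l\<close> in \<open>C1\<close> of the tensor products of \<open>\<lambda>X. oscale (X i j) (munit k l)\<close> with the map
  \<open>\<lambda>Y. block (\<Omega> (otensor (munit i j) Y)) k l\<close>, and \<open>\<Theta>\<close> acts on the latter.  The set \<open>C1\<close> need not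
  be mentioned: for indices outside \<open>C1\<close> the latter map, hence its image under \<open>\<Theta>\<close>, is zero.
  See also \<open>superext_ltensor\<close> below.
\<close>

definition superext ::
  "'c0 set \<Rightarrow> (('a0 op \<Rightarrow> 'a1 op) \<Rightarrow> ('b0 op \<Rightarrow> 'b1 op))
     \<Rightarrow> (('c0 \<times> 'a0) op \<Rightarrow> ('c1 \<times> 'a1) op) \<Rightarrow> ('c0 \<times> 'b0) op \<Rightarrow> ('c1 \<times> 'b1) op" where
  "superext C0 \<Theta> \<Omega> Z = (\<lambda>(k, p) (l, q). \<Sum>i\<in>C0. \<Sum>j\<in>C0.
     \<Theta> (\<lambda>Y. block (\<Omega> (otensor (munit i j) Y)) k l) (block Z i j) p q)"

definition superchannel ::
  "(('a0::finite op \<Rightarrow> 'a1::finite op) \<Rightarrow> ('b0::finite op \<Rightarrow> 'b1::finite op)) \<Rightarrow> bool" where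
  "superchannel \<Theta> \<longleftrightarrow> superlinear \<Theta> \<and>
     (\<forall>(c0::nat) (c1::nat) \<Omega>.
        cp ({..<c0} \<times> UNIV) ({..<c1} \<times> UNIV) \<Omega> \<longrightarrow>
        cp ({..<c0} \<times> UNIV) ({..<c1} \<times> UNIV) (superext {..<c0} \<Theta> \<Omega>)) \<and>
     (\<forall>N. linmap UNIV UNIV N \<and> trace_preserving N \<longrightarrow> trace_preserving (\<Theta> N))"


section \<open>Extended conditional min-entropy\<close>

text \<open>
  The unnormalised maximally entangled operator on a system and its copy.  On a composite system it
  is the tensor product of those of the factors, up to the order of the systems; see
  \<open>phi_plus_prod\<close> below.
\<close>

definition phi_plus :: "('i::finite \<times> 'i) op" where
  "phi_plus = (\<Sum>i\<in>UNIV. \<Sum>j\<in>UNIV. otensor (munit i j) (munit i j))"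

definition choi_state ::
  "(('a0::finite \<times> 'b0::finite) op \<Rightarrow> ('a1 \<times> 'b1) op) \<Rightarrow> (('a0 \<times> 'b0) \<times> ('a1 \<times> 'b1)) op" where
  "choi_state \<Omega> =
     oscale (1 / (of_nat CARD('a0) * of_nat CARD('b0))) (ltensor UNIV UNIV id \<Omega> phi_plus)"

text \<open>
  The operator \<open>\<gamma>\<close> lives on the system \<open>(A0 A1) B0\<close>, while \<open>choi_state\<close> is ordered as
  \<open>(A0 B0) (A1 B1)\<close>.
\<close>

definition Hmin_feasible ::
  "(('a0::finite \<times> 'b0::finite) op \<Rightarrow> ('a1::finite \<times> 'b1::finite) op)
     \<Rightarrow> (('a0 \<times> 'a1) \<times> 'b0) op set" where
  "Hmin_feasible \<Omega> = {\<gamma>. hermitian \<gamma> \<and>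
     psd UNIV (reindex (\<lambda>((a0, b0), (a1, b1)). (((a0, a1), b0), b1)) (otensor \<gamma> ident)
       - choi_state \<Omega>) \<and>
     ptrace_snd (reindex (\<lambda>((a0, b0), a1). ((a0, a1), b0)) \<gamma>)
       = otensor max_mixed (ptrace_fst \<gamma>)}"

text \<open>
  This is the entropy of the second party given the first.  For a channel the infimum is a positive
  minimum: the feasible set is closed, nonempty and consists of positive operators, so its parts of
  bounded trace are compact.  The trace of a Hermitian operator is real.
\<close>

definition Hmin_ext ::
  "(('a0::finite \<times> 'b0::finite) op \<Rightarrow> ('a1::finite \<times> 'b1::finite) op) \<Rightarrow> real" where
  "Hmin_ext \<Omega> = - log 2 (Inf ((\<lambda>\<gamma>. Re (tr \<gamma>)) ` Hmin_feasible \<Omega>))"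


section \<open>Characteristic equations of the tensor constructions\<close>

lemma sum_op_apply: "(\<Sum>x\<in>A. f x) i j = (\<Sum>x\<in>A. (f x :: 'i op) i j)"
  by (induction A rule: infinite_finite_induct) auto

lemma munit_in_ops: "a \<in> S \<Longrightarrow> b \<in> S \<Longrightarrow> munit a b \<in> ops S"
  by (auto simp: munit_def ops_def)

lemma oscale_in_ops: "X \<in> ops S \<Longrightarrow> oscale c X \<in> ops S"
  by (auto simp: oscale_def ops_def)

lemma sum_in_ops: "(\<And>x. x \<in> A \<Longrightarrow> f x \<in> ops S) \<Longrightarrow> sum f A \<in> ops S"
  by (auto simp: ops_def sum_op_apply)

lemma ops_UNIV [simp]: "X \<in> ops UNIV"
  by (simp add: ops_def)

lemma linmap_sum:
  assumes "linmap S T N" "\<And>x. x \<in> A \<Longrightarrow> f x \<in> ops S"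
  shows "N (sum f A) = (\<Sum>x\<in>A. N (f x))"
proof -
  have *: "0 \<in> ops S" by (simp add: ops_def)
  have zero: "oscale 0 X = 0" for X :: "'x op" by (simp add: oscale_def zero_fun_def)
  have "N (oscale 0 0) = oscale 0 (N 0)" using assms(1) * unfolding linmap_def by blast
  then have "N 0 = 0" by (simp add: zero)
  with assms * show ?thesis
  proof (induction A rule: infinite_finite_induct)
    case (insert x A)
    then have "N (f x + sum f A) = N (f x) + N (sum f A)"
      using sum_in_ops[of A f S] unfolding linmap_def by auto
    moreover have "N (sum f A) = (\<Sum>x\<in>A. N (f x))"
      using insert by blast
    ultimately show ?case by (simp only: sum.insert[OF insert.hyps])
  qed auto
qed

lemma ops_expand:
  assumes "finite S" "X \<in> ops S"
  shows "X = (\<Sum>i\<in>S. \<Sum>j\<in>S. oscale (X i j) (munit i j))"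
proof (intro ext)
  fix a b
  have "(\<Sum>i\<in>S. \<Sum>j\<in>S. X i j * (if a = i \<and> b = j then 1 else 0))
      = (\<Sum>i\<in>S. if a = i then (\<Sum>j\<in>S. if b = j then X i j else 0) else 0)"
    by (intro sum.cong refl) (auto intro!: sum.cong sum.neutral)
  then show "X a b = (\<Sum>i\<in>S. \<Sum>j\<in>S. oscale (X i j) (munit i j)) a b"
    using assms by (auto simp: sum_op_apply oscale_def munit_def ops_def)
qed

lemma linmap_expand:
  assumes "finite S" "linmap S T N" "X \<in> ops S"
  shows "N X = (\<Sum>i\<in>S. \<Sum>j\<in>S. oscale (X i j) (N (munit i j)))"
proof -
  have "N X = N (\<Sum>i\<in>S. \<Sum>j\<in>S. oscale (X i j) (munit i j))"
    by (rule arg_cong[where f = N, OF ops_expand[OF assms(1,3)]])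
  also have "\<dots> = (\<Sum>i\<in>S. \<Sum>j\<in>S. N (oscale (X i j) (munit i j)))"
  proof -
    have "N (\<Sum>i\<in>S. \<Sum>j\<in>S. oscale (X i j) (munit i j)) = (\<Sum>i\<in>S. N (\<Sum>j\<in>S. oscale (X i j) (munit i j)))"
      by (intro linmap_sum[OF assms(2)] sum_in_ops oscale_in_ops munit_in_ops)
    also have "\<dots> = (\<Sum>i\<in>S. \<Sum>j\<in>S. N (oscale (X i j) (munit i j)))"
      by (intro sum.cong refl linmap_sum[OF assms(2)] oscale_in_ops munit_in_ops)
    finally show ?thesis .
  qed
  also have "\<dots> = (\<Sum>i\<in>S. \<Sum>j\<in>S. oscale (X i j) (N (munit i j)))"
  proof (intro sum.cong refl)
    fix i j assume "i \<in> S" "j \<in> S"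
    then show "N (oscale (X i j) (munit i j)) = oscale (X i j) (N (munit i j))"
      using assms(2) munit_in_ops[of i S j] unfolding linmap_def by simp
  qed
  finally show ?thesis .
qed

lemma ltensor_apply:
  "ltensor S S' N M X (p, q) (r, s) =
     (\<Sum>i\<in>S. \<Sum>k\<in>S'. \<Sum>j\<in>S. \<Sum>l\<in>S'.
        X (i, k) (j, l) * (N (munit i j) p r * M (munit k l) q s))"
  by (simp add: ltensor_def sum_op_apply oscale_def otensor_def sum.cartesian_product')

lemma ltensor_otensor:
  assumes "finite S" "finite S'" "linmap S T N" "linmap S' T' M" "X \<in> ops S" "Y \<in> ops S'"
  shows "ltensor S S' N M (otensor X Y) = otensor (N X) (M Y)"
proof -
  have "ltensor S S' N M (otensor X Y) (p, q) (r, s) = N X p r * M Y q s" for p q r s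
  proof -
    have "ltensor S S' N M (otensor X Y) (p, q) (r, s) =
       (\<Sum>i\<in>S. \<Sum>k\<in>S'. \<Sum>j\<in>S. \<Sum>l\<in>S'. (X i j * N (munit i j) p r) * (Y k l * M (munit k l) q s))"
      unfolding ltensor_apply otensor_def by (intro sum.cong refl) simp
    also have "\<dots> = (\<Sum>i\<in>S. \<Sum>j\<in>S. \<Sum>k\<in>S'. \<Sum>l\<in>S'. (X i j * N (munit i j) p r) * (Y k l * M (munit k l) q s))"
      by (rule sum.cong[OF refl], rule sum.swap)
    also have "\<dots> = (\<Sum>i\<in>S. \<Sum>j\<in>S. X i j * N (munit i j) p r) * (\<Sum>k\<in>S'. \<Sum>l\<in>S'. Y k l * M (munit k l) q s)"
      by (simp only: sum_distrib_right) (simp only: sum_distrib_left)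
    also have "\<dots> = N X p r * M Y q s"
      unfolding linmap_expand[OF assms(1,3,5)] linmap_expand[OF assms(2,4,6)] sum_op_apply oscale_def ..
    finally show ?thesis .
  qed
  then show ?thesis by (auto simp: otensor_def fun_eq_iff)
qed

lemma phi_plus_apply: "phi_plus (i, k) (j, l) = (if i = k \<and> j = l then 1 else 0)"
proof -
  have "otensor (munit a b) (munit a b) (i, k) (j, l) =
     (if a = i then if b = j then if i = k \<and> j = l then 1 else 0 else 0 else 0)" for a b
    by (auto simp: otensor_def munit_def)
  then have "phi_plus (i, k) (j, l) =
     (\<Sum>a\<in>UNIV. if a = i then (\<Sum>b\<in>UNIV. if b = j then if i = k \<and> j = l then 1 else 0 else 0) else 0)"
    unfolding phi_plus_def sum_op_apply by (intro sum.cong refl) simp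
  then show ?thesis by simp
qed

lemma phi_plus_prod:
  "phi_plus = reindex (\<lambda>((a, b), (a', b')). ((a, a'), (b, b'))) (otensor phi_plus phi_plus)"
  by (auto simp: fun_eq_iff reindex_def otensor_def phi_plus_apply)

lemma superext_ltensor:
  fixes M :: "'c0 op \<Rightarrow> 'c1 op" and N :: "'a0::finite op \<Rightarrow> 'a1::finite op"
    and \<Theta> :: "('a0 op \<Rightarrow> 'a1 op) \<Rightarrow> ('b0::finite op \<Rightarrow> 'b1::finite op)"
  assumes "finite C0" "linmap C0 C1 M" "linmap UNIV UNIV N" "superlinear \<Theta>"
  shows "superext C0 \<Theta> (ltensor C0 UNIV M N) = ltensor C0 UNIV M (\<Theta> N)"
    (is "?L = ?R")
proof (intro ext)
  fix Z :: "('c0 \<times> 'b0) op" and x y :: "'c1 \<times> 'b1"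
  obtain k p where x: "x = (k, p)" by (cases x)
  obtain l q where y: "y = (l, q)" by (cases y)
  have lin: "linmap UNIV UNIV (\<Theta> N)" using assms unfolding superlinear_def by blast
  have slice: "(\<lambda>Y. block (ltensor C0 UNIV M N (otensor (munit i j) Y)) k l)
      = (\<lambda>Y. oscale (M (munit i j) k l) (N Y))" if "i \<in> C0" "j \<in> C0" for i j
  proof
    fix Y
    have "ltensor C0 UNIV M N (otensor (munit i j) Y) = otensor (M (munit i j)) (N Y)"
      by (rule ltensor_otensor[OF assms(1) finite assms(2,3)]) (simp_all add: that munit_in_ops)
    then show "block (ltensor C0 UNIV M N (otensor (munit i j) Y)) k l = oscale (M (munit i j) k l) (N Y)"
      by (simp add: block_def oscale_def otensor_def)
  qed
  have "?L Z x y = (\<Sum>i\<in>C0. \<Sum>j\<in>C0. \<Theta> (\<lambda>Y. oscale (M (munit i j) k l) (N Y)) (block Z i j) p q)"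
    by (simp add: superext_def x y slice cong: sum.cong)
  also have "\<dots> = (\<Sum>i\<in>C0. \<Sum>j\<in>C0. M (munit i j) k l * \<Theta> N (block Z i j) p q)"
    using assms(3,4) unfolding superlinear_def by (simp add: oscale_def)
  also have "\<dots> = (\<Sum>i\<in>C0. \<Sum>j\<in>C0. \<Sum>a\<in>UNIV. \<Sum>b\<in>UNIV.
      M (munit i j) k l * (Z (i, a) (j, b) * \<Theta> N (munit a b) p q))"
    by (subst linmap_expand[OF _ lin])
       (simp_all add: sum_op_apply oscale_def block_def sum_distrib_left)
  also have "\<dots> = (\<Sum>i\<in>C0. \<Sum>a\<in>UNIV. \<Sum>j\<in>C0. \<Sum>b\<in>UNIV.
      M (munit i j) k l * (Z (i, a) (j, b) * \<Theta> N (munit a b) p q))"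
    by (rule sum.cong[OF refl], rule sum.swap)
  also have "\<dots> = ?R Z x y"
    unfolding x y ltensor_apply by (intro sum.cong refl) simp
  finally show "?L Z x y = ?R Z x y" .
qed

end

theory Submission
  imports Defs
begin

text \<open>
  If \<open>\<Theta>\<close> maps every \<open>\<Psi> j\<close> to \<open>\<Phi> j\<close>, then \<open>d\<^bsub>A0\<^esub> / d\<^bsub>B0\<^esub>\<close> times \<open>\<Theta>\<close> maps every operator that is
  feasible for the average of \<open>\<Psi> j \<otimes> \<Lambda> j\<close> to one of the same trace that is feasible for the average
  of \<open>\<Phi> j \<otimes> \<Lambda> j\<close>; hence the entropy does not decrease.

  Conversely, the Choi matrices of superchannels with \<open>\<Theta> (\<Psi> j) = \<Phi> j\<close> are the positive operators of
  trace \<open>d\<^bsub>A1\<^esub> d\<^bsub>B0\<^esub>\<close> that solve a system of linear equations.  The positive operators of this trace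
  form a compact convex set.  If it contains no solution, the residual of a least-squares solution is
  a separating functional.  It provides Hermitian operators \<open>H j\<close> and an operator \<open>G\<close> with product
  marginal such that \<open>G \<otimes> I \<ge> (\<Sum>j. choi (\<Psi> j) \<otimes> H j)\<close>, while \<open>tr G / d\<^bsub>A0\<^esub>\<close> is smaller than the sum of
  the pairings of \<open>H j\<close> with \<open>choi (\<Phi> j)\<close>.  Rescaling \<open>H j\<close> and adding an operator of the form \<open>X \<otimes> I\<close>
  turns it into the Choi matrix of a channel \<open>\<Lambda> j\<close> and changes both sides of this inequality equally.
  So \<open>G\<close> yields a feasible operator for the \<open>\<Psi> j\<close> whose trace is below the pairing of the \<open>\<Phi> j\<close> with
  the \<open>\<Lambda> j\<close>.  This pairing in turn bounds the trace of every feasible operator for the \<open>\<Phi> j\<close> from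
  below: test the constraint on the maximally entangled vector of \<open>B\<close> and \<open>R\<close>.
\<close>

text \<open>Prevents the index sets \<open>{1..n}\<close> from being rewritten to
  \<open>{Suc 0..n}\<close>, so that facts about \<open>{1..n}\<close> keep matching.\<close>

declare One_nat_def [simp del]

subsection \<open>Positive semidefinite matrices\<close>

lemma sum_UNIV_prod: "(\<Sum>x\<in>UNIV. f x) = (\<Sum>a\<in>UNIV. \<Sum>b\<in>UNIV. f (a, b))"
  for f :: "'a::finite \<times> 'b::finite \<Rightarrow> 'c::comm_monoid_add"
  by (simp add: sum.cartesian_product flip: UNIV_Times_UNIV)

definition qform :: "'i set \<Rightarrow> 'i op \<Rightarrow> ('i \<Rightarrow> complex) \<Rightarrow> complex" where
  "qform S X v = (\<Sum>i\<in>S. \<Sum>j\<in>S. cnj (v i) * X i j * v j)"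

lemma psd_iff_qform: "psd S X \<longleftrightarrow> X \<in> ops S \<and> (\<forall>v. Re (qform S X v) \<ge> 0 \<and> Im (qform S X v) = 0)"
  by (simp add: psd_def qform_def complex_nonneg_Reals_iff)

lemma qform_insert:
  assumes "finite S" "s \<notin> S"
  shows "qform (insert s S) X v = cnj (v s) * X s s * v s + cnj (v s) * (\<Sum>j\<in>S. X s j * v j)
    + (\<Sum>i\<in>S. cnj (v i) * X i s) * v s + qform S X v"
  using assms
  by (simp add: qform_def sum.distrib sum_distrib_left sum_distrib_right mult.assoc add.assoc)

lemma qform_cong: "(\<And>i. i \<in> S \<Longrightarrow> v i = w i) \<Longrightarrow> qform S X v = qform S X w"
  unfolding qform_def by (intro sum.cong refl) simp

lemma qform_supp:
  assumes "finite S" "T \<subseteq> S" "\<And>i. i \<in> S - T \<Longrightarrow> v i = 0"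
  shows "qform S X v = qform T X v"
proof -
  have "qform S X v = (\<Sum>i\<in>T. \<Sum>j\<in>S. cnj (v i) * X i j * v j)"
    unfolding qform_def by (rule sum.mono_neutral_right) (use assms in auto)
  also have "\<dots> = qform T X v"
    unfolding qform_def by (rule sum.cong[OF refl], rule sum.mono_neutral_right) (use assms in auto)
  finally show ?thesis .
qed

text \<open>A test vector supported on two indices sees only a 2 x 2 principal block. Hermiticity
  and the vanishing of rows are obtained below from suitable choices of \<open>a\<close> and
  \<open>b\<close>.\<close>

lemma psd_qform_pair:
  assumes "finite S" "psd S X" "i \<in> S" "j \<in> S" "i \<noteq> j"
  defines "q a b \<equiv> cnj a * X i i * a + cnj a * X i j * b + cnj b * X j i * a + cnj b * X j j * b"
  shows "Re (q a b) \<ge> 0" "Im (q a b) = 0"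
proof -
  let ?v = "\<lambda>k. if k = i then a else if k = j then b else 0"
  have "qform S X ?v = qform {i, j} X ?v"
    by (rule qform_supp) (use assms in auto)
  also have "\<dots> = q a b" using assms(5) by (simp add: qform_def q_def add.assoc)
  finally show "Re (q a b) \<ge> 0" "Im (q a b) = 0" using assms(2) by (metis psd_iff_qform)+
qed

lemma psd_diag:
  assumes "finite S" "psd S X"
  shows "Re (X i i) \<ge> 0" "Im (X i i) = 0"
proof -
  have "Re (X i i) \<ge> 0 \<and> Im (X i i) = 0"
  proof (cases "i \<in> S")
    case True
    have "qform S X (\<lambda>k. if k = i then 1 else 0) = qform {i} X (\<lambda>k. if k = i then 1 else 0)"
      by (rule qform_supp) (use assms True in auto)
    also have "\<dots> = X i i" by (simp add: qform_def)
    finally show ?thesis using assms(2) by (metis psd_iff_qform)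
  next
    case False
    then show ?thesis using assms(2) by (simp add: psd_def ops_def)
  qed
  then show "Re (X i i) \<ge> 0" "Im (X i i) = 0" by simp_all
qed

lemma psd_hermitian:
  assumes "finite S" "psd S X"
  shows "hermitian X"
  unfolding hermitian_def
proof (intro allI)
  fix i j
  consider "i \<notin> S \<or> j \<notin> S" | "i = j" | "i \<in> S" "j \<in> S" "i \<noteq> j" by blast
  then show "X i j = cnj (X j i)"
  proof cases
    case 1
    then show ?thesis using assms(2) by (auto simp: psd_def ops_def)
  next
    case 2
    then show ?thesis using psd_diag[OF assms, of j] by (simp add: complex_eq_iff)
  next
    case 3
    \<comment> \<open>Given real diagonal entries, the pair (1, 1) makes the imaginary part of
      \<open>X i j + X j i\<close> vanish, and the pair (1, \<i>) the real part of
      \<open>X i j - X j i\<close>.\<close>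
    then show ?thesis
      using psd_qform_pair(2)[OF assms 3, of 1 1] psd_qform_pair(2)[OF assms 3, of 1 \<i>]
        psd_diag(2)[OF assms, of i] psd_diag(2)[OF assms, of j]
      by (simp add: complex_eq_iff)
  qed
qed

text \<open>With a vanishing diagonal entry the form is affine in the coordinate \<open>s\<close>.
  The vector with entry \<open>- t * X s j\<close> at \<open>s\<close> and 1 at \<open>j\<close>
  gives \<open>D - 2 * t * N\<close>, which would be negative for large \<open>t\<close> if
  \<open>X s j\<close> were nonzero.\<close>

lemma psd_zero_row:
  assumes "finite S" "psd S X" "X s s = 0"
  shows "X s j = 0"
proof (cases "s \<in> S \<and> j \<in> S \<and> s \<noteq> j")
  case False
  then show ?thesis using assms by (auto simp: psd_def ops_def)
next
  case True
  have h: "X j s = cnj (X s j)" using psd_hermitian[OF assms(1,2)] unfolding hermitian_def by blast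
  define D where "D = Re (X j j)"
  define N where "N = (cmod (X s j))\<^sup>2"
  have "D \<ge> 0" using psd_diag[OF assms(1,2)] by (simp add: D_def)
  have ge: "D - 2 * t * N \<ge> 0" for t :: real
  proof -
    have "Re (cnj (- of_real t * X s j) * X s j + X j s * (- of_real t * X s j) + X j j) \<ge> 0"
      using psd_qform_pair(1)[OF assms(1,2), of s j "- of_real t * X s j" 1] True assms(3) by simp
    moreover have "(cmod (X s j))\<^sup>2 = (Re (X s j))\<^sup>2 + (Im (X s j))\<^sup>2" by (rule cmod_power2)
    ultimately show ?thesis by (simp add: D_def N_def h power2_eq_square algebra_simps)
  qed
  have "N = 0"
  proof (rule ccontr)
    assume "N \<noteq> 0"
    then have "N > 0" by (simp add: N_def)
    then show False using ge[of "(D + 1) / N"] \<open>D \<ge> 0\<close> by simp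
  qed
  then show ?thesis by (simp add: N_def)
qed

text \<open>Cholesky factorisation by induction on the index set: removing the rank-one contribution
  of the pivot \<open>s\<close> leaves the Schur complement, which is positive on the remaining
  indices. The closure properties of positivity below rest on this factorisation.\<close>

lemma psd_gram:
  assumes "finite S" "psd S X"
  obtains m :: nat and w where "\<And>i j. X i j = (\<Sum>k<m. w k i * cnj (w k j))"
proof -
  have "\<exists>(m::nat) w. \<forall>i j. X i j = (\<Sum>k<m. w k i * cnj (w k j))"
    using assms
  proof (induction S arbitrary: X rule: finite_induct)
    case empty
    then have "\<forall>i j. X i j = (\<Sum>k<(0::nat). undefined k i * cnj (undefined k j))"
      by (simp add: psd_def ops_def)
    then show ?case by blast
  next
    case (insert s S)
    have fin: "finite (insert s S)" using insert by simp
    note herm = psd_hermitian[OF fin insert.prems, unfolded hermitian_def, rule_format]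
    define d where "d = Re (X s s)"
    have d: "X s s = of_real d" "d \<ge> 0"
      using psd_diag[OF fin insert.prems, of s] by (auto simp: d_def complex_eq_iff)
    \<comment> \<open>For \<open>d = 0\<close> the division gives 0 and \<open>X' = X\<close>; the
      row and column of \<open>s\<close> are then zero by \<open>psd_zero_row\<close>.\<close>
    define X' where "X' = (\<lambda>i j. X i j - X i s * X s j / d)"
    have row: "X' s j = 0" "X' j s = 0" for j
      using d psd_zero_row[OF fin insert.prems, of s j] herm[of j s] by (auto simp: X'_def)
    have "psd S X'"
      unfolding psd_iff_qform
    proof (intro conjI allI)
      show "X' \<in> ops S"
      proof -
        have "X' i j = 0" if "i \<notin> S \<or> j \<notin> S" for i j
          using that row insert.prems by (cases "i = s \<or> j = s") (auto simp: psd_def ops_def X'_def)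
        then show ?thesis by (simp add: ops_def)
      qed
    next
      fix v
      define r where "r = (\<Sum>j\<in>S. X s j * v j)"
      \<comment> \<open>Completing the square: with this entry at \<open>s\<close>, the form of
        \<open>X\<close> at \<open>u\<close> equals the form of the Schur complement at
        \<open>v\<close>.\<close>
      define u where "u = (\<lambda>i. if i = s then - r / d else v i)"
      have r': "(\<Sum>i\<in>S. cnj (v i) * X i s) = cnj r"
        using herm[of _ s] by (simp add: r_def mult.commute)
      have u_r: "(\<Sum>j\<in>S. X s j * u j) = r"
        unfolding r_def by (rule sum.cong) (use insert.hyps in \<open>auto simp: u_def\<close>)
      have u_r': "(\<Sum>i\<in>S. cnj (u i) * X i s) = cnj r"
        unfolding r'[symmetric] by (rule sum.cong) (use insert.hyps in \<open>auto simp: u_def\<close>)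
      have u_q: "qform S X u = qform S X v"
        by (rule qform_cong) (use insert.hyps in \<open>auto simp: u_def\<close>)
      have "qform S X' v = qform S X v - (\<Sum>i\<in>S. \<Sum>j\<in>S. (cnj (v i) * X i s) * (X s j * v j)) / d"
        unfolding qform_def X'_def sum_subtractf[symmetric] sum_divide_distrib
        by (intro sum.cong refl) (simp add: algebra_simps)
      also have "(\<Sum>i\<in>S. \<Sum>j\<in>S. (cnj (v i) * X i s) * (X s j * v j)) = cnj r * r"
        unfolding r'[symmetric] by (simp add: r_def sum_product)
      also have "qform S X v - cnj r * r / d = qform (insert s S) X u"
        unfolding qform_insert[OF insert.hyps] u_r u_r' u_q
        by (cases "d = 0") (simp_all add: u_def d(1))
      finally show "Re (qform S X' v) \<ge> 0" "Im (qform S X' v) = 0"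
        using insert.prems by (simp_all add: psd_iff_qform)
    qed
    then obtain m w where mw: "\<And>i j. X' i j = (\<Sum>k<(m::nat). w k i * cnj (w k j))"
      using insert.IH by blast
    \<comment> \<open>The column of the pivot divided by \<open>sqrt d\<close> restores the
      subtracted rank-one term.\<close>
    define w' where "w' = w(m := (\<lambda>i. X i s / sqrt d))"
    have "X i j = (\<Sum>k<Suc m. w' k i * cnj (w' k j))" for i j
    proof -
      have "(\<Sum>k<Suc m. w' k i * cnj (w' k j)) = X' i j + X i s * X s j / (of_real (sqrt d) * of_real (sqrt d))"
        unfolding mw by (simp add: w'_def herm[of s j])
      also have "of_real (sqrt d) * of_real (sqrt d) = (of_real d :: complex)"
        using d(2) by (metis of_real_mult real_sqrt_mult_self abs_of_nonneg)
      finally show ?thesis by (simp add: X'_def)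
    qed
    then show ?case by blast
  qed
  then show ?thesis using that by blast
qed

lemma psd_gramI:
  assumes "finite K" "X \<in> ops S" "\<And>i j. i \<in> S \<Longrightarrow> j \<in> S \<Longrightarrow> X i j = (\<Sum>k\<in>K. w k i * cnj (w k j))"
  shows "psd S X"
  unfolding psd_iff_qform
proof (intro conjI allI assms(2))
  fix v
  define z where "z k = (\<Sum>i\<in>S. cnj (v i) * w k i)" for k
  have "qform S X v = (\<Sum>i\<in>S. \<Sum>j\<in>S. \<Sum>k\<in>K. (cnj (v i) * w k i) * cnj (cnj (v j) * w k j))"
    unfolding qform_def
    by (intro sum.cong refl) (simp add: assms(3) sum_distrib_left sum_distrib_right mult_ac)
  also have "\<dots> = (\<Sum>i\<in>S. \<Sum>k\<in>K. \<Sum>j\<in>S. (cnj (v i) * w k i) * cnj (cnj (v j) * w k j))"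
    by (intro sum.cong refl sum.swap)
  also have "\<dots> = (\<Sum>k\<in>K. \<Sum>i\<in>S. \<Sum>j\<in>S. (cnj (v i) * w k i) * cnj (cnj (v j) * w k j))"
    by (rule sum.swap)
  also have "\<dots> = (\<Sum>k\<in>K. z k * cnj (z k))"
    by (simp add: z_def sum_product)
  also have "\<dots> = of_real (\<Sum>k\<in>K. (cmod (z k))\<^sup>2)"
    by (simp only: complex_norm_square[symmetric] of_real_sum)
  finally have "qform S X v = of_real (\<Sum>k\<in>K. (cmod (z k))\<^sup>2)" .
  then show "Re (qform S X v) \<ge> 0" "Im (qform S X v) = 0" by (simp_all add: sum_nonneg)
qed

text \<open>Precomposing the Gram vectors with \<open>h\<close> works for any \<open>h\<close>,
  injective or not. Reordering tensor factors, moving systems into the natural numbers and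
  restricting to the graph of a map are all instances.\<close>

lemma psd_compress:
  assumes "finite T" "psd T X" "Y \<in> ops S" "\<And>i j. i \<in> S \<Longrightarrow> j \<in> S \<Longrightarrow> Y i j = X (h i) (h j)"
  shows "psd S Y"
proof -
  obtain m w where w: "\<And>i j. X i j = (\<Sum>k<(m::nat). w k i * cnj (w k j))"
    using psd_gram[OF assms(1,2)] by metis
  show ?thesis
    by (rule psd_gramI[of "{..<m}" _ _ "\<lambda>k i. w k (h i)"]) (simp_all only: assms(3,4) w finite_lessThan)
qed

text \<open>The link product of two positive operators. Contracting a Gram vector of
  \<open>X\<close> with one of \<open>Y\<close> over \<open>T\<close> gives a Gram vector of
  \<open>Z\<close>, indexed by pairs. Entries are paired at equal indices, so no transposition
  enters.\<close>

lemma psd_contract: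
  assumes "finite S" "finite T" "finite U" "psd (S \<times> T) X" "psd (T \<times> U) Y" "Z \<in> ops (S \<times> U)"
    and "\<And>s u s' u'. s \<in> S \<Longrightarrow> u \<in> U \<Longrightarrow> s' \<in> S \<Longrightarrow> u' \<in> U \<Longrightarrow>
      Z (s, u) (s', u') = (\<Sum>t\<in>T. \<Sum>t'\<in>T. X (s, t) (s', t') * Y (t, u) (t', u'))"
  shows "psd (S \<times> U) Z"
proof -
  obtain m x where x: "\<And>i j. X i j = (\<Sum>k<(m::nat). x k i * cnj (x k j))"
    using psd_gram[of "S \<times> T" X] assms(1,2,4) by (metis finite_cartesian_product)
  obtain n y where y: "\<And>i j. Y i j = (\<Sum>k<(n::nat). y k i * cnj (y k j))"
    using psd_gram[of "T \<times> U" Y] assms(2,3,5) by (metis finite_cartesian_product)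
  define z where "z = (\<lambda>(k, l) (s, u). \<Sum>t\<in>T. x k (s, t) * y l (t, u))"
  show ?thesis
  proof (rule psd_gramI[of "{..<m} \<times> {..<n}" _ _ z])
    fix i j assume ij: "i \<in> S \<times> U" "j \<in> S \<times> U"
    obtain s u s' u' where [simp]: "i = (s, u)" "j = (s', u')" by (cases i, cases j)
    have "Z i j = (\<Sum>t\<in>T. \<Sum>t'\<in>T. X (s, t) (s', t') * Y (t, u) (t', u'))"
      using assms(7) ij by simp
    also have "\<dots> = (\<Sum>t\<in>T. \<Sum>t'\<in>T. \<Sum>kl\<in>{..<m} \<times> {..<n}. (x (fst kl) (s, t) * y (snd kl) (t, u)) * cnj (x (fst kl) (s', t') * y (snd kl) (t', u')))"
      unfolding x y sum_product sum.cartesian_product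
      by (intro sum.cong refl) (simp add: case_prod_beta mult_ac)
    also have "\<dots> = (\<Sum>t\<in>T. \<Sum>kl\<in>{..<m} \<times> {..<n}. \<Sum>t'\<in>T. (x (fst kl) (s, t) * y (snd kl) (t, u)) * cnj (x (fst kl) (s', t') * y (snd kl) (t', u')))"
      by (intro sum.cong refl sum.swap)
    also have "\<dots> = (\<Sum>kl\<in>{..<m} \<times> {..<n}. \<Sum>t\<in>T. \<Sum>t'\<in>T. (x (fst kl) (s, t) * y (snd kl) (t, u)) * cnj (x (fst kl) (s', t') * y (snd kl) (t', u')))"
      by (rule sum.swap)
    also have "\<dots> = (\<Sum>kl\<in>{..<m} \<times> {..<n}. z kl i * cnj (z kl j))"
      by (intro sum.cong refl) (simp add: z_def case_prod_beta sum_product)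
    finally show "Z i j = (\<Sum>kl\<in>{..<m} \<times> {..<n}. z kl i * cnj (z kl j))" .
  qed (use assms in auto)
qed

subsection \<open>Choi matrices\<close>

text \<open>The unnormalised Choi matrix. A \<open>linmap\<close> is unconstrained off
  \<open>ops S\<close>, so the entries outside \<open>S\<close> are set to 0 explicitly.\<close>

definition choi :: "'i set \<Rightarrow> ('i op \<Rightarrow> 'k op) \<Rightarrow> ('i \<times> 'k) op" where
  "choi S N = (\<lambda>(a, p) (b, q). if a \<in> S \<and> b \<in> S then N (munit a b) p q else 0)"

definition lmap :: "'i set \<Rightarrow> ('i \<times> 'k) op \<Rightarrow> 'i op \<Rightarrow> 'k op" where
  "lmap S C X = (\<lambda>p q. \<Sum>a\<in>S. \<Sum>b\<in>S. X a b * C (a, p) (b, q))"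

lemma choi_UNIV [simp]: "choi UNIV N (a, p) (b, q) = N (munit a b) p q"
  by (simp add: choi_def)

lemma linmap_UNIV:
  "linmap UNIV UNIV N \<longleftrightarrow> (\<forall>X Y. N (X + Y) = N X + N Y) \<and> (\<forall>c X. N (oscale c X) = oscale c (N X))"
  by (simp add: linmap_def Ball_def)

lemma linmap_lmap:
  assumes "C \<in> ops (S \<times> T)"
  shows "linmap S T (lmap S C)"
  using assms
  by (auto simp: linmap_def lmap_def ops_def oscale_def fun_eq_iff algebra_simps sum.distrib
      sum_distrib_left intro!: sum.neutral)

lemma sum_delta2:
  assumes "finite S" "finite T" "a \<in> S" "b \<in> T"
  shows "(\<Sum>i\<in>S. \<Sum>j\<in>T. (if i = a \<and> j = b then 1 else 0) * f i j) = (f a b :: complex)"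
proof -
  have "(\<Sum>i\<in>S. \<Sum>j\<in>T. (if i = a \<and> j = b then 1 else 0) * f i j)
      = (\<Sum>i\<in>S. if i = a then (\<Sum>j\<in>T. if j = b then f i j else 0) else 0)"
    by (intro sum.cong refl) (auto intro!: sum.cong)
  then show ?thesis using assms by simp
qed

lemma lmap_munit:
  assumes "finite S" "a \<in> S" "b \<in> S"
  shows "lmap S C (munit a b) = (\<lambda>p q. C (a, p) (b, q))"
  using assms by (simp add: lmap_def munit_def sum_delta2)

lemma choi_lmap:
  assumes "finite S" "C \<in> ops (S \<times> T)"
  shows "choi S (lmap S C) = C"
  using assms by (auto simp: choi_def lmap_munit fun_eq_iff ops_def)

lemma lmap_choi:
  fixes N :: "'i::finite op \<Rightarrow> 'k op"
  assumes "linmap UNIV UNIV N"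
  shows "lmap UNIV (choi UNIV N) = N"
proof (intro ext)
  fix X p q
  show "lmap UNIV (choi UNIV N) X p q = N X p q"
    by (subst linmap_expand[OF _ assms]) (simp_all add: lmap_def sum_op_apply oscale_def)
qed

lemma ltensor_id:
  assumes "finite R"
  shows "ltensor R S id N X (m, p) (l, q) =
    (if m \<in> R \<and> l \<in> R then \<Sum>a\<in>S. \<Sum>b\<in>S. X (m, a) (l, b) * N (munit a b) p q else 0)"
proof -
  have "ltensor R S id N X (m, p) (l, q) = (\<Sum>i\<in>R. \<Sum>j\<in>R. \<Sum>k\<in>S. \<Sum>r\<in>S.
      X (i, k) (j, r) * (munit i j m l * N (munit k r) p q))"
    unfolding ltensor_apply id_apply by (rule sum.cong[OF refl], rule sum.swap)
  also have "\<dots> = (\<Sum>i\<in>R. \<Sum>j\<in>R. (if i = m \<and> j = l then 1 else 0) *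
      (\<Sum>a\<in>S. \<Sum>b\<in>S. X (i, a) (j, b) * N (munit a b) p q))"
    unfolding sum_distrib_left by (intro sum.cong refl) (simp add: munit_def)
  also have "\<dots> = (if m \<in> R \<and> l \<in> R then \<Sum>a\<in>S. \<Sum>b\<in>S. X (m, a) (l, b) * N (munit a b) p q else 0)"
  proof (cases "m \<in> R \<and> l \<in> R")
    case True
    then show ?thesis using assms by (simp add: sum_delta2)
  next
    case False
    then show ?thesis by (auto intro!: sum.neutral)
  qed
  finally show ?thesis .
qed

text \<open>Choi's theorem. Forwards, \<open>X\<close> is the maximally entangled operator on
  \<open>S\<close> and an ancilla of dimension \<open>card S\<close>, identified through the
  enumeration \<open>h\<close>; its image is the Choi matrix up to relabelling. Backwards, the
  extended map contracts its argument with the Choi matrix, so \<open>psd_contract\<close>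
  applies.\<close>

lemma cp_iff_choi:
  assumes "finite S" "finite T"
  shows "cp S T N \<longleftrightarrow> linmap S T N \<and> psd (S \<times> T) (choi S N)"
proof (intro iffI conjI)
  assume N: "cp S T N"
  then show lin: "linmap S T N" by (simp add: cp_def)
  obtain h where h: "bij_betw h S {0..<card S}" using ex_bij_betw_finite_nat[OF assms(1)] by blast
  define v :: "nat \<times> 'a \<Rightarrow> complex" where "v = (\<lambda>(m, a). if a \<in> S \<and> m = h a then 1 else 0)"
  define X where "X = (\<lambda>i j. v i * cnj (v j))"
  have hS: "h a < card S" if "a \<in> S" for a using h that by (auto simp: bij_betw_def)
  have "psd ({..<card S} \<times> S) X"
    by (rule psd_gramI[of "{()}" _ _ "\<lambda>_. v"]) (use hS in \<open>auto simp: X_def v_def ops_def\<close>)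
  then have "psd ({..<card S} \<times> T) (ltensor {..<card S} S id N X)" using N by (simp add: cp_def)
  then show "psd (S \<times> T) (choi S N)"
  proof (rule psd_compress[rotated, where h = "\<lambda>(a, p). (h a, p)"])
    show "choi S N \<in> ops (S \<times> T)"
      using lin unfolding linmap_def choi_def ops_def
      by (auto simp: munit_def)
  next
    fix i j assume ij: "i \<in> S \<times> T" "j \<in> S \<times> T"
    obtain a p b q where [simp]: "i = (a, p)" "j = (b, q)" by (cases i, cases j)
    have inj: "h x = h y \<longleftrightarrow> x = y" if "x \<in> S" "y \<in> S" for x y
      using h that by (auto simp: bij_betw_def inj_on_def)
    have "ltensor {..<card S} S id N X (h a, p) (h b, q)
        = (\<Sum>x\<in>S. \<Sum>y\<in>S. X (h a, x) (h b, y) * N (munit x y) p q)"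
      using ij hS by (simp add: ltensor_id)
    also have "\<dots> = (\<Sum>x\<in>S. \<Sum>y\<in>S. (if x = a \<and> y = b then 1 else 0) * N (munit x y) p q)"
      using ij by (intro sum.cong refl) (auto simp: X_def v_def inj)
    also have "\<dots> = N (munit a b) p q" using ij assms by (simp add: sum_delta2)
    finally show "choi S N i j = ltensor {..<card S} S id N X
        (case i of (a, p) \<Rightarrow> (h a, p)) (case j of (a, p) \<Rightarrow> (h a, p))"
      using ij by (simp add: choi_def)
  qed (use assms in auto)
next
  assume N: "linmap S T N \<and> psd (S \<times> T) (choi S N)"
  have zero: "N (munit a b) p q = 0" if "a \<in> S" "b \<in> S" "p \<notin> T \<or> q \<notin> T" for a b p q
    using N munit_in_ops[OF that(1,2)] that(3) unfolding linmap_def ops_def by blast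
  have "psd ({..<k} \<times> T) (ltensor {..<k} S id N X)" if "psd ({..<k} \<times> S) X" for k :: nat and X
  proof (rule psd_contract[where X = X and Y = "choi S N" and T = S])
    show "ltensor {..<k} S id N X \<in> ops ({..<k} \<times> T)"
      by (auto simp: ops_def ltensor_id zero intro!: sum.neutral)
  qed (use that N assms in \<open>auto simp: ltensor_id choi_def intro!: sum.cong\<close>)
  with N show "cp S T N" by (simp add: cp_def)
qed

lemma cp_UNIV_iff_choi:
  "cp UNIV UNIV N \<longleftrightarrow> linmap UNIV UNIV N \<and> psd UNIV (choi UNIV N)"
  for N :: "'i::finite op \<Rightarrow> 'k::finite op"
  using cp_iff_choi[of "UNIV :: 'i set" "UNIV :: 'k set"] by simp

lemma tr_munit: "tr (munit a b) = (if a = b then 1 else 0)"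
  unfolding tr_def munit_def by (auto intro!: sum.neutral)

lemma tr_lmap:
  fixes C :: "('i::finite \<times> 'k::finite) op"
  shows "tr (lmap UNIV C X) = (\<Sum>a\<in>UNIV. \<Sum>b\<in>UNIV. X a b * (\<Sum>p\<in>UNIV. C (a, p) (b, p)))"
proof -
  have "tr (lmap UNIV C X) = (\<Sum>a\<in>UNIV. \<Sum>p\<in>UNIV. \<Sum>b\<in>UNIV. X a b * C (a, p) (b, p))"
    unfolding tr_def lmap_def by (rule sum.swap)
  also have "\<dots> = (\<Sum>a\<in>UNIV. \<Sum>b\<in>UNIV. \<Sum>p\<in>UNIV. X a b * C (a, p) (b, p))"
    by (intro sum.cong refl sum.swap)
  finally show ?thesis by (simp add: sum_distrib_left)
qed

lemma tr_lmap_scaled: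
  fixes C :: "('i::finite \<times> 'k::finite) op"
  assumes "\<And>a b. (\<Sum>p\<in>UNIV. C (a, p) (b, p)) = (if a = b then c else 0)"
  shows "tr (lmap UNIV C X) = c * tr X"
proof -
  have "tr (lmap UNIV C X) = (\<Sum>a\<in>UNIV. \<Sum>b\<in>UNIV. if a = b then X a b * c else 0)"
    unfolding tr_lmap assms by (intro sum.cong refl) simp
  then show ?thesis by (simp add: tr_def sum_distrib_left mult.commute)
qed

lemma channel_lmap:
  fixes C :: "('i::finite \<times> 'k::finite) op"
  assumes "psd UNIV C" "\<And>a b. (\<Sum>p\<in>UNIV. C (a, p) (b, p)) = (if a = b then 1 else 0)"
  shows "channel (lmap UNIV C)"
proof -
  have "choi UNIV (lmap UNIV C) = C" using choi_lmap[of UNIV C UNIV] by simp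
  then show ?thesis
    using assms linmap_lmap[of C UNIV UNIV] tr_lmap_scaled[of C 1]
    by (simp add: channel_def cp_UNIV_iff_choi trace_preserving_def)
qed

lemma channelD:
  assumes "channel N"
  shows "linmap UNIV UNIV N" "psd UNIV (choi UNIV N)" "trace_preserving N"
    "(\<Sum>p\<in>UNIV. choi UNIV N (a, p) (b, p)) = (if a = b then 1 else 0)"
proof -
  show "linmap UNIV UNIV N" "psd UNIV (choi UNIV N)" and tp: "trace_preserving N"
    using assms by (simp_all add: channel_def cp_UNIV_iff_choi)
  have "(\<Sum>p\<in>UNIV. choi UNIV N (a, p) (b, p)) = tr (N (munit a b))" by (simp add: tr_def)
  also have "\<dots> = (if a = b then 1 else 0)"
    using tp by (simp add: trace_preserving_def tr_munit)
  finally show "(\<Sum>p\<in>UNIV. choi UNIV N (a, p) (b, p)) = (if a = b then 1 else 0)" .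
qed

section \<open>Feasibility in terms of Choi matrices\<close>

lemma munit_prod: "munit (a, r) (b, s) = otensor (munit a b) (munit r s)"
  by (auto simp: munit_def otensor_def fun_eq_iff)

lemma choi_state_apply:
  fixes \<Omega> :: "('a0::finite \<times> 'b0::finite) op \<Rightarrow> ('a1 \<times> 'b1) op"
  shows "choi_state \<Omega> (x, p) (y, q) = 1 / (of_nat CARD('a0) * of_nat CARD('b0)) * \<Omega> (munit x y) p q"
proof -
  have "ltensor UNIV UNIV id \<Omega> phi_plus (x, p) (y, q) =
      (\<Sum>i\<in>UNIV. \<Sum>j\<in>UNIV. (if i = x \<and> j = y then 1 else 0) * \<Omega> (munit i j) p q)"
    by (simp add: ltensor_id phi_plus_apply eq_commute)
  then show ?thesis by (simp only: choi_state_def oscale_def sum_delta2 finite UNIV_I)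
qed

text \<open>The operator whose positivity is the entropy constraint: \<gamma> \<otimes> I minus
  \<open>c\<close> times the sum of the \<open>C j\<close> \<otimes> \<open>L j\<close>. The free
  factor \<open>c\<close> covers both the normalised Choi state and the unnormalised dual witness,
  where \<open>c = 1\<close>.\<close>

definition gap :: "complex \<Rightarrow> nat \<Rightarrow> (nat \<Rightarrow> 'x op) \<Rightarrow> (nat \<Rightarrow> ('r \<times> 's) op) \<Rightarrow> ('x \<times> 'r) op
    \<Rightarrow> ('x \<times> 'r \<times> 's) op" where
  "gap c n C L \<gamma> = (\<lambda>(x, r, s) (x', r', s').
     (if s = s' then \<gamma> (x, r) (x', r') else 0) - c * (\<Sum>j\<in>{1..n}. C j x x' * L j (r, s) (r', s')))"

lemma choi_state_average:
  fixes \<Psi> :: "nat \<Rightarrow> 'a0::finite op \<Rightarrow> 'a1::finite op" and \<Lambda> :: "nat \<Rightarrow> 'r0::finite op \<Rightarrow> 'r1::finite op"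
  assumes "\<And>j. j \<in> {1..n} \<Longrightarrow> linmap UNIV UNIV (\<Psi> j)" "\<And>j. j \<in> {1..n} \<Longrightarrow> linmap UNIV UNIV (\<Lambda> j)"
  shows "choi_state (average_tensor n \<Psi> \<Lambda>) ((a, r), (p, s)) ((a', r'), (p', s')) =
    1 / (of_nat CARD('a0) * of_nat CARD('r0) * of_nat n) *
    (\<Sum>j\<in>{1..n}. choi UNIV (\<Psi> j) (a, p) (a', p') * choi UNIV (\<Lambda> j) (r, s) (r', s'))"
proof -
  have "ltensor UNIV UNIV (\<Psi> j) (\<Lambda> j) (munit (a, r) (a', r')) (p, s) (p', s')
      = choi UNIV (\<Psi> j) (a, p) (a', p') * choi UNIV (\<Lambda> j) (r, s) (r', s')" if "j \<in> {1..n}" for j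
  proof -
    have "ltensor UNIV UNIV (\<Psi> j) (\<Lambda> j) (munit (a, r) (a', r'))
        = otensor (\<Psi> j (munit a a')) (\<Lambda> j (munit r r'))"
      unfolding munit_prod using assms[OF that] by (intro ltensor_otensor) auto
    then show ?thesis by (simp add: otensor_def)
  qed
  then show ?thesis
    by (simp add: choi_state_apply average_tensor_def oscale_def sum_op_apply)
qed

lemma psd_UNIV_reindex:
  fixes X :: "'j::finite op" and h :: "'i::finite \<Rightarrow> 'j"
  assumes "psd UNIV X"
  shows "psd UNIV (reindex h X)"
  by (rule psd_compress[OF _ assms]) (simp_all add: reindex_def)

text \<open>The constraint operator and \<open>gap\<close> differ only in the order of the tensor
  factors: \<open>?f\<close> and \<open>?g\<close> are mutually inverse rearrangements, and pulling
  back along either preserves positivity.\<close>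

lemma Hmin_feasible_average:
  fixes \<Psi> :: "nat \<Rightarrow> 'a0::finite op \<Rightarrow> 'a1::finite op" and \<Lambda> :: "nat \<Rightarrow> 'r0::finite op \<Rightarrow> 'r1::finite op"
  assumes "\<forall>j\<in>{1..n}. channel (\<Psi> j)" "\<forall>j\<in>{1..n}. channel (\<Lambda> j)"
  shows "\<gamma> \<in> Hmin_feasible (average_tensor n \<Psi> \<Lambda>) \<longleftrightarrow> hermitian \<gamma> \<and>
    psd UNIV (gap (1 / (of_nat CARD('a0) * of_nat CARD('r0) * of_nat n)) n
      (\<lambda>j. choi UNIV (\<Psi> j)) (\<lambda>j. choi UNIV (\<Lambda> j)) \<gamma>) \<and>
    (\<forall>a a' r r'. (\<Sum>p\<in>UNIV. \<gamma> ((a, p), r) ((a', p), r')) =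
      (if a = a' then (\<Sum>x\<in>UNIV. \<gamma> (x, r) (x, r')) / of_nat CARD('a0) else 0))"
proof -
  let ?f = "\<lambda>((a, p), (r, s)). ((a, r), (p, s))" and ?g = "\<lambda>((a, r), (p, s)). ((a, p), (r, s))"
  let ?D = "reindex (\<lambda>((a0, b0), (a1, b1)). (((a0, a1), b0), b1)) (otensor \<gamma> ident)
       - choi_state (average_tensor n \<Psi> \<Lambda>)"
  let ?G = "gap (1 / (of_nat CARD('a0) * of_nat CARD('r0) * of_nat n)) n
      (\<lambda>j. choi UNIV (\<Psi> j)) (\<lambda>j. choi UNIV (\<Lambda> j)) \<gamma>"
  have entry: "choi_state (average_tensor n \<Psi> \<Lambda>) ((a, r), (p, s)) ((a', r'), (p', s')) =
    (\<Sum>j\<in>{1..n}. choi UNIV (\<Psi> j) (a, p) (a', p') * choi UNIV (\<Lambda> j) (r, s) (r', s')) /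
    (of_nat CARD('a0) * of_nat CARD('r0) * of_nat n)" for a r p s a' r' p' s'
    by (subst choi_state_average) (simp_all add: assms channelD(1))
  have "?G = reindex ?f ?D" "?D = reindex ?g ?G"
    by (simp_all add: fun_eq_iff reindex_def gap_def otensor_def ident_def
        entry del: choi_UNIV)
  then have "psd UNIV ?D \<longleftrightarrow> psd UNIV ?G" by (metis psd_UNIV_reindex)
  moreover have "ptrace_snd (reindex (\<lambda>((a0, b0), a1). ((a0, a1), b0)) \<gamma>)
       = otensor max_mixed (ptrace_fst \<gamma>) \<longleftrightarrow>
    (\<forall>a a' r r'. (\<Sum>p\<in>UNIV. \<gamma> ((a, p), r) ((a', p), r')) =
      (if a = a' then (\<Sum>x\<in>UNIV. \<gamma> (x, r) (x, r')) / of_nat CARD('a0) else 0))"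
  proof -
    have "otensor max_mixed (ptrace_fst \<gamma>) (a, r) (a', r') =
      (if a = a' then (\<Sum>x\<in>UNIV. \<gamma> (x, r) (x, r')) / of_nat CARD('a0) else 0)" for a a' :: 'a0 and r r'
      by (simp add: otensor_def max_mixed_def ident_def oscale_def ptrace_fst_def)
    then show ?thesis by (simp add: fun_eq_iff ptrace_snd_def reindex_def) blast
  qed
  ultimately show ?thesis unfolding Hmin_feasible_def by blast
qed

subsection \<open>Superchannels\<close>

lemma oscale_zero [simp]: "oscale 0 X = 0"
  by (simp add: oscale_def zero_fun_def)

lemma oscale_0_right [simp]: "oscale c 0 = 0"
  by (simp add: oscale_def zero_fun_def)

lemma oscale_apply: "oscale c X i j = c * X i j"
  by (simp add: oscale_def)

lemma superlinear_0:
  assumes "superlinear \<Theta>"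
  shows "\<Theta> (\<lambda>_. 0) = (\<lambda>_. 0)"
proof -
  have "linmap UNIV UNIV (\<lambda>_. 0)" by (simp add: linmap_UNIV)
  then have "\<Theta> (\<lambda>X. oscale 0 ((\<lambda>_. 0) X)) = (\<lambda>Y. oscale 0 (\<Theta> (\<lambda>_. 0) Y))"
    using assms unfolding superlinear_def by blast
  then show ?thesis by simp
qed

lemma linmap_scale: "linmap UNIV UNIV N \<Longrightarrow> linmap UNIV UNIV (\<lambda>X. oscale c (N X))"
  by (simp add: linmap_UNIV) (simp add: oscale_def fun_eq_iff algebra_simps)

lemma linmap_add: "linmap UNIV UNIV N \<Longrightarrow> linmap UNIV UNIV M \<Longrightarrow> linmap UNIV UNIV (N + M)"
  by (simp add: linmap_UNIV) (simp add: oscale_def fun_eq_iff algebra_simps)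

text \<open>\<open>superlinear\<close> gives additivity on linear maps only, so the induction has to
  carry along that the combination is linear.\<close>

lemma superlinear_lincomb:
  assumes "superlinear \<Theta>" "finite J" "linmap UNIV UNIV M" "\<And>j. j \<in> J \<Longrightarrow> linmap UNIV UNIV (N j)"
  shows "\<Theta> (\<lambda>X. oscale c (M X) + (\<Sum>j\<in>J. oscale (d j) (N j X)))
      = (\<lambda>Y. oscale c (\<Theta> M Y) + (\<Sum>j\<in>J. oscale (d j) (\<Theta> (N j) Y))) \<and>
    linmap UNIV UNIV (\<lambda>X. oscale c (M X) + (\<Sum>j\<in>J. oscale (d j) (N j X)))"
  using assms(2,4)
proof (induction J rule: finite_induct)
  case empty
  then show ?case using assms(1,3) linmap_scale[OF assms(3), of c] by (simp add: superlinear_def)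
next
  case (insert j J)
  let ?P = "\<lambda>X. oscale c (M X) + (\<Sum>j\<in>J. oscale (d j) (N j X))"
  let ?Q = "\<lambda>X. oscale (d j) (N j X)"
  have P: "linmap UNIV UNIV ?P" and Q: "linmap UNIV UNIV ?Q"
    using insert linmap_scale by blast+
  have split: "(\<lambda>X. oscale c (M X) + (\<Sum>j\<in>insert j J. oscale (d j) (N j X))) = ?P + ?Q"
    using insert.hyps by (simp add: fun_eq_iff add_ac)
  have "\<Theta> (?P + ?Q) = \<Theta> ?P + \<Theta> ?Q"
    using P Q assms(1) unfolding superlinear_def by blast
  moreover have "\<Theta> ?P = (\<lambda>Y. oscale c (\<Theta> M Y) + (\<Sum>j\<in>J. oscale (d j) (\<Theta> (N j) Y)))"
    using insert by blast
  moreover have "\<Theta> ?Q = (\<lambda>Y. oscale (d j) (\<Theta> (N j) Y))"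
    using insert assms(1) unfolding superlinear_def by blast
  ultimately show ?case
    unfolding split using linmap_add[OF P Q] insert.hyps by (simp add: fun_eq_iff add_ac)
qed

section \<open>The extended superchannel on matrix units\<close>

definition slice :: "(('c0 \<times> 'a0) op \<Rightarrow> ('c1 \<times> 'a1) op) \<Rightarrow> 'c0 \<Rightarrow> 'c0 \<Rightarrow> 'c1 \<Rightarrow> 'c1 \<Rightarrow> 'a0 op \<Rightarrow> 'a1 op" where
  "slice \<Omega> i j k l = (\<lambda>Y. block (\<Omega> (otensor (munit i j) Y)) k l)"

lemma otensor_munit_in_ops: "i \<in> C \<Longrightarrow> j \<in> C \<Longrightarrow> otensor (munit i j) Y \<in> ops (C \<times> UNIV)"
  by (auto simp: ops_def otensor_def munit_def)

lemma linmap_slice: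
  assumes "linmap (C0 \<times> UNIV) (C1 \<times> UNIV) \<Omega>" "i \<in> C0" "j \<in> C0"
  shows "linmap UNIV UNIV (slice \<Omega> i j k l)"
  unfolding linmap_UNIV
proof (intro conjI allI)
  fix X Y c
  note in_ops = otensor_munit_in_ops[OF assms(2,3)]
  have "\<Omega> (otensor (munit i j) X + otensor (munit i j) Y)
      = \<Omega> (otensor (munit i j) X) + \<Omega> (otensor (munit i j) Y)"
    using assms(1) in_ops unfolding linmap_def by blast
  moreover have "otensor (munit i j) (X + Y) = otensor (munit i j) X + otensor (munit i j) Y"
    by (simp add: otensor_def fun_eq_iff algebra_simps)
  ultimately show "slice \<Omega> i j k l (X + Y) = slice \<Omega> i j k l X + slice \<Omega> i j k l Y"
    by (simp add: slice_def block_def) (simp add: fun_eq_iff)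
  have "\<Omega> (oscale c (otensor (munit i j) X)) = oscale c (\<Omega> (otensor (munit i j) X))"
    using assms(1) in_ops unfolding linmap_def by blast
  moreover have "otensor (munit i j) (oscale c X) = oscale c (otensor (munit i j) X)"
    by (simp add: otensor_def oscale_def fun_eq_iff algebra_simps)
  ultimately show "slice \<Omega> i j k l (oscale c X) = oscale c (slice \<Omega> i j k l X)"
    by (simp add: slice_def block_def oscale_def)
qed

lemma choi_slice: "choi UNIV (slice \<Omega> i j k l) (a, p) (b, q) = \<Omega> (munit (i, a) (j, b)) (k, p) (l, q)"
  by (simp add: slice_def block_def munit_prod)

lemma superext_slice:
  "superext C0 \<Theta> \<Omega> Z (k, p) (l, q) = (\<Sum>i\<in>C0. \<Sum>j\<in>C0. \<Theta> (slice \<Omega> i j k l) (block Z i j) p q)"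
  by (simp add: superext_def slice_def)

lemma linmap_superext:
  assumes "superlinear \<Theta>" "linmap (C0 \<times> UNIV) (C1 \<times> UNIV) \<Omega>"
  shows "linmap (C0 \<times> UNIV) (C1 \<times> UNIV) (superext C0 \<Theta> \<Omega>)"
proof -
  have lin: "linmap UNIV UNIV (\<Theta> (slice \<Omega> i j k l))" if "i \<in> C0" "j \<in> C0" for i j k l
    using assms(1) linmap_slice[OF assms(2) that] unfolding superlinear_def by blast
  have "slice \<Omega> i j k l = (\<lambda>_. 0)" if "i \<in> C0" "j \<in> C0" "k \<notin> C1 \<or> l \<notin> C1" for i j k l
  proof -
    have "\<Omega> (otensor (munit i j) Y) \<in> ops (C1 \<times> UNIV)" for Y
      using assms(2) otensor_munit_in_ops[OF that(1,2)] unfolding linmap_def by blast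
    then show ?thesis using that(3) by (auto simp: slice_def block_def ops_def fun_eq_iff)
  qed
  then have zero: "\<Theta> (slice \<Omega> i j k l) Y p q = 0"
    if "i \<in> C0" "j \<in> C0" "k \<notin> C1 \<or> l \<notin> C1" for i j k l Y p q
    using that superlinear_0[OF assms(1)] by simp
  have add: "\<Theta> (slice \<Omega> i j k l) (block (X + Y) i j) p q
      = \<Theta> (slice \<Omega> i j k l) (block X i j) p q + \<Theta> (slice \<Omega> i j k l) (block Y i j) p q"
    if "i \<in> C0" "j \<in> C0" for i j k l X Y p q
  proof -
    have "block (X + Y) i j = block X i j + block Y i j" by (simp add: block_def fun_eq_iff)
    then show ?thesis using lin[OF that] by (simp add: linmap_UNIV)
  qed
  have scale: "\<Theta> (slice \<Omega> i j k l) (block (oscale c X) i j) p q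
      = c * \<Theta> (slice \<Omega> i j k l) (block X i j) p q"
    if "i \<in> C0" "j \<in> C0" for i j k l X c p q
  proof -
    have "block (oscale c X) i j = oscale c (block X i j)" by (simp add: block_def oscale_def)
    then show ?thesis using lin[OF that] by (simp add: linmap_UNIV) (simp add: oscale_def)
  qed
  show ?thesis
    unfolding linmap_def
    by (auto simp: ops_def fun_eq_iff superext_slice zero add scale sum.distrib sum_distrib_left
        oscale_def[of _ "superext _ _ _ _"] intro!: sum.neutral)
qed

lemma superext_munit:
  assumes "finite C0" "superlinear \<Theta>" "linmap (C0 \<times> UNIV) (C1 \<times> UNIV) \<Omega>" "i \<in> C0" "j \<in> C0"
  shows "superext C0 \<Theta> \<Omega> (munit (i, b) (j, b')) (k, p) (l, q)
    = \<Theta> (slice \<Omega> i j k l) (munit b b') p q"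
proof -
  have "\<Theta> (slice \<Omega> x y k l) (block (munit (i, b) (j, b')) x y) p q
      = (if x = i \<and> y = j then 1 else 0) * \<Theta> (slice \<Omega> x y k l) (munit b b') p q"
    if "x \<in> C0" "y \<in> C0" for x y
  proof -
    have "block (munit (i, b) (j, b')) x y = oscale (if x = i \<and> y = j then 1 else 0) (munit b b')"
      by (auto simp: block_def munit_def oscale_def fun_eq_iff)
    moreover have "linmap UNIV UNIV (\<Theta> (slice \<Omega> x y k l))"
      using assms(2) linmap_slice[OF assms(3) that] unfolding superlinear_def by blast
    ultimately show ?thesis by (simp add: linmap_UNIV) (simp add: oscale_def)
  qed
  then show ?thesis using assms(1,4,5) by (simp add: superext_slice sum_delta2)
qed

text \<open>
  \<open>J\<close> is the Choi matrix of the superchannel.  No transposition occurs because the contraction pairs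
  the entries of \<open>choi UNIV N\<close> and \<open>J\<close> at equal, not at exchanged, indices.
\<close>

definition super_of ::
  "(('a0 \<times> 'a1) \<times> ('b0 \<times> 'b1)) op \<Rightarrow> ('a0::finite op \<Rightarrow> 'a1::finite op) \<Rightarrow> 'b0 op \<Rightarrow> 'b1 op" where
  "super_of J N = lmap UNIV (\<lambda>u u'. \<Sum>x\<in>UNIV. \<Sum>x'\<in>UNIV. choi UNIV N x x' * J (x, u) (x', u'))"

lemma super_of_munit:
  fixes J :: "(('a0::finite \<times> 'a1::finite) \<times> ('b0::finite \<times> 'b1::finite)) op"
  shows "super_of J N (munit b b') p q
    = (\<Sum>x\<in>UNIV. \<Sum>x'\<in>UNIV. choi UNIV N x x' * J (x, (b, p)) (x', (b', q)))"
  by (simp add: super_of_def lmap_munit)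

lemma superlinear_super_of:
  fixes J :: "(('a0::finite \<times> 'a1::finite) \<times> ('b0::finite \<times> 'b1::finite)) op"
  shows "superlinear (super_of J)"
  unfolding superlinear_def
proof (intro conjI allI impI)
  show "linmap UNIV UNIV (super_of J N)" for N
    unfolding super_of_def using linmap_lmap[of _ UNIV UNIV] by simp
  have choi_add: "choi UNIV (N + M) x x' = choi UNIV N x x' + choi UNIV M x x'"
    for N M :: "'a0 op \<Rightarrow> 'a1 op" and x x'
    by (cases x; cases x') simp
  show "super_of J (N + M) = super_of J N + super_of J M" for N M
    by (simp add: super_of_def lmap_def fun_eq_iff choi_add algebra_simps sum.distrib)
  have choi_scale: "choi UNIV (\<lambda>X. oscale c (N X)) x x' = c * choi UNIV N x x'"
    for N :: "'a0 op \<Rightarrow> 'a1 op" and c x x'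
    by (cases x; cases x') (simp add: oscale_def)
  show "super_of J (\<lambda>X. oscale c (N X)) = (\<lambda>Y. oscale c (super_of J N Y))" for c N
    by (simp add: super_of_def lmap_def fun_eq_iff choi_scale oscale_apply algebra_simps sum_distrib_left)
qed

text \<open>Once the ancilla indices are grouped together, the Choi matrix of the extended image is
  the contraction of \<open>choi ?S \<Omega>\<close> with \<open>J\<close> over A, hence positive.
  For the trace, \<open>no_signalling\<close> leaves the identity on A1, so \<open>N\<close> enters
  only through its Choi marginal on A0; this is the identity for trace-preserving \<open>N\<close>,
  and \<open>normalised\<close> finishes.\<close>

lemma superchannel_super_of:
  fixes J :: "(('a0::finite \<times> 'a1::finite) \<times> ('b0::finite \<times> 'b1::finite)) op"
  assumes J: "psd UNIV J"
    and no_signalling: "\<And>a s b a' s' b'. (\<Sum>p\<in>UNIV. J ((a, s), (b, p)) ((a', s'), (b', p)))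
      = (if s = s' then \<sigma> (a, b) (a', b') else 0)"
    and normalised: "\<And>b b'. (\<Sum>a\<in>UNIV. \<sigma> (a, b) (a, b')) = (if b = b' then 1 else 0)"
  shows "superchannel (super_of J)"
  unfolding superchannel_def
proof (intro conjI allI impI superlinear_super_of)
  fix c0 c1 :: nat and \<Omega> :: "(nat \<times> 'a0) op \<Rightarrow> (nat \<times> 'a1) op"
  let ?S = "{..<c0} \<times> (UNIV :: 'a0 set)" and ?T = "{..<c1} \<times> (UNIV :: 'a1 set)"
  let ?E = "superext {..<c0} (super_of J) \<Omega>"
  assume "cp ?S ?T \<Omega>"
  then have lin: "linmap ?S ?T \<Omega>" and psd: "psd (?S \<times> ?T) (choi ?S \<Omega>)"
    by (simp_all add: cp_iff_choi)
  note entry = superext_munit[OF finite_lessThan superlinear_super_of[of J] lin]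
  have linE: "linmap ({..<c0} \<times> UNIV) ({..<c1} \<times> UNIV) ?E"
    by (rule linmap_superext[OF superlinear_super_of lin])
  let ?R = "{..<c0} \<times> {..<c1}"
  define X where "X = (\<lambda>((i, k), (a, s)) ((j, l), (a', s')).
    if i < c0 \<and> k < c1 \<and> j < c0 \<and> l < c1 then choi ?S \<Omega> ((i, a), (k, s)) ((j, a'), (l, s')) else 0)"
  have X: "psd (?R \<times> UNIV) X"
    by (rule psd_compress[OF _ psd, where h = "\<lambda>((i, k), (a, s)). ((i, a), (k, s))"])
      (auto simp: X_def ops_def)
  define Z where "Z = (\<lambda>((i, k), (b, p)) ((j, l), (b', q)).
    if i < c0 \<and> k < c1 \<and> j < c0 \<and> l < c1 then ?E (munit (i, b) (j, b')) (k, p) (l, q) else 0)"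
  have "psd (?R \<times> UNIV) Z"
  proof (rule psd_contract[OF _ _ _ X])
    show "psd (UNIV \<times> UNIV) J" using J by simp
    show "Z \<in> ops (?R \<times> UNIV)" by (auto simp: Z_def ops_def)
  next
    fix s s' :: "nat \<times> nat" and u u' :: "'b0 \<times> 'b1"
    assume ss': "s \<in> ?R" "s' \<in> ?R"
    obtain i k j l b p b' q where [simp]: "s = (i, k)" "s' = (j, l)" "u = (b, p)" "u' = (b', q)"
      by (cases s, cases s', cases u, cases u')
    show "Z (s, u) (s', u') = (\<Sum>t\<in>UNIV. \<Sum>t'\<in>UNIV. X (s, t) (s', t') * J (t, u) (t', u'))"
      using ss' by (auto simp: Z_def entry super_of_munit X_def choi_slice choi_def[of ?S]
          simp del: choi_UNIV intro!: sum.cong)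
  qed auto
  then have "psd (({..<c0} \<times> UNIV) \<times> ({..<c1} \<times> UNIV)) (choi ({..<c0} \<times> UNIV) ?E)"
  proof (rule psd_compress[rotated, where h = "\<lambda>((i, b), (k, p)). ((i, k), (b, p))"])
    have "?E (munit x y) v w = 0"
      if "x \<in> {..<c0} \<times> UNIV" "y \<in> {..<c0} \<times> UNIV" "v \<notin> {..<c1} \<times> UNIV \<or> w \<notin> {..<c1} \<times> UNIV"
      for x y v w
      using linE munit_in_ops[OF that(1,2)] that(3) unfolding linmap_def ops_def by blast
    then show "choi ({..<c0} \<times> UNIV) ?E \<in> ops (({..<c0} \<times> UNIV) \<times> ({..<c1} \<times> UNIV))"
      unfolding ops_def choi_def by auto
  qed (auto simp: choi_def Z_def)
  then show "cp ({..<c0} \<times> UNIV) ({..<c1} \<times> UNIV) ?E"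
    using linE by (simp add: cp_iff_choi)
next
  fix N :: "'a0 op \<Rightarrow> 'a1 op"
  assume N: "linmap UNIV UNIV N \<and> trace_preserving N"
  have marg: "(\<Sum>s\<in>UNIV. choi UNIV N (a, s) (a', s)) = (if a = a' then 1 else 0)" for a a'
  proof -
    have "(\<Sum>s\<in>UNIV. choi UNIV N (a, s) (a', s)) = tr (N (munit a a'))" by (simp add: tr_def)
    then show ?thesis using N by (simp add: trace_preserving_def tr_munit)
  qed
  have "(\<Sum>p\<in>UNIV. \<Sum>x\<in>UNIV. \<Sum>x'\<in>UNIV. choi UNIV N x x' * J (x, (b, p)) (x', (b', p)))
      = (if b = b' then 1 else 0)" for b b'
  proof -
    have "(\<Sum>p\<in>UNIV. \<Sum>x\<in>UNIV. \<Sum>x'\<in>UNIV. choi UNIV N x x' * J (x, (b, p)) (x', (b', p)))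
      = (\<Sum>x\<in>UNIV. \<Sum>p\<in>UNIV. \<Sum>x'\<in>UNIV. choi UNIV N x x' * J (x, (b, p)) (x', (b', p)))"
      by (rule sum.swap)
    also have "\<dots> = (\<Sum>x\<in>UNIV. \<Sum>x'\<in>UNIV. choi UNIV N x x' * (\<Sum>p\<in>UNIV. J (x, (b, p)) (x', (b', p))))"
      unfolding sum_distrib_left by (intro sum.cong refl sum.swap)
    also have "\<dots> = (\<Sum>a\<in>UNIV. \<Sum>s\<in>UNIV. \<Sum>a'\<in>UNIV. choi UNIV N (a, s) (a', s) * \<sigma> (a, b) (a', b'))"
      by (simp add: sum_UNIV_prod no_signalling if_distrib[of "\<lambda>z. _ * z"] cong: if_cong)
    also have "\<dots> = (\<Sum>a\<in>UNIV. \<Sum>a'\<in>UNIV. (\<Sum>s\<in>UNIV. choi UNIV N (a, s) (a', s)) * \<sigma> (a, b) (a', b'))"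
      unfolding sum_distrib_right by (intro sum.cong refl sum.swap)
    also have "\<dots> = (\<Sum>a\<in>UNIV. \<Sum>a'\<in>UNIV. if a = a' then \<sigma> (a, b) (a', b') else 0)"
      unfolding marg by (intro sum.cong refl) simp
    finally show ?thesis using normalised by simp
  qed
  then show "trace_preserving (super_of J N)"
    unfolding trace_preserving_def super_of_def
    by (intro allI, subst tr_lmap_scaled[where c = 1]) simp_all
qed

section \<open>Applying a superchannel in the presence of a reference system\<close>

definition apply_super ::
  "(('a0::finite op \<Rightarrow> 'a1 op) \<Rightarrow> ('b0 op \<Rightarrow> 'b1 op)) \<Rightarrow> (('a0 \<times> 'a1) \<times> 't) op \<Rightarrow> (('b0 \<times> 'b1) \<times> 't) op" where
  "apply_super \<Theta> D = (\<lambda>(y, t) (y', t'). choi UNIV (\<Theta> (lmap UNIV (\<lambda>x x'. D (x, t) (x', t')))) y y')"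

text \<open>The reference systems act as the ancilla party in complete positivity: \<open>D\<close>
  is read as the Choi matrix of a completely positive map \<Omega> on the ancilla and A, and its
  blocks are the slices of \<Omega>. The enumerations \<open>e0\<close> and \<open>e1\<close> move
  the reference to initial segments of the natural numbers, as \<open>superchannel\<close>
  demands.\<close>

lemma psd_apply_super:
  fixes D :: "(('a0::finite \<times> 'a1::finite) \<times> ('r0::finite \<times> 'r1::finite)) op"
    and \<Theta> :: "('a0 op \<Rightarrow> 'a1 op) \<Rightarrow> ('b0::finite op \<Rightarrow> 'b1::finite op)"
  assumes \<Theta>: "superchannel \<Theta>" and D: "psd UNIV D"
  shows "psd UNIV (apply_super \<Theta> D)"
proof -
  define c0 c1 where "c0 = CARD('r0)" and "c1 = CARD('r1)"
  obtain e0 :: "'r0 \<Rightarrow> nat" where e0: "bij_betw e0 UNIV {..<c0}"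
    unfolding c0_def using ex_bij_betw_finite_nat[of "UNIV :: 'r0 set"] by (auto simp: lessThan_atLeast0)
  obtain e1 :: "'r1 \<Rightarrow> nat" where e1: "bij_betw e1 UNIV {..<c1}"
    unfolding c1_def using ex_bij_betw_finite_nat[of "UNIV :: 'r1 set"] by (auto simp: lessThan_atLeast0)
  define d0 d1 where "d0 = inv e0" and "d1 = inv e1"
  have de [simp]: "d0 (e0 r) = r" "d1 (e1 s) = s" for r s
    using e0 e1 by (simp_all add: d0_def d1_def bij_betw_def)
  have lt [simp]: "e0 r < c0" "e1 s < c1" for r s
    using e0 e1 by (auto simp: bij_betw_def)
  let ?S = "{..<c0} \<times> (UNIV :: 'a0 set)" and ?T = "{..<c1} \<times> (UNIV :: 'a1 set)"
  define D' where "D' = (\<lambda>((i, a), (k, s)) ((j, a'), (l, s')). if i < c0 \<and> k < c1 \<and> j < c0 \<and> l < c1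
      then D ((a, s), (d0 i, d1 k)) ((a', s'), (d0 j, d1 l)) else 0)"
  have D': "psd (?S \<times> ?T) D'"
    by (rule psd_compress[OF _ D, where h = "\<lambda>((i, a), (k, s)). ((a, s), (d0 i, d1 k))"])
      (auto simp: D'_def ops_def)
  define \<Omega> where "\<Omega> = lmap ?S D'"
  have D'_ops: "D' \<in> ops (?S \<times> ?T)" using D' unfolding psd_def by blast
  have lin: "linmap ?S ?T \<Omega>"
    unfolding \<Omega>_def by (rule linmap_lmap[OF D'_ops])
  have "choi ?S \<Omega> = D'"
    unfolding \<Omega>_def by (rule choi_lmap[OF _ D'_ops]) simp
  then have "cp ?S ?T \<Omega>" using lin D' by (simp add: cp_iff_choi)
  then have "cp ({..<c0} \<times> UNIV) ({..<c1} \<times> UNIV) (superext {..<c0} \<Theta> \<Omega>)"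
    using \<Theta> unfolding superchannel_def by blast
  then have psd: "psd (({..<c0} \<times> UNIV) \<times> ({..<c1} \<times> UNIV)) (choi ({..<c0} \<times> UNIV) (superext {..<c0} \<Theta> \<Omega>))"
    by (simp add: cp_iff_choi)
  have slice: "slice \<Omega> (e0 r) (e0 r') (e1 s) (e1 s') = lmap UNIV (\<lambda>x x'. D (x, (r, s)) (x', (r', s')))"
    for r r' s s'
  proof -
    have "linmap UNIV UNIV (slice \<Omega> (e0 r) (e0 r') (e1 s) (e1 s'))"
      by (rule linmap_slice[OF lin]) simp_all
    moreover have "choi UNIV (slice \<Omega> (e0 r) (e0 r') (e1 s) (e1 s')) = (\<lambda>x x'. D (x, (r, s)) (x', (r', s')))"
      by (simp add: fun_eq_iff choi_slice \<Omega>_def lmap_munit D'_def del: choi_UNIV)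
    ultimately show ?thesis using lmap_choi by metis
  qed
  have sl: "superlinear \<Theta>" using \<Theta> by (simp add: superchannel_def)
  define h :: "('b0 \<times> 'b1) \<times> ('r0 \<times> 'r1) \<Rightarrow> (nat \<times> 'b0) \<times> (nat \<times> 'b1)"
    where "h = (\<lambda>((b, p), (r, s)). ((e0 r, b), (e1 s, p)))"
  show ?thesis
  proof (rule psd_compress[OF _ psd, where h = h])
    fix x y :: "('b0 \<times> 'b1) \<times> ('r0 \<times> 'r1)"
    obtain b p r s b' p' r' s' where [simp]: "x = ((b, p), (r, s))" "y = ((b', p'), (r', s'))"
      by (cases x, cases y) auto
    show "apply_super \<Theta> D x y = choi ({..<c0} \<times> UNIV) (superext {..<c0} \<Theta> \<Omega>) (h x) (h y)"
      by (simp add: h_def choi_def[of "{..<c0} \<times> UNIV"] superext_munit[OF _ sl lin] slice apply_super_def)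
  qed auto
qed

text \<open>A superchannel is constrained directly on trace-preserving maps only. Adding
  \<open>1 - c\<close> times the channel \<open>N0\<close> to \<open>N\<close> gives such a map, and
  linearity of \<Theta> then isolates the trace of \<open>\<Theta> N Y\<close>.\<close>

lemma tr_superchannel:
  fixes \<Theta> :: "('a0::finite op \<Rightarrow> 'a1::finite op) \<Rightarrow> ('b0::finite op \<Rightarrow> 'b1::finite op)"
    and N N0 :: "'a0 op \<Rightarrow> 'a1 op"
  assumes \<Theta>: "superchannel \<Theta>" and N: "linmap UNIV UNIV N" "\<And>X. tr (N X) = c * tr X"
    and N0: "channel N0"
  shows "tr (\<Theta> N Y) = c * tr Y"
proof -
  have N0': "linmap UNIV UNIV N0" "\<And>X. tr (N0 X) = tr X"
    using channelD[OF N0] by (simp_all add: trace_preserving_def)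
  have sl: "superlinear \<Theta>" using \<Theta> by (simp add: superchannel_def)
  have tr_comb: "tr (oscale a X + oscale b Z) = a * tr X + b * tr Z" for a b and X Z :: "'z::finite op"
    by (simp add: tr_def oscale_def sum.distrib sum_distrib_left)
  let ?M = "\<lambda>X. oscale 1 (N X) + oscale (1 - c) (N0 X)"
  have comb: "\<Theta> ?M = (\<lambda>Y. oscale 1 (\<Theta> N Y) + oscale (1 - c) (\<Theta> N0 Y))"
    and lin: "linmap UNIV UNIV ?M"
    using superlinear_lincomb[OF sl, of "{0::nat}" N "\<lambda>_. N0" 1 "\<lambda>_. 1 - c"] N(1) N0'(1) by simp_all
  have "trace_preserving ?M"
    by (simp add: trace_preserving_def tr_comb N(2) N0'(2) algebra_simps)
  then have "tr (\<Theta> ?M Y) = tr Y"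
    using \<Theta> lin unfolding superchannel_def trace_preserving_def by blast
  moreover have "tr (\<Theta> N0 Y) = tr Y"
    using \<Theta> N0' unfolding superchannel_def trace_preserving_def by blast
  ultimately show ?thesis by (simp add: comb tr_comb algebra_simps)
qed

lemma sum_rotate: "(\<Sum>x\<in>A. \<Sum>y\<in>B. \<Sum>z\<in>C. f x y z) = (\<Sum>z\<in>C. \<Sum>x\<in>A. \<Sum>y\<in>B. f x y z)"
  by (rule trans[OF sum.cong[OF refl sum.swap] sum.swap])

subsection \<open>Feasible operators and the min-entropy\<close>

lemma lmap_add: "lmap S (\<lambda>x x'. C x x' + D x x') X = lmap S C X + lmap S D X"
  by (simp add: lmap_def fun_eq_iff algebra_simps sum.distrib)

lemma lmap_scale: "lmap S (\<lambda>x x'. c * C x x') X = oscale c (lmap S C X)"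
  by (simp add: lmap_def fun_eq_iff oscale_apply algebra_simps sum_distrib_left)

lemma lmap_lincomb:
  assumes "finite J"
  shows "lmap S (\<lambda>x x'. c * C x x' + (\<Sum>j\<in>J. d j * D j x x')) X
    = oscale c (lmap S C X) + (\<Sum>j\<in>J. oscale (d j) (lmap S (D j) X))"
  using assms
proof (induction J rule: finite_induct)
  case empty
  then show ?case by (simp add: lmap_scale)
next
  case (insert j J)
  then show ?case
    using lmap_add[of S "\<lambda>x x'. d j * D j x x'" "\<lambda>x x'. c * C x x' + (\<Sum>j\<in>J. d j * D j x x')" X]
    by (simp add: add_ac lmap_scale)
qed

text \<open>For fixed indices of the reference, the block of the gap is a linear combination of the
  block of \<gamma> and the Choi matrices of the \<open>\<Psi> j\<close>, so linearity of \<Theta>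
  suffices.\<close>

lemma apply_super_gap:
  fixes \<gamma> :: "(('a0::finite \<times> 'a1::finite) \<times> 'r) op" and L :: "nat \<Rightarrow> ('r \<times> 's) op"
    and \<Theta> :: "('a0 op \<Rightarrow> 'a1 op) \<Rightarrow> ('b0::finite op \<Rightarrow> 'b1::finite op)"
  assumes "superlinear \<Theta>" "\<forall>j\<in>{1..n}. linmap UNIV UNIV (\<Psi> j)"
  shows "apply_super \<Theta> (gap c n (\<lambda>j. choi UNIV (\<Psi> j)) L \<gamma>)
    = gap c n (\<lambda>j. choi UNIV (\<Theta> (\<Psi> j))) L (apply_super \<Theta> \<gamma>)"
proof -
  have "apply_super \<Theta> (gap c n (\<lambda>j. choi UNIV (\<Psi> j)) L \<gamma>) (y, (r, s)) (y', (r', s'))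
    = gap c n (\<lambda>j. choi UNIV (\<Theta> (\<Psi> j))) L (apply_super \<Theta> \<gamma>) (y, (r, s)) (y', (r', s'))"
    for y r s y' r' s'
  proof -
    define d where "d = (if s = s' then 1 else 0 :: complex)"
    define e where "e j = - c * L j (r, s) (r', s')" for j
    define M where "M = lmap UNIV (\<lambda>x x'. \<gamma> (x, r) (x', r'))"
    have "(\<lambda>x x'. gap c n (\<lambda>j. choi UNIV (\<Psi> j)) L \<gamma> (x, (r, s)) (x', (r', s')))
      = (\<lambda>x x'. d * \<gamma> (x, r) (x', r') + (\<Sum>j\<in>{1..n}. e j * choi UNIV (\<Psi> j) x x'))"
      by (simp add: gap_def d_def e_def sum_distrib_left sum_negf mult_ac fun_eq_iff del: choi_UNIV)
    moreover have "lmap UNIV (\<lambda>x x'. d * \<gamma> (x, r) (x', r') + (\<Sum>j\<in>{1..n}. e j * choi UNIV (\<Psi> j) x x'))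
      = (\<lambda>X. oscale d (M X) + (\<Sum>j\<in>{1..n}. oscale (e j) (\<Psi> j X)))"
      using assms(2) by (simp add: fun_eq_iff lmap_lincomb lmap_choi M_def)
    moreover have "\<Theta> (\<lambda>X. oscale d (M X) + (\<Sum>j\<in>{1..n}. oscale (e j) (\<Psi> j X)))
      = (\<lambda>Y. oscale d (\<Theta> M Y) + (\<Sum>j\<in>{1..n}. oscale (e j) (\<Theta> (\<Psi> j) Y)))"
    proof (rule superlinear_lincomb[OF assms(1), THEN conjunct1])
      show "linmap UNIV UNIV M" unfolding M_def using linmap_lmap[of _ UNIV UNIV] by simp
    qed (use assms(2) in auto)
    ultimately have "apply_super \<Theta> (gap c n (\<lambda>j. choi UNIV (\<Psi> j)) L \<gamma>) (y, (r, s)) (y', (r', s'))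
      = choi UNIV (\<lambda>Y. oscale d (\<Theta> M Y) + (\<Sum>j\<in>{1..n}. oscale (e j) (\<Theta> (\<Psi> j) Y))) y y'"
      by (simp add: apply_super_def)
    also have "\<dots> = d * choi UNIV (\<Theta> M) y y' + (\<Sum>j\<in>{1..n}. e j * choi UNIV (\<Theta> (\<Psi> j)) y y')"
      by (cases y, cases y') (simp add: oscale_apply sum_op_apply)
    also have "\<dots> = gap c n (\<lambda>j. choi UNIV (\<Theta> (\<Psi> j))) L (apply_super \<Theta> \<gamma>) (y, (r, s)) (y', (r', s'))"
      by (simp add: gap_def d_def e_def sum_distrib_left sum_negf mult_ac apply_super_def M_def)
    finally show ?thesis .
  qed
  then show ?thesis by (simp add: fun_eq_iff)
qed

lemma psd_scale:
  assumes "psd S X" "r \<ge> 0"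
  shows "psd S (oscale (of_real r) X)"
proof -
  have "qform S (oscale (of_real r) X) v = of_real r * qform S X v" for v
    by (simp add: qform_def oscale_apply sum_distrib_left mult_ac)
  then show ?thesis using assms by (simp add: psd_iff_qform oscale_in_ops)
qed

lemma oscale_gap: "oscale a (gap c n C L \<gamma>) = gap (a * c) n C L (oscale a \<gamma>)"
  by (auto simp: gap_def oscale_def fun_eq_iff algebra_simps)

lemma psd_cnj: "cnj (X j i) = X i j" if "psd UNIV X" for X :: "'i::finite op"
  using psd_hermitian[OF finite that] unfolding hermitian_def by metis

lemma tr_prod: "tr X = (\<Sum>x\<in>UNIV. \<Sum>t\<in>UNIV. X (x, t) (x, t))"
  for X :: "('x::finite \<times> 't::finite) op"
  unfolding tr_def by (rule sum_UNIV_prod)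

text \<open>Fixing one index \<open>s\<close> on both sides isolates \<gamma> as a block of the
  positive gap plus a real multiple of a Hermitian sum.\<close>

lemma hermitian_of_gap:
  fixes \<gamma> :: "('x::finite \<times> 'r::finite) op" and L :: "nat \<Rightarrow> ('r \<times> 's::finite) op"
  assumes "psd UNIV (gap (of_real c) n C L \<gamma>)"
    and "\<forall>j\<in>{1..n}. psd UNIV (C j)" "\<forall>j\<in>{1..n}. psd UNIV (L j)"
  shows "hermitian \<gamma>"
proof -
  fix s :: 's
  let ?G = "gap (of_real c) n C L \<gamma>"
  let ?F = "\<lambda>x r x' r'. \<Sum>j\<in>{1..n}. C j x x' * L j (r, s) (r', s)"
  have F: "cnj (?F x' r' x r) = ?F x r x' r'" for x r x' r'
  proof -
    have "cnj (C j x' x) = C j x x'" "cnj (L j (r', s) (r, s)) = L j (r, s) (r', s)"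
      if "j \<in> {1..n}" for j
      by (rule psd_cnj[OF bspec[OF assms(2) that]], rule psd_cnj[OF bspec[OF assms(3) that]])
    then show ?thesis by simp
  qed
  have G: "cnj (?G (x', r', s) (x, r, s)) = ?G (x, r, s) (x', r', s)" for x r x' r'
    by (rule psd_cnj[OF assms(1)])
  have \<gamma>: "\<gamma> (x, r) (x', r') = ?G (x, r, s) (x', r', s) + of_real c * ?F x r x' r'" for x r x' r'
    by (simp add: gap_def)
  have "\<gamma> (x, r) (x', r') = cnj (\<gamma> (x', r') (x, r))" for x r x' r'
    unfolding \<gamma> complex_cnj_add complex_cnj_mult complex_cnj_complex_of_real F G ..
  then show ?thesis unfolding hermitian_def split_paired_All by blast
qed

lemma Hmin_feasible_superchannel:
  fixes \<Psi> :: "nat \<Rightarrow> 'a0::finite op \<Rightarrow> 'a1::finite op"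
    and \<Lambda> :: "nat \<Rightarrow> 'r0::finite op \<Rightarrow> 'r1::finite op"
    and \<Theta> :: "('a0 op \<Rightarrow> 'a1 op) \<Rightarrow> ('b0::finite op \<Rightarrow> 'b1::finite op)"
  assumes n: "n \<ge> 1" and \<Theta>: "superchannel \<Theta>"
    and \<Psi>: "\<forall>j\<in>{1..n}. channel (\<Psi> j)" and \<Phi>: "\<forall>j\<in>{1..n}. channel (\<Theta> (\<Psi> j))"
    and \<Lambda>: "\<forall>j\<in>{1..n}. channel (\<Lambda> j)"
    and \<gamma>: "\<gamma> \<in> Hmin_feasible (average_tensor n \<Psi> \<Lambda>)"
  obtains \<gamma>' where "\<gamma>' \<in> Hmin_feasible (average_tensor n (\<lambda>j. \<Theta> (\<Psi> j)) \<Lambda>)" "tr \<gamma>' = tr \<gamma>"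
proof -
  let ?a = "of_nat CARD('a0) :: complex" and ?b = "of_nat CARD('b0) :: complex"
  let ?r = "of_nat CARD('r0) :: complex" and ?L = "\<lambda>j. choi UNIV (\<Lambda> j)"
  have sl: "superlinear \<Theta>" using \<Theta> by (simp add: superchannel_def)
  have lin: "\<forall>j\<in>{1..n}. linmap UNIV UNIV (\<Psi> j)" using \<Psi> channelD(1) by blast
  have feas: "psd UNIV (gap (1 / (?a * ?r * of_nat n)) n (\<lambda>j. choi UNIV (\<Psi> j)) ?L \<gamma>)"
    and marg: "(\<Sum>p\<in>UNIV. \<gamma> ((a, p), r) ((a', p), r')) =
      (if a = a' then (\<Sum>x\<in>UNIV. \<gamma> (x, r) (x, r')) / ?a else 0)" for a a' r r'
    using \<gamma> Hmin_feasible_average[OF \<Psi> \<Lambda>] by blast+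
  \<comment> \<open>The Choi states of the two averages carry the factors 1 / d_A0 and 1 / d_B0;
    multiplying by \<open>k\<close> converts one normalisation into the other.\<close>
  define k where "k = real CARD('a0) / real CARD('b0)"
  define \<gamma>' where "\<gamma>' = oscale (of_real k) (apply_super \<Theta> \<gamma>)"
  \<comment> \<open>The reduced operator of \<gamma> on R0. By \<open>w'\<close> below, \<gamma>'
    has the same one, whence the equal traces.\<close>
  define w where "w r r' = (\<Sum>x\<in>UNIV. \<gamma> (x, r) (x, r'))" for r r'
  have k: "of_real k = ?a / ?b" by (simp add: k_def)
  have c: "1 / (?b * ?r * of_nat n) = of_real k * (1 / (?a * ?r * of_nat n))" by (simp add: k)
  have gap: "gap (1 / (?b * ?r * of_nat n)) n (\<lambda>j. choi UNIV (\<Theta> (\<Psi> j))) ?L \<gamma>'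
    = oscale (of_real k) (apply_super \<Theta> (gap (1 / (?a * ?r * of_nat n)) n (\<lambda>j. choi UNIV (\<Psi> j)) ?L \<gamma>))"
    unfolding \<gamma>'_def apply_super_gap[OF sl lin] oscale_gap c ..
  have psd: "psd UNIV (gap (1 / (?b * ?r * of_nat n)) n (\<lambda>j. choi UNIV (\<Theta> (\<Psi> j))) ?L \<gamma>')"
    unfolding gap by (intro psd_scale psd_apply_super[OF \<Theta> feas]) (simp add: k_def)
  have "hermitian \<gamma>'"
  proof (rule hermitian_of_gap)
    show "psd UNIV (gap (of_real (1 / (real CARD('b0) * real CARD('r0) * real n))) n
      (\<lambda>j. choi UNIV (\<Theta> (\<Psi> j))) ?L \<gamma>')" using psd by simp
  qed (use channelD(2) \<Phi> \<Lambda> in blast)+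
  moreover have marg': "(\<Sum>p\<in>UNIV. \<gamma>' ((b, p), r) ((b', p), r')) = (if b = b' then w r r' / ?b else 0)"
    for b b' r r'
  proof -
    let ?N = "lmap UNIV (\<lambda>x x'. \<gamma> (x, r) (x', r'))"
    have "tr (?N X) = w r r' / ?a * tr X" for X
      by (rule tr_lmap_scaled) (simp add: marg w_def)
    \<comment> \<open>By the marginal condition \<open>?N\<close> multiplies traces by a constant,
      and \<Theta> keeps this constant. The auxiliary channel is \<open>\<Psi> 1\<close>, which
      exists because \<open>n \<ge> 1\<close>.\<close>
    then have "tr (\<Theta> ?N (munit b b')) = w r r' / ?a * tr (munit b b')"
      by (intro tr_superchannel[OF \<Theta> _ _ bspec[OF \<Psi>, of 1]]) (use n linmap_lmap[of _ UNIV UNIV] in simp_all)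
    moreover have "(\<Sum>p\<in>UNIV. \<gamma>' ((b, p), r) ((b', p), r')) = of_real k * tr (\<Theta> ?N (munit b b'))"
      by (simp add: \<gamma>'_def oscale_apply apply_super_def tr_def sum_distrib_left)
    ultimately show ?thesis by (simp add: k tr_munit)
  qed
  have w': "(\<Sum>x\<in>UNIV. \<gamma>' (x, r) (x, r')) = w r r'" for r r'
    unfolding sum_UNIV_prod[of "\<lambda>x. \<gamma>' (x, r) (x, r')"] marg' by simp
  ultimately have "\<gamma>' \<in> Hmin_feasible (average_tensor n (\<lambda>j. \<Theta> (\<Psi> j)) \<Lambda>)"
    using psd marg' by (subst Hmin_feasible_average[OF \<Phi> \<Lambda>]) (auto simp: w')
  moreover have "tr \<gamma>' = tr \<gamma>"
    unfolding tr_prod sum.swap[of _ UNIV "UNIV :: ('b0 \<times> 'b1) set"] w' by (subst sum.swap) (simp add: w_def)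
  ultimately show ?thesis by (rule that)
qed

section \<open>Bounds on the traces of feasible operators\<close>

lemma tr_psd:
  fixes X :: "'i::finite op"
  assumes "psd UNIV X"
  shows "Re (tr X) \<ge> 0" "Im (tr X) = 0"
  using psd_diag[OF _ assms] by (simp_all add: tr_def sum_nonneg)

lemma tr_choi_channel:
  fixes N :: "'i::finite op \<Rightarrow> 'k::finite op"
  assumes "channel N"
  shows "tr (choi UNIV N) = of_nat CARD('i)"
  unfolding tr_def sum_UNIV_prod channelD(4)[OF assms] by simp

lemma tr_gap:
  fixes \<gamma> :: "('x::finite \<times> 'r::finite) op" and L :: "nat \<Rightarrow> ('r \<times> 's::finite) op"
  shows "tr (gap c n C L \<gamma>) = of_nat CARD('s) * tr \<gamma> - c * (\<Sum>j\<in>{1..n}. tr (C j) * tr (L j))"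
proof -
  have "(\<Sum>x\<in>UNIV. \<Sum>t\<in>UNIV. \<Sum>j\<in>{1..n}. C j x x * L j t t) = (\<Sum>j\<in>{1..n}. tr (C j) * tr (L j))"
    unfolding tr_def sum_product by (rule sum_rotate)
  moreover have "gap c n C L \<gamma> (x, t) (x, t)
      = \<gamma> (x, fst t) (x, fst t) - (\<Sum>j\<in>{1..n}. c * (C j x x * L j t t))" for x t
    by (cases t) (simp add: gap_def sum_distrib_left)
  moreover have "(\<Sum>x\<in>UNIV. \<Sum>t\<in>(UNIV :: ('r \<times> 's) set). \<gamma> (x, fst t) (x, fst t)) = of_nat CARD('s) * tr \<gamma>"
    by (simp add: tr_prod sum_UNIV_prod[where 'a = 'r] sum_distrib_left)
  ultimately show ?thesis
    by (simp add: tr_prod sum_subtractf flip: sum_distrib_left)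
qed

text \<open>The positive gap has nonnegative trace, and the state subtracted in it has trace 1. The
  bound keeps the infimum away from 0, where the logarithm degenerates.\<close>

lemma Hmin_feasible_trace_ge:
  fixes \<Psi> :: "nat \<Rightarrow> 'a0::finite op \<Rightarrow> 'a1::finite op" and \<Lambda> :: "nat \<Rightarrow> 'r0::finite op \<Rightarrow> 'r1::finite op"
  assumes n: "n \<ge> 1" and \<Psi>: "\<forall>j\<in>{1..n}. channel (\<Psi> j)" and \<Lambda>: "\<forall>j\<in>{1..n}. channel (\<Lambda> j)"
    and \<gamma>: "\<gamma> \<in> Hmin_feasible (average_tensor n \<Psi> \<Lambda>)"
  shows "Re (tr \<gamma>) \<ge> 1 / CARD('r1)"
proof -
  let ?c = "1 / (of_nat CARD('a0) * of_nat CARD('r0) * of_nat n) :: complex"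
  let ?G = "gap ?c n (\<lambda>j. choi UNIV (\<Psi> j)) (\<lambda>j. choi UNIV (\<Lambda> j)) \<gamma>"
  have "psd UNIV ?G"
    using \<gamma> Hmin_feasible_average[OF \<Psi> \<Lambda>] by blast
  then have "Re (tr ?G) \<ge> 0" by (rule tr_psd)
  moreover have "tr ?G = of_nat CARD('r1) * tr \<gamma> - 1"
    using n \<Psi> \<Lambda> by (simp add: tr_gap tr_choi_channel)
  ultimately have "real CARD('r1) * Re (tr \<gamma>) \<ge> 1" by simp
  then show ?thesis by (simp add: field_simps)
qed

lemma hermitian_qform_real:
  fixes X :: "'i::finite op"
  assumes "hermitian X"
  shows "Im (qform UNIV X v) = 0"
proof -
  have X: "cnj (X i j) = X j i" for i j using assms unfolding hermitian_def by metis
  have "cnj (qform UNIV X v) = (\<Sum>i\<in>UNIV. \<Sum>j\<in>UNIV. cnj (v j) * X j i * v i)"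
    unfolding qform_def cnj_sum by (intro sum.cong refl) (simp add: X mult_ac)
  also have "\<dots> = qform UNIV X v" unfolding qform_def by (rule sum.swap)
  finally show ?thesis by (simp add: complex_eq_iff)
qed

text \<open>Each product of moduli of two entries of \<open>v\<close> is at most the squared norm of
  \<open>v\<close>, so the form of \<open>X\<close> is at most the sum of the moduli of its entries
  times that norm. This crude bound supplies a multiple of the identity above any Hermitian
  operator.\<close>

lemma psd_diagonally_dominated:
  fixes X :: "'i::finite op"
  assumes "hermitian X" and m: "(\<Sum>i\<in>UNIV. \<Sum>j\<in>UNIV. cmod (X i j)) \<le> m"
  shows "psd UNIV (\<lambda>i j. (if i = j then of_real m else 0) - X i j)" (is "psd UNIV ?D")
  unfolding psd_iff_qform
proof (intro conjI allI)
  fix v :: "'i \<Rightarrow> complex"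
  define V where "V = (\<Sum>i\<in>UNIV. (cmod (v i))\<^sup>2)"
  let ?q = "qform UNIV X v"
  have "qform UNIV ?D v = (\<Sum>i\<in>UNIV. \<Sum>j\<in>UNIV. if i = j then of_real m * (v i * cnj (v i)) else 0) - ?q"
    unfolding qform_def sum_subtractf[symmetric]
    by (intro sum.cong refl) (simp add: algebra_simps)
  also have "\<dots> = of_real (m * V) - ?q"
    by (simp only: complex_norm_square[symmetric]) (simp add: V_def sum_distrib_left)
  finally have q: "qform UNIV ?D v = of_real (m * V) - ?q" .
  then show "Im (qform UNIV ?D v) = 0" by (simp add: hermitian_qform_real[OF assms(1)])
  have "cmod ?q \<le> (\<Sum>i\<in>UNIV. \<Sum>j\<in>UNIV. cmod (X i j) * V)"
    unfolding qform_def
  proof (intro sum_norm_le)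
    fix i j
    have le: "(cmod (v k))\<^sup>2 \<le> V" for k
      unfolding V_def by (rule member_le_sum) auto
    have "2 * (cmod (v i) * cmod (v j)) \<le> (cmod (v i))\<^sup>2 + (cmod (v j))\<^sup>2"
      using sum_squares_bound[of "cmod (v i)" "cmod (v j)"] by (simp add: mult.assoc)
    then have "cmod (v i) * cmod (v j) \<le> V" using le[of i] le[of j] by linarith
    then have "cmod (X i j) * (cmod (v i) * cmod (v j)) \<le> cmod (X i j) * V"
      by (intro mult_left_mono) auto
    then show "cmod (cnj (v i) * X i j * v j) \<le> cmod (X i j) * V"
      by (simp add: norm_mult mult_ac)
  qed
  also have "\<dots> = (\<Sum>i\<in>UNIV. \<Sum>j\<in>UNIV. cmod (X i j)) * V" by (simp add: sum_distrib_right)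
  also have "\<dots> \<le> m * V" using m by (intro mult_right_mono) (simp_all add: V_def sum_nonneg)
  finally have "Re ?q \<le> m * V" using complex_Re_le_cmod[of ?q] by linarith
  then show "Re (qform UNIV ?D v) \<ge> 0" by (simp add: q)
qed simp

text \<open>A large multiple of the identity dominates the state and has a product marginal.\<close>

lemma Hmin_feasible_nonempty:
  fixes \<Psi> :: "nat \<Rightarrow> 'a0::finite op \<Rightarrow> 'a1::finite op" and \<Lambda> :: "nat \<Rightarrow> 'r0::finite op \<Rightarrow> 'r1::finite op"
  assumes \<Psi>: "\<forall>j\<in>{1..n}. channel (\<Psi> j)" and \<Lambda>: "\<forall>j\<in>{1..n}. channel (\<Lambda> j)"
  shows "Hmin_feasible (average_tensor n \<Psi> \<Lambda>) \<noteq> {}"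
proof -
  let ?c = "1 / (of_nat CARD('a0) * of_nat CARD('r0) * of_nat n) :: complex"
  define X where "X = (\<lambda>(x, t) (x', t'). ?c * (\<Sum>j\<in>{1..n}. choi UNIV (\<Psi> j) x x' * choi UNIV (\<Lambda> j) t t'))"
  have "hermitian X"
  proof -
    have "cnj (choi UNIV (\<Psi> j) x' x) = choi UNIV (\<Psi> j) x x'" "cnj (choi UNIV (\<Lambda> j) t' t) = choi UNIV (\<Lambda> j) t t'"
      if "j \<in> {1..n}" for j x x' t t'
      by (rule psd_cnj[OF channelD(2)[OF bspec[OF \<Psi> that]]], rule psd_cnj[OF channelD(2)[OF bspec[OF \<Lambda> that]]])
    then show ?thesis by (simp add: hermitian_def X_def del: choi_UNIV)
  qed
  note dom = psd_diagonally_dominated[OF this order_refl]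
  define M :: complex where "M = of_real (\<Sum>i\<in>UNIV. \<Sum>j\<in>UNIV. cmod (X i j))"
  define \<gamma> :: "(('a0 \<times> 'a1) \<times> 'r0) op" where "\<gamma> = (\<lambda>i j. if i = j then M else 0)"
  have "gap ?c n (\<lambda>j. choi UNIV (\<Psi> j)) (\<lambda>j. choi UNIV (\<Lambda> j)) \<gamma> = (\<lambda>i j. (if i = j then M else 0) - X i j)"
    by (auto simp: fun_eq_iff gap_def \<gamma>_def X_def simp del: choi_UNIV)
  then have "psd UNIV (gap ?c n (\<lambda>j. choi UNIV (\<Psi> j)) (\<lambda>j. choi UNIV (\<Lambda> j)) \<gamma>)"
    using dom unfolding M_def by metis
  moreover have "hermitian \<gamma>" by (simp add: hermitian_def \<gamma>_def M_def)
  moreover have "(\<Sum>p\<in>UNIV. \<gamma> ((a, p), r) ((a', p), r')) =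
      (if a = a' then (\<Sum>x\<in>UNIV. \<gamma> (x, r) (x, r')) / of_nat CARD('a0) else 0)" for a a' r r'
    by (simp add: \<gamma>_def sum_UNIV_prod)
  ultimately show ?thesis
    using Hmin_feasible_average[OF \<Psi> \<Lambda>] by blast
qed

text \<open>Both infima are positive by the trace bound, and on positive reals the negative
  logarithm reverses the order.\<close>

lemma Hmin_ext_le_iff:
  fixes \<Psi> :: "nat \<Rightarrow> 'a0::finite op \<Rightarrow> 'a1::finite op" and \<Phi> :: "nat \<Rightarrow> 'b0::finite op \<Rightarrow> 'b1::finite op"
    and \<Lambda> :: "nat \<Rightarrow> 'r0::finite op \<Rightarrow> 'r1::finite op"
  assumes n: "n \<ge> 1" and \<Psi>: "\<forall>j\<in>{1..n}. channel (\<Psi> j)"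
    and \<Phi>: "\<forall>j\<in>{1..n}. channel (\<Phi> j)" and \<Lambda>: "\<forall>j\<in>{1..n}. channel (\<Lambda> j)"
  shows "Hmin_ext (average_tensor n \<Psi> \<Lambda>) \<le> Hmin_ext (average_tensor n \<Phi> \<Lambda>) \<longleftrightarrow>
    Inf ((\<lambda>\<gamma>. Re (tr \<gamma>)) ` Hmin_feasible (average_tensor n \<Phi> \<Lambda>)) \<le>
    Inf ((\<lambda>\<gamma>. Re (tr \<gamma>)) ` Hmin_feasible (average_tensor n \<Psi> \<Lambda>))"
proof -
  have "0 < 1 / real CARD('r1)" by simp
  also have "1 / real CARD('r1) \<le> Inf ((\<lambda>\<gamma>. Re (tr \<gamma>)) ` Hmin_feasible (average_tensor n \<Phi> \<Lambda>))"
    using Hmin_feasible_nonempty[OF \<Phi> \<Lambda>] Hmin_feasible_trace_ge[OF n \<Phi> \<Lambda>]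
    by (intro cInf_greatest) auto
  finally have pos: "0 < Inf ((\<lambda>\<gamma>. Re (tr \<gamma>)) ` Hmin_feasible (average_tensor n \<Phi> \<Lambda>))" .
  have "0 < 1 / real CARD('r1)" by simp
  also have "1 / real CARD('r1) \<le> Inf ((\<lambda>\<gamma>. Re (tr \<gamma>)) ` Hmin_feasible (average_tensor n \<Psi> \<Lambda>))"
    using Hmin_feasible_nonempty[OF \<Psi> \<Lambda>] Hmin_feasible_trace_ge[OF n \<Psi> \<Lambda>]
    by (intro cInf_greatest) auto
  finally show ?thesis using pos by (simp add: Hmin_ext_def)
qed

text \<open>This is weak duality, applied to the identity superchannel.\<close>

lemma Hmin_feasible_trace_ge_pairing:
  fixes \<Phi> :: "nat \<Rightarrow> 'b0::finite op \<Rightarrow> 'b1::finite op" and \<Lambda> :: "nat \<Rightarrow> 'r0::finite op \<Rightarrow> 'r1::finite op"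
  assumes \<Phi>: "\<forall>j\<in>{1..n}. channel (\<Phi> j)" and \<Lambda>: "\<forall>j\<in>{1..n}. channel (\<Lambda> j)"
    and \<gamma>: "\<gamma> \<in> Hmin_feasible (average_tensor n \<Phi> \<Lambda>)"
    and f: "bij (f :: 'b0 \<Rightarrow> 'r0)" and g: "bij (g :: 'b1 \<Rightarrow> 'r1)"
  shows "Re (\<Sum>j\<in>{1..n}. \<Sum>y\<in>UNIV. \<Sum>y'\<in>UNIV. choi UNIV (\<Phi> j) y y' *
      choi UNIV (\<Lambda> j) (map_prod f g y) (map_prod f g y')) / (CARD('r0) * n) \<le> Re (tr \<gamma>)"
proof -
  let ?c = "1 / (of_nat CARD('b0) * of_nat CARD('r0) * of_nat n) :: complex"
  let ?G = "gap ?c n (\<lambda>j. choi UNIV (\<Phi> j)) (\<lambda>j. choi UNIV (\<Lambda> j)) \<gamma>"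
  let ?h = "map_prod f g"
  define P where "P = (\<Sum>j\<in>{1..n}. \<Sum>y\<in>UNIV. \<Sum>y'\<in>UNIV. choi UNIV (\<Phi> j) y y' * choi UNIV (\<Lambda> j) (?h y) (?h y'))"
  have psd: "psd UNIV ?G" and marg: "(\<Sum>p\<in>UNIV. \<gamma> ((a, p), r) ((a', p), r')) =
      (if a = a' then (\<Sum>x\<in>UNIV. \<gamma> (x, r) (x, r')) / of_nat CARD('b0) else 0)" for a a' r r'
    using \<gamma> Hmin_feasible_average[OF \<Phi> \<Lambda>] by blast+
  \<comment> \<open>Restricting to the graph of \<open>?h\<close> and testing with the all-ones
    vector evaluates \<open>?G\<close> at the unnormalised maximally entangled vector.\<close>
  have "psd UNIV (\<lambda>y y'. ?G (y, ?h y) (y', ?h y'))"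
    using psd_UNIV_reindex[OF psd, of "\<lambda>y. (y, ?h y)"] by (simp add: reindex_def)
  then have "Re (qform UNIV (\<lambda>y y'. ?G (y, ?h y) (y', ?h y')) (\<lambda>_. 1)) \<ge> 0"
    unfolding psd_iff_qform by blast
  moreover have "qform UNIV (\<lambda>y y'. ?G (y, ?h y) (y', ?h y')) (\<lambda>_. 1) = tr \<gamma> / of_nat CARD('b0) - ?c * P"
  proof -
    have eq: "g p = g p' \<longleftrightarrow> p = p'" for p p' using g by (simp add: bij_def inj_eq)
    have "(\<Sum>y\<in>UNIV. \<Sum>y'\<in>UNIV. if g (snd y) = g (snd y') then \<gamma> (y, f (fst y)) (y', f (fst y')) else 0)
      = (\<Sum>b\<in>UNIV. \<Sum>p\<in>UNIV. \<Sum>b'\<in>UNIV. \<gamma> ((b, p), f b) ((b', p), f b'))"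
      by (simp add: sum_UNIV_prod eq)
    also have "\<dots> = (\<Sum>b\<in>UNIV. \<Sum>b'\<in>UNIV. \<Sum>p\<in>UNIV. \<gamma> ((b, p), f b) ((b', p), f b'))"
      by (intro sum.cong refl sum.swap)
    \<comment> \<open>The marginal condition removes all terms with \<open>b \<noteq> b'\<close>;
      what remains is the trace of \<gamma> divided by d_B0.\<close>
    also have "\<dots> = (\<Sum>b\<in>UNIV. (\<Sum>x\<in>UNIV. \<gamma> (x, f b) (x, f b)) / of_nat CARD('b0))"
      by (simp add: marg)
    also have "\<dots> = (\<Sum>r\<in>UNIV. (\<Sum>x\<in>UNIV. \<gamma> (x, r) (x, r)) / of_nat CARD('b0))"
      by (rule sum.reindex_bij_betw[OF f])
    also have "\<dots> = tr \<gamma> / of_nat CARD('b0)"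
      unfolding tr_prod sum_divide_distrib by (rule sum.swap)
    finally have 1: "(\<Sum>y\<in>UNIV. \<Sum>y'\<in>UNIV. if g (snd y) = g (snd y') then \<gamma> (y, f (fst y)) (y', f (fst y')) else 0)
      = tr \<gamma> / of_nat CARD('b0)" .
    have "(\<Sum>y\<in>UNIV. \<Sum>y'\<in>UNIV. \<Sum>j\<in>{1..n}. choi UNIV (\<Phi> j) y y' * choi UNIV (\<Lambda> j) (?h y) (?h y')) = P"
      unfolding P_def by (rule sum_rotate)
    then have 2: "(\<Sum>y\<in>UNIV. \<Sum>y'\<in>UNIV. ?c * (\<Sum>j\<in>{1..n}. choi UNIV (\<Phi> j) y y' * choi UNIV (\<Lambda> j) (?h y) (?h y'))) = ?c * P"
      by (simp only: sum_distrib_left[symmetric])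
    have G: "?G (y, ?h y) (y', ?h y') = (if g (snd y) = g (snd y') then \<gamma> (y, f (fst y)) (y', f (fst y')) else 0)
      - ?c * (\<Sum>j\<in>{1..n}. choi UNIV (\<Phi> j) y y' * choi UNIV (\<Lambda> j) (?h y) (?h y'))" for y y'
      by (cases y; cases y') (simp add: gap_def del: choi_UNIV)
    show ?thesis
      by (simp only: qform_def G complex_cnj_one mult_1 mult_1_right sum_subtractf 1 2)
  qed
  moreover have "?c * P = of_real (1 / (real CARD('b0) * real CARD('r0) * real n)) * P" by simp
  ultimately have "Re P / (real CARD('b0) * real CARD('r0) * real n) \<le> Re (tr \<gamma>) / real CARD('b0)"
    by (simp del: of_real_divide of_real_mult)
  then show ?thesis unfolding P_def by (simp add: divide_simps mult_ac split: if_splits)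
qed

subsection \<open>Systems of linear equations on a compact set of positive operators\<close>

lemma compact_PiE_UNIV:
  fixes S :: "'i \<Rightarrow> 'a::topological_space set"
  assumes "\<And>i. compact (S i)"
  shows "compact (PiE UNIV S)"
proof -
  have "compactin (product_topology (\<lambda>_. euclidean) UNIV) (PiE UNIV S)"
    unfolding compactin_PiE using assms by simp
  then show ?thesis by (simp add: euclidean_product_topology)
qed

lemma continuous_on_entry [continuous_intros]: "continuous_on K (\<lambda>J :: 'i op. J i j)"
  by (rule continuous_on_product_then_coordinatewise[OF continuous_on_product_then_coordinatewise[OF continuous_on_id]])

text \<open>In terms of Gram vectors, twice the modulus of an entry is at most the sum of two
  diagonal entries, each of which is at most the trace.\<close>

lemma psd_entry_le_trace:
  fixes X :: "'i::finite op"
  assumes "psd UNIV X"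
  shows "cmod (X i j) \<le> Re (tr X)"
proof -
  obtain m w where w: "\<And>i j. X i j = (\<Sum>k<(m::nat). w k i * cnj (w k j))"
    using psd_gram[OF _ assms] by (metis finite)
  have diag: "Re (X i i) = (\<Sum>k<m. (cmod (w k i))\<^sup>2)" for i
    unfolding w by (simp only: complex_norm_square[symmetric] of_real_sum[symmetric] Re_complex_of_real)
  have "Re (X k k) \<le> Re (tr X)" for k
    unfolding tr_def Re_sum by (rule member_le_sum) (use psd_diag[OF _ assms] in auto)
  then have "Re (X i i) + Re (X j j) \<le> 2 * Re (tr X)" by (smt (verit))
  moreover have "2 * cmod (X i j) \<le> Re (X i i) + Re (X j j)"
  proof -
    have "cmod (X i j) \<le> (\<Sum>k<m. cmod (w k i) * cmod (w k j))"
      unfolding w by (rule sum_norm_le) (simp add: norm_mult)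
    then have "2 * cmod (X i j) \<le> (\<Sum>k<m. 2 * cmod (w k i) * cmod (w k j))"
      by (simp add: sum_distrib_left[symmetric] mult.assoc)
    also have "\<dots> \<le> (\<Sum>k<m. (cmod (w k i))\<^sup>2 + (cmod (w k j))\<^sup>2)"
      by (intro sum_mono sum_squares_bound)
    finally show ?thesis by (simp add: diag sum.distrib)
  qed
  ultimately show ?thesis by linarith
qed

text \<open>Positivity and the trace condition are closed in the product topology, and the entry
  bound places the set in a product of discs of radius \<open>d\<close>.\<close>

lemma compact_psd_trace: "compact {J :: 'i::finite op. psd UNIV J \<and> tr J = of_real d}"
proof -
  let ?B = "PiE UNIV (\<lambda>_. PiE UNIV (\<lambda>_. cball 0 d)) :: 'i op set"
  let ?P = "{J :: 'i op. \<forall>v. qform UNIV J v \<in> \<real>\<^sub>\<ge>\<^sub>0} \<inter> {J. tr J = of_real d}"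
  have "closed {J :: 'i op. qform UNIV J v \<in> \<real>\<^sub>\<ge>\<^sub>0}" for v
  proof -
    have "continuous_on UNIV (\<lambda>J :: 'i op. qform UNIV J v)"
      unfolding qform_def by (intro continuous_intros)
    then show ?thesis using closed_vimage[OF closed_nonneg_Reals_complex] by (simp add: vimage_def)
  qed
  then have "closed {J :: 'i op. \<forall>v. qform UNIV J v \<in> \<real>\<^sub>\<ge>\<^sub>0}" by (intro closed_Collect_all)
  moreover have "closed {J :: 'i op. tr J = of_real d}"
    unfolding tr_def by (intro closed_Collect_eq continuous_intros)
  moreover have "compact ?B" by (intro compact_PiE_UNIV compact_cball)
  ultimately have "compact (?B \<inter> ?P)" by (intro compact_Int_closed closed_Int)
  moreover have "{J :: 'i op. psd UNIV J \<and> tr J = of_real d} = ?B \<inter> ?P"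
  proof -
    have psd_iff: "psd UNIV J \<longleftrightarrow> (\<forall>v. qform UNIV J v \<in> \<real>\<^sub>\<ge>\<^sub>0)" for J :: "'i op"
      by (simp add: psd_def qform_def)
    have "J \<in> ?B" if "psd UNIV J" "tr J = of_real d" for J
      using psd_entry_le_trace[OF that(1)] that(2) by (simp add: PiE_def Pi_def)
    then show ?thesis unfolding psd_iff by blast
  qed
  ultimately show ?thesis by simp
qed

lemma psd_add:
  assumes "psd S X" "psd S Y"
  shows "psd S (X + Y)"
proof -
  have "qform S (X + Y) v = qform S X v + qform S Y v" for v
    by (simp add: qform_def algebra_simps sum.distrib)
  then show ?thesis using assms by (simp add: psd_iff_qform ops_def)
qed

text \<open>The witness is the residual at a point of \<open>K\<close> that minimises the sum of the squared violations.\<close>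

lemma linear_alternative:
  fixes K :: "'i::finite op set" and L :: "'c \<Rightarrow> 'i op \<Rightarrow> complex"
  assumes "compact K" "K \<noteq> {}" and fin: "finite I"
    and convex: "\<And>J J' t. J \<in> K \<Longrightarrow> J' \<in> K \<Longrightarrow> 0 \<le> t \<Longrightarrow> t \<le> 1 \<Longrightarrow>
      oscale (of_real (1 - t)) J + oscale (of_real t) J' \<in> K"
    and affine: "\<And>c J J' t. c \<in> I \<Longrightarrow>
      L c (oscale (of_real (1 - t)) J + oscale (of_real t) J') = of_real (1 - t) * L c J + of_real t * L c J'"
    and cont: "\<And>c. c \<in> I \<Longrightarrow> continuous_on K (L c)"
  shows "(\<exists>J\<in>K. \<forall>c\<in>I. L c J = b c) \<or>
    (\<exists>y \<epsilon>. \<epsilon> > 0 \<and> (\<forall>J\<in>K. Re (\<Sum>c\<in>I. y c * (L c J - b c)) \<ge> \<epsilon>))"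
proof -
  define q where "q J = (\<Sum>c\<in>I. (cmod (L c J - b c))\<^sup>2)" for J
  have "continuous_on K q"
    unfolding q_def using cont by (intro continuous_intros) auto
  then obtain J0 where J0: "J0 \<in> K" "\<And>J. J \<in> K \<Longrightarrow> q J0 \<le> q J"
    using continuous_attains_inf[OF assms(1,2)] by blast
  show ?thesis
  proof (cases "q J0 = 0")
    case True
    then have "\<forall>c\<in>I. L c J0 = b c"
      using fin by (simp add: q_def sum_nonneg_eq_0_iff)
    then show ?thesis using J0(1) by blast
  next
    case False
    then have pos: "q J0 > 0" by (simp add: q_def less_le sum_nonneg)
    define r where "r c = L c J0 - b c" for c
    have "Re (\<Sum>c\<in>I. cnj (r c) * (L c J - b c)) \<ge> q J0" if "J \<in> K" for J
    proof -
      define d where "d c = L c J - L c J0" for c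
      define A where "A = (\<Sum>c\<in>I. Re (cnj (r c) * d c))"
      define Q where "Q = (\<Sum>c\<in>I. (cmod (d c))\<^sup>2)"
      \<comment> \<open>Minimality of \<open>J0\<close> along the segment towards \<open>J\<close>;
        the segment stays in \<open>K\<close> by convexity.\<close>
      have ge: "2 * t * A + t\<^sup>2 * Q \<ge> 0" if t: "0 \<le> t" "t \<le> 1" for t
      proof -
        let ?J = "oscale (of_real (1 - t)) J0 + oscale (of_real t) J"
        have "L c ?J - b c = r c + of_real t * d c" if "c \<in> I" for c
          using affine[OF that] by (simp add: r_def d_def algebra_simps)
        then have "q ?J = (\<Sum>c\<in>I. (cmod (r c + of_real t * d c))\<^sup>2)"
          unfolding q_def by (intro sum.cong refl) simp
        also have "\<dots> = (\<Sum>c\<in>I. (cmod (r c))\<^sup>2 + 2 * t * Re (cnj (r c) * d c) + t\<^sup>2 * (cmod (d c))\<^sup>2)"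
          by (intro sum.cong refl) (simp add: cmod_power2, simp add: power2_eq_square algebra_simps)
        also have "\<dots> = q J0 + 2 * t * A + t\<^sup>2 * Q"
          by (simp add: q_def r_def A_def Q_def sum.distrib sum_distrib_left)
        finally show ?thesis using J0(2)[OF convex[OF J0(1) \<open>J \<in> K\<close> t]] by simp
      qed
      have "A \<ge> 0"
      proof (rule ccontr)
        assume "\<not> A \<ge> 0"
        have "Q \<ge> 0" by (simp add: Q_def sum_nonneg)
        \<comment> \<open>This step lies in (0, 1] and satisfies \<open>t * Q = - A + t * A\<close>,
          so \<open>2 * A + t * Q\<close> becomes \<open>A + t * A\<close>, which is
          negative.\<close>
        define t where "t = - A / (Q - A)"
        have "Q - A > 0" "0 < t" "t \<le> 1"
          using \<open>\<not> A \<ge> 0\<close> \<open>Q \<ge> 0\<close> by (auto simp: t_def divide_simps)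
        then have "t * (Q - A) = - A" by (simp add: t_def)
        then have "t * Q = - A + t * A" by (simp add: algebra_simps)
        moreover have "t * (2 * A + t * Q) \<ge> 0"
          using ge[of t] \<open>0 < t\<close> \<open>t \<le> 1\<close> by (simp add: power2_eq_square algebra_simps)
        then have "2 * A + t * Q \<ge> 0" using \<open>0 < t\<close> by (simp add: zero_le_mult_iff)
        moreover have "t * A < 0" using \<open>0 < t\<close> \<open>\<not> A \<ge> 0\<close> by (simp add: mult_pos_neg)
        ultimately show False using \<open>\<not> A \<ge> 0\<close> by linarith
      qed
      \<comment> \<open>Here \<open>L c J - b c\<close> splits as \<open>d c + r c\<close>; the
        residual paired with itself contributes the positive gap \<open>q J0\<close>.\<close>
      moreover have "Re (\<Sum>c\<in>I. cnj (r c) * (L c J - b c)) = A + q J0"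
      proof -
        have "Re (cnj (r c) * (L c J - b c)) = Re (cnj (r c) * d c) + (cmod (L c J0 - b c))\<^sup>2" for c
          unfolding cmod_power2 by (simp add: r_def d_def power2_eq_square algebra_simps)
        then show ?thesis by (simp add: A_def q_def sum.distrib del: times_complex.simps complex_cnj)
      qed
      ultimately show ?thesis by simp
    qed
    with pos show ?thesis
      by (intro disjI2 exI[of _ "\<lambda>c. cnj (r c)"] exI[of _ "q J0"]) simp
  qed
qed

section \<open>The bilinear pairing of matrices and Hermitian parts\<close>

definition pair :: "'i::finite op \<Rightarrow> 'i op \<Rightarrow> complex" where
  "pair X Y = (\<Sum>i\<in>UNIV. \<Sum>j\<in>UNIV. X i j * Y i j)"

definition hpart :: "'i op \<Rightarrow> 'i op" where
  "hpart X = (\<lambda>i j. (X i j + cnj (X j i)) / 2)"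

lemma hermitian_hpart: "hermitian (hpart X)"
  by (simp add: hermitian_def hpart_def add.commute)

text \<open>For Hermitian \<open>Y\<close>, conjugating the pairing amounts to replacing
  \<open>X\<close> by its adjoint. A separating functional can therefore be made Hermitian without
  changing its real part on Hermitian operators.\<close>

lemma pair_hpart:
  assumes "hermitian Y"
  shows "pair (hpart X) Y = of_real (Re (pair X Y))"
proof -
  have Y: "Y i j = cnj (Y j i)" for i j using assms unfolding hermitian_def by blast
  have "cnj (pair X Y) = (\<Sum>j\<in>UNIV. \<Sum>i\<in>UNIV. cnj (X i j) * cnj (Y i j))"
    unfolding pair_def cnj_sum complex_cnj_mult by (rule sum.swap)
  also have "\<dots> = (\<Sum>i\<in>UNIV. \<Sum>j\<in>UNIV. cnj (X j i) * Y i j)"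
    by (intro sum.cong refl) (subst (2) Y, simp)
  finally have "pair (hpart X) Y = (pair X Y + cnj (pair X Y)) / 2"
    by (simp add: pair_def hpart_def sum_divide_distrib sum.distrib add_divide_distrib algebra_simps)
  then show ?thesis by (simp add: complex_eq_iff)
qed

lemma qform_minus_scalar:
  fixes X :: "'i::finite op"
  shows "qform UNIV (\<lambda>i j. X i j - (if i = j then of_real m else 0)) v
    = qform UNIV X v - of_real (m * (\<Sum>i\<in>UNIV. (cmod (v i))\<^sup>2))"
proof -
  have "qform UNIV (\<lambda>i j. X i j - (if i = j then of_real m else 0)) v
      = qform UNIV X v - (\<Sum>i\<in>UNIV. \<Sum>j\<in>UNIV. if i = j then of_real m * (v i * cnj (v i)) else 0)"
    unfolding qform_def sum_subtractf[symmetric] by (intro sum.cong refl) (simp add: algebra_simps)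
  then show ?thesis
    by (simp only: complex_norm_square[symmetric]) (simp add: sum_distrib_left)
qed

text \<open>Each nonzero \<open>v\<close> yields a rank-one positive operator of trace
  \<open>d\<close>, on which the assumed bound becomes a bound on the form of \<open>W\<close> at
  \<open>v\<close>. The conjugate falls on the first factor because \<open>pair\<close> is
  bilinear.\<close>

lemma psd_minus_scalar:
  fixes W :: "'i::finite op"
  assumes "hermitian W" "d > 0"
    and ge: "\<And>J. psd UNIV J \<Longrightarrow> tr J = of_real d \<Longrightarrow> Re (pair W J) \<ge> \<beta>"
  shows "psd UNIV (\<lambda>i j. W i j - (if i = j then of_real (\<beta> / d) else 0))"
  unfolding psd_iff_qform qform_minus_scalar
proof (intro conjI allI)
  fix v :: "'i \<Rightarrow> complex"
  let ?V = "\<Sum>i\<in>UNIV. (cmod (v i))\<^sup>2"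
  show "Im (qform UNIV W v - of_real (\<beta> / d * ?V)) = 0"
    by (simp add: hermitian_qform_real[OF assms(1)])
  show "Re (qform UNIV W v - of_real (\<beta> / d * ?V)) \<ge> 0"
  proof (cases "?V = 0")
    case True
    then have "v i = 0" for i by (simp add: sum_nonneg_eq_0_iff)
    then show ?thesis by (simp add: qform_def)
  next
    case False
    then have V: "?V > 0" by (simp add: less_le sum_nonneg)
    define J where "J = oscale (of_real (d / ?V)) (\<lambda>i j. cnj (v i) * v j)"
    have "psd UNIV (\<lambda>i j. cnj (v i) * v j)"
      by (rule psd_gramI[of "{()}" _ _ "\<lambda>_ i. cnj (v i)"]) simp_all
    then have "psd UNIV J"
      unfolding J_def using V assms(2) by (intro psd_scale) simp_all
    moreover have "tr J = of_real d"
    proof -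
      have "tr J = of_real (d / ?V) * (\<Sum>i\<in>UNIV. v i * cnj (v i))"
        unfolding tr_def J_def oscale_apply sum_distrib_left by (intro sum.cong refl) (simp only: mult_ac)
      also have "(\<Sum>i\<in>UNIV. v i * cnj (v i)) = of_real ?V"
        by (simp only: complex_norm_square[symmetric] of_real_sum)
      also have "of_real (d / ?V) * of_real ?V = (of_real (d / ?V * ?V) :: complex)"
        by (rule of_real_mult[symmetric])
      also have "d / ?V * ?V = d" using V by simp
      finally show ?thesis .
    qed
    moreover have "pair W J = of_real (d / ?V) * qform UNIV W v"
      unfolding pair_def J_def oscale_apply qform_def sum_distrib_left
      by (intro sum.cong refl) (simp add: mult_ac)
    ultimately have "\<beta> \<le> d / ?V * Re (qform UNIV W v)" using ge[of J] by simp
    then show ?thesis using V assms(2) by (simp add: field_simps)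
  qed
qed simp

subsection \<open>Duality\<close>

lemma pair_commute: "pair X Y = pair Y X"
  by (simp add: pair_def mult.commute)

lemma pair_add_left: "pair (X + Y) Z = pair X Z + pair Y Z"
  by (simp add: pair_def algebra_simps sum.distrib)

lemma pair_oscale_left: "pair (oscale c X) Z = c * pair X Z"
  by (simp add: pair_def oscale_apply sum_distrib_left mult.assoc)

lemma pair_add_right: "pair Z (X + Y) = pair Z X + pair Z Y"
  by (simp add: pair_def algebra_simps sum.distrib)

lemma pair_oscale_right: "pair Z (oscale c X) = c * pair Z X"
  by (simp add: pair_def oscale_apply sum_distrib_left mult_ac)

definition trace_out :: "('x \<times> 'b \<times> 'p::finite) op \<Rightarrow> ('x \<times> 'b) op" where
  "trace_out J = (\<lambda>(x, b) (x', b'). \<Sum>p\<in>UNIV. J (x, (b, p)) (x', (b', p)))"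

definition contract :: "'x::finite op \<Rightarrow> ('x \<times> 'u) op \<Rightarrow> 'u op" where
  "contract C J = (\<lambda>u u'. \<Sum>x\<in>UNIV. \<Sum>x'\<in>UNIV. C x x' * J (x, u) (x', u'))"

text \<open>Traces out A1 and puts the identity back in its place. An operator equals its twirl
  divided by d_A1 exactly when it is the identity on A1 tensored with an operator on the other
  systems.\<close>

definition twirl :: "(('a \<times> 's::finite) \<times> 'b) op \<Rightarrow> (('a \<times> 's) \<times> 'b) op" where
  "twirl X = (\<lambda>((a, s), b) ((a', s'), b'). if s = s' then \<Sum>t\<in>UNIV. X ((a, t), b) ((a', t), b') else 0)"

lemma linear_ops:
  "trace_out (oscale \<alpha> X + oscale \<beta> Y) = oscale \<alpha> (trace_out X) + oscale \<beta> (trace_out Y)"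
  "contract C (oscale \<alpha> X + oscale \<beta> Y) = oscale \<alpha> (contract C X) + oscale \<beta> (contract C Y)"
  "twirl (oscale \<alpha> X' + oscale \<beta> Y') = oscale \<alpha> (twirl X') + oscale \<beta> (twirl Y')"
  "ptrace_fst (oscale \<alpha> X'' + oscale \<beta> Y'') = oscale \<alpha> (ptrace_fst X'') + oscale \<beta> (ptrace_fst Y'')"
  by (simp_all add: fun_eq_iff trace_out_def contract_def twirl_def ptrace_fst_def oscale_apply
      algebra_simps sum.distrib sum_distrib_left)

text \<open>The right-hand side is symmetric in \<open>X\<close> and \<open>Y\<close>, which makes
  \<open>twirl\<close> self-adjoint for the pairing.\<close>

lemma pair_twirl_sum:
  fixes X Y :: "(('a::finite \<times> 's::finite) \<times> 'b::finite) op"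
  shows "pair X (twirl Y) = (\<Sum>a\<in>UNIV. \<Sum>b\<in>UNIV. \<Sum>a'\<in>UNIV. \<Sum>b'\<in>UNIV.
    (\<Sum>s\<in>UNIV. X ((a, s), b) ((a', s), b')) * (\<Sum>t\<in>UNIV. Y ((a, t), b) ((a', t), b')))"
proof -
  let ?Y = "\<lambda>a b a' b'. \<Sum>t\<in>UNIV. Y ((a, t), b) ((a', t), b')"
  have "pair X (twirl Y) = (\<Sum>a\<in>UNIV. \<Sum>s\<in>UNIV. \<Sum>b\<in>UNIV. \<Sum>a'\<in>UNIV. \<Sum>s'\<in>UNIV. \<Sum>b'\<in>UNIV.
      if s = s' then X ((a, s), b) ((a', s'), b') * ?Y a b a' b' else 0)"
    unfolding pair_def sum_UNIV_prod by (intro sum.cong refl) (simp add: twirl_def)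
  also have "\<dots> = (\<Sum>a\<in>UNIV. \<Sum>s\<in>UNIV. \<Sum>b\<in>UNIV. \<Sum>a'\<in>UNIV. \<Sum>b'\<in>UNIV. \<Sum>s'\<in>UNIV.
      if s = s' then X ((a, s), b) ((a', s'), b') * ?Y a b a' b' else 0)"
    by (intro sum.cong refl sum.swap)
  also have "\<dots> = (\<Sum>a\<in>UNIV. \<Sum>s\<in>UNIV. \<Sum>b\<in>UNIV. \<Sum>a'\<in>UNIV. \<Sum>b'\<in>UNIV.
      X ((a, s), b) ((a', s), b') * ?Y a b a' b')"
    by simp
  also have "\<dots> = (\<Sum>a\<in>UNIV. \<Sum>b\<in>UNIV. \<Sum>s\<in>UNIV. \<Sum>a'\<in>UNIV. \<Sum>b'\<in>UNIV.
      X ((a, s), b) ((a', s), b') * ?Y a b a' b')"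
    by (intro sum.cong refl sum.swap)
  also have "\<dots> = (\<Sum>a\<in>UNIV. \<Sum>b\<in>UNIV. \<Sum>a'\<in>UNIV. \<Sum>b'\<in>UNIV. \<Sum>s\<in>UNIV.
      X ((a, s), b) ((a', s), b') * ?Y a b a' b')"
    by (intro sum.cong refl sum_rotate[symmetric])
  finally show ?thesis by (simp only: sum_distrib_right)
qed

lemma pair_twirl: "pair X (twirl Y) = pair (twirl X) Y"
  for X Y :: "(('a::finite \<times> 's::finite) \<times> 'b::finite) op"
  unfolding pair_commute[of "twirl X"] pair_twirl_sum by (simp only: mult.commute)

definition id_otensor :: "'b op \<Rightarrow> ('x \<times> 'b) op" where
  "id_otensor Y = (\<lambda>(x, b) (x', b'). if x = x' then Y b b' else 0)"

lemma pair_ptrace_fst: "pair Y (ptrace_fst X) = pair (id_otensor Y) X"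
  for X :: "('x::finite \<times> 'b::finite) op"
proof -
  have "pair (id_otensor Y) X = (\<Sum>x\<in>UNIV. \<Sum>b\<in>UNIV. \<Sum>x'\<in>UNIV. \<Sum>b'\<in>UNIV.
      if x = x' then Y b b' * X (x, b) (x', b') else 0)"
    unfolding pair_def sum_UNIV_prod by (intro sum.cong refl) (simp add: id_otensor_def)
  also have "\<dots> = (\<Sum>x\<in>UNIV. \<Sum>b\<in>UNIV. \<Sum>b'\<in>UNIV. \<Sum>x'\<in>UNIV.
      if x = x' then Y b b' * X (x, b) (x', b') else 0)"
    by (intro sum.cong refl sum.swap)
  also have "\<dots> = (\<Sum>x\<in>UNIV. \<Sum>b\<in>UNIV. \<Sum>b'\<in>UNIV. Y b b' * X (x, b) (x, b'))" by simp
  also have "\<dots> = (\<Sum>b\<in>UNIV. \<Sum>b'\<in>UNIV. \<Sum>x\<in>UNIV. Y b b' * X (x, b) (x, b'))"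
    by (rule sum_rotate[symmetric])
  finally show ?thesis by (simp add: pair_def ptrace_fst_def sum_distrib_left)
qed

text \<open>The adjoint form of the gap: it represents the functional that pairs \<open>F\<close>
  with the B1-trace of \<open>J\<close> and the \<open>H j\<close> with the images of the
  \<open>C j\<close>. A functional separating the superchannel equations is thereby turned into an
  operator of the shape of the entropy constraint.\<close>

lemma pair_gap:
  fixes J :: "('x::finite \<times> 'b::finite \<times> 'p::finite) op"
  shows "pair (gap c n C H F) J
    = pair F (trace_out J) - c * (\<Sum>j\<in>{1..n}. pair (H j) (contract (C j) J))"
proof -
  have 1: "(\<Sum>x\<in>UNIV. \<Sum>u\<in>UNIV. \<Sum>x'\<in>UNIV. \<Sum>u'\<in>UNIV.
      (if snd u = snd u' then F (x, fst u) (x', fst u') * J (x, u) (x', u') else 0)) = pair F (trace_out J)"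
  proof -
    have "(\<Sum>x\<in>UNIV. \<Sum>u\<in>UNIV. \<Sum>x'\<in>UNIV. \<Sum>u'\<in>UNIV.
      (if snd u = snd u' then F (x, fst u) (x', fst u') * J (x, u) (x', u') else 0))
      = (\<Sum>x\<in>UNIV. \<Sum>b\<in>UNIV. \<Sum>p\<in>UNIV. \<Sum>x'\<in>UNIV. \<Sum>b'\<in>UNIV. F (x, b) (x', b') * J (x, (b, p)) (x', (b', p)))"
      unfolding sum_UNIV_prod[where 'a = 'b and 'b = 'p] by simp
    also have "\<dots> = (\<Sum>x\<in>UNIV. \<Sum>b\<in>UNIV. \<Sum>x'\<in>UNIV. \<Sum>b'\<in>UNIV. \<Sum>p\<in>UNIV. F (x, b) (x', b') * J (x, (b, p)) (x', (b', p)))"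
      by (intro sum.cong refl sum_rotate[symmetric])
    finally show ?thesis
      by (simp add: pair_def sum_UNIV_prod trace_out_def sum_distrib_left)
  qed
  have 2: "(\<Sum>x\<in>UNIV. \<Sum>u\<in>UNIV. \<Sum>x'\<in>UNIV. \<Sum>u'\<in>UNIV. \<Sum>j\<in>{1..n}. C j x x' * H j u u' * J (x, u) (x', u'))
    = (\<Sum>j\<in>{1..n}. pair (H j) (contract (C j) J))"
  proof -
    have "(\<Sum>x\<in>UNIV. \<Sum>u\<in>UNIV. \<Sum>x'\<in>UNIV. \<Sum>u'\<in>UNIV. \<Sum>j\<in>{1..n}. C j x x' * H j u u' * J (x, u) (x', u'))
      = (\<Sum>x\<in>UNIV. \<Sum>u\<in>UNIV. \<Sum>j\<in>{1..n}. \<Sum>x'\<in>UNIV. \<Sum>u'\<in>UNIV. C j x x' * H j u u' * J (x, u) (x', u'))"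
      by (intro sum.cong refl sum_rotate)
    also have "\<dots> = (\<Sum>j\<in>{1..n}. \<Sum>x\<in>UNIV. \<Sum>u\<in>UNIV. \<Sum>x'\<in>UNIV. \<Sum>u'\<in>UNIV. C j x x' * H j u u' * J (x, u) (x', u'))"
      by (rule sum_rotate)
    also have "\<dots> = (\<Sum>j\<in>{1..n}. \<Sum>u\<in>UNIV. \<Sum>x\<in>UNIV. \<Sum>u'\<in>UNIV. \<Sum>x'\<in>UNIV. C j x x' * H j u u' * J (x, u) (x', u'))"
      by (intro sum.cong refl trans[OF sum.swap] sum.swap)
    also have "\<dots> = (\<Sum>j\<in>{1..n}. \<Sum>u\<in>UNIV. \<Sum>u'\<in>UNIV. \<Sum>x\<in>UNIV. \<Sum>x'\<in>UNIV. C j x x' * H j u u' * J (x, u) (x', u'))"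
      by (intro sum.cong refl sum.swap)
    finally show ?thesis
      by (simp add: pair_def contract_def sum_distrib_left mult_ac)
  qed
  have "pair (gap c n C H F) J = (\<Sum>x\<in>UNIV. \<Sum>u\<in>UNIV. \<Sum>x'\<in>UNIV. \<Sum>u'\<in>UNIV.
      (if snd u = snd u' then F (x, fst u) (x', fst u') * J (x, u) (x', u') else 0)
      - c * (\<Sum>j\<in>{1..n}. C j x x' * H j u u' * J (x, u) (x', u')))"
    unfolding pair_def sum_UNIV_prod[where 'a = 'x]
  proof (intro sum.cong refl)
    fix x x' :: 'x and u u' :: "'b \<times> 'p"
    show "gap c n C H F (x, u) (x', u') * J (x, u) (x', u')
      = (if snd u = snd u' then F (x, fst u) (x', fst u') * J (x, u) (x', u') else 0)
      - c * (\<Sum>j\<in>{1..n}. C j x x' * H j u u' * J (x, u) (x', u'))"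
      by (cases u; cases u') (simp add: gap_def left_diff_distrib sum_distrib_right mult.assoc)
  qed
  also have "\<dots> = pair F (trace_out J) - c * (\<Sum>j\<in>{1..n}. pair (H j) (contract (C j) J))"
    unfolding sum_subtractf 1 sum_distrib_left[symmetric] 2 ..
  finally show ?thesis .
qed

section \<open>Superchannel or dual witness\<close>

lemma psd_ident: "psd UNIV (ident :: 'i::finite op)"
proof (rule psd_gramI)
  fix i j :: 'i
  have "(\<Sum>k\<in>UNIV. (if i = k then 1 else 0) * cnj (if j = k then 1 else 0)) = (\<Sum>k\<in>UNIV. if i = k then ident i j else 0)"
    by (intro sum.cong refl) (auto simp: ident_def)
  then show "ident i j = (\<Sum>k\<in>UNIV. (if i = k then 1 else 0) * cnj (if j = k then 1 else 0))" by simp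
qed simp_all

lemma exists_psd_trace:
  assumes "d \<ge> 0"
  shows "\<exists>J :: 'i::finite op. psd UNIV J \<and> tr J = of_real d"
proof (intro exI conjI)
  show "psd UNIV (oscale (of_real (d / CARD('i))) (ident :: 'i op))"
    using assms by (intro psd_scale psd_ident) simp
  show "tr (oscale (of_real (d / CARD('i))) (ident :: 'i op)) = of_real d"
    by (simp add: tr_def oscale_apply ident_def)
qed

lemma hpart_gap:
  assumes "\<forall>j\<in>{1..n}. hermitian (C j)"
  shows "hpart (gap 1 n C H F) = gap 1 n C (\<lambda>j. hpart (H j)) (hpart F)"
proof -
  have "hpart (gap 1 n C H F) (x, r, s) (x', r', s') = gap 1 n C (\<lambda>j. hpart (H j)) (hpart F) (x, r, s) (x', r', s')"
    for x r s x' r' s'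
  proof -
    have cnj: "cnj (C j x' x) = C j x x'" if "j \<in> {1..n}" for j
      using assms that unfolding hermitian_def by metis
    have "(\<Sum>j\<in>{1..n}. cnj (C j x' x) * cnj (H j (r', s') (r, s))) = (\<Sum>j\<in>{1..n}. C j x x' * cnj (H j (r', s') (r, s)))"
      by (intro sum.cong refl) (simp only: cnj)
    then show ?thesis
      by (simp add: hpart_def gap_def sum.distrib distrib_left diff_divide_distrib add_divide_distrib sum_divide_distrib)
  qed
  then show ?thesis by (simp add: fun_eq_iff)
qed

lemma hermitian_pair_real:
  assumes "hermitian Y"
  shows "Re (pair X Y) = Re (pair (hpart X) Y)"
  using pair_hpart[OF assms, of X] by simp

text \<open>The alternative \<open>linear_alternative\<close> is applied to three groups of
  equations for \<open>J\<close>: no signalling from A1 once B1 is traced out, normalisation, and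
  the prescribed images of the \<open>C j\<close>. In the unsolvable case the multipliers of the
  three groups are assembled into \<open>F\<close> and \<open>H\<close>.\<close>

lemma super_op_or_witness:
  fixes C :: "nat \<Rightarrow> ('a0::finite \<times> 'a1::finite) op" and D :: "nat \<Rightarrow> ('b0::finite \<times> 'b1::finite) op"
  assumes C: "\<forall>j\<in>{1..n}. hermitian (C j)" and D: "\<forall>j\<in>{1..n}. hermitian (D j)"
  obtains (super_op) J \<sigma> where "psd UNIV J"
      "\<And>a s b a' s' b'. (\<Sum>p\<in>UNIV. J ((a, s), (b, p)) ((a', s'), (b', p))) = (if s = s' then \<sigma> (a, b) (a', b') else 0)"
      "\<And>b b'. (\<Sum>a\<in>UNIV. \<sigma> (a, b) (a, b')) = (if b = b' then 1 else 0)"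
      "\<And>j. j \<in> {1..n} \<Longrightarrow> contract (C j) J = D j"
    | (witness) G H \<tau> \<epsilon> where "\<epsilon> > 0" "\<And>j. hermitian (H j)" "psd UNIV (gap 1 n C H G)"
      "\<And>a b a' b'. (\<Sum>s\<in>UNIV. G ((a, s), b) ((a', s), b')) = (if a = a' then \<tau> b b' else 0)"
      "tr \<tau> = (\<Sum>j\<in>{1..n}. pair (H j) (D j)) - of_real \<epsilon>"
proof -
  \<comment> \<open>\<open>d\<close> is the trace that no-signalling and normalisation force on
    every solution, so fixing it loses none and makes the domain compact.\<close>
  define d1 d where "d1 = real CARD('a1)" and "d = d1 * real CARD('b0)"
  have d1: "d1 > 0" and d: "d > 0" by (simp_all add: d1_def d_def)
  define K where "K = {J :: (('a0 \<times> 'a1) \<times> ('b0 \<times> 'b1)) op. psd UNIV J \<and> tr J = of_real d}"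
  \<comment> \<open>\<open>P J = 0\<close> expresses that the operator left after tracing out B1 is
    the identity on A1 tensored with something.\<close>
  define P where "P J = trace_out J + oscale (of_real (- 1 / d1)) (twirl (trace_out J))"
    for J :: "(('a0 \<times> 'a1) \<times> ('b0 \<times> 'b1)) op"
  define I where "I = ((UNIV :: ((('a0 \<times> 'a1) \<times> 'b0) \<times> (('a0 \<times> 'a1) \<times> 'b0)) set) <+> (UNIV :: ('b0 \<times> 'b0) set))
    <+> ({1..n} \<times> (UNIV :: (('b0 \<times> 'b1) \<times> ('b0 \<times> 'b1)) set))"
  define L where "L c J = (case c of Inl (Inl (u, u')) \<Rightarrow> P J u u'
    | Inl (Inr (b, b')) \<Rightarrow> ptrace_fst (trace_out J) b b' | Inr (j, v, v') \<Rightarrow> contract (C j) J v v')"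
    for c and J :: "(('a0 \<times> 'a1) \<times> ('b0 \<times> 'b1)) op"
  define r where "r c = (case c of Inl (Inl (u, u')) \<Rightarrow> 0
    | Inl (Inr (b, b')) \<Rightarrow> (if b = b' then of_real d1 else 0) | Inr (j, v, v') \<Rightarrow> D j v v')"
    for c :: "((('a0 \<times> 'a1) \<times> 'b0) \<times> (('a0 \<times> 'a1) \<times> 'b0) + 'b0 \<times> 'b0) + nat \<times> ('b0 \<times> 'b1) \<times> ('b0 \<times> 'b1)"
  have mem: "Inl x \<in> I" "j \<in> {1..n} \<Longrightarrow> Inr (j, v) \<in> I" for x j v
    by (auto simp: I_def)
  have "(\<exists>J\<in>K. \<forall>c\<in>I. L c J = r c) \<or>
    (\<exists>y \<epsilon>. \<epsilon> > 0 \<and> (\<forall>J\<in>K. Re (\<Sum>c\<in>I. y c * (L c J - r c)) \<ge> \<epsilon>))"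
  proof (rule linear_alternative)
    show "compact K" unfolding K_def by (rule compact_psd_trace)
    show "K \<noteq> {}" unfolding K_def using exists_psd_trace[of d] d by auto
    show "finite I" by (simp add: I_def)
    show "oscale (of_real (1 - t)) J + oscale (of_real t) J' \<in> K"
      if JJ': "J \<in> K" "J' \<in> K" and t: "0 \<le> t" "t \<le> 1" for J J' t
    proof -
      have "psd UNIV (oscale (of_real (1 - t)) J + oscale (of_real t) J')"
        using JJ' t by (intro psd_add psd_scale) (simp_all add: K_def)
      moreover have "tr (oscale (of_real (1 - t)) J + oscale (of_real t) J') = of_real (1 - t) * tr J + of_real t * tr J'"
        unfolding tr_def plus_fun_apply oscale_apply sum.distrib sum_distrib_left ..
      ultimately show ?thesis using JJ' by (simp add: K_def algebra_simps)
    qed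
    show "L c (oscale (of_real (1 - t)) J + oscale (of_real t) J') = of_real (1 - t) * L c J + of_real t * L c J'"
      for c J J' t
      by (auto simp: L_def P_def linear_ops(1) linear_ops(2-4) oscale_apply algebra_simps split: sum.split)
    show "continuous_on K (L c)" for c
    proof -
      have "continuous_on K (\<lambda>J. trace_out J u u')" for u u'
        by (cases u; cases u') (auto simp: trace_out_def intro!: continuous_intros)
      moreover from this have "continuous_on K (\<lambda>J. twirl (trace_out J) u u')" for u u'
        by (cases u; cases u'; cases "fst u"; cases "fst u'"; cases "snd (fst u) = snd (fst u')")
          (auto simp: twirl_def intro!: continuous_intros)
      moreover have "(\<exists>u u'. c = Inl (Inl (u, u'))) \<or> (\<exists>b b'. c = Inl (Inr (b, b'))) \<or> (\<exists>j v v'. c = Inr (j, v, v'))"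
        by (metis sum.exhaust surj_pair)
      ultimately show ?thesis
        by (elim disjE exE) (simp_all add: L_def P_def oscale_apply ptrace_fst_def contract_def continuous_intros
            less_imp_neq[OF d1, symmetric])
    qed
  qed
  then consider (J) J where "J \<in> K" "\<forall>c\<in>I. L c J = r c"
    | (y) y \<epsilon> where "\<epsilon> > 0" "\<And>J. J \<in> K \<Longrightarrow> Re (\<Sum>c\<in>I. y c * (L c J - r c)) \<ge> \<epsilon>" by blast
  then show ?thesis
  proof cases
    case J
    have L: "P J u u' = 0" "ptrace_fst (trace_out J) b b' = (if b = b' then of_real d1 else 0)"
      "j \<in> {1..n} \<Longrightarrow> contract (C j) J v v' = D j v v'" for u u' b b' j v v'
    proof -
      show "P J u u' = 0"
        using J(2)[rule_format, of "Inl (Inl (u, u'))"] by (simp add: mem L_def r_def)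
      show "ptrace_fst (trace_out J) b b' = (if b = b' then of_real d1 else 0)"
        using J(2)[rule_format, of "Inl (Inr (b, b'))"] by (simp add: mem L_def r_def)
      show "j \<in> {1..n} \<Longrightarrow> contract (C j) J v v' = D j v v'"
        using J(2)[rule_format, of "Inr (j, v, v')"] by (simp add: mem L_def r_def)
    qed
    \<comment> \<open>By the first group of equations the blocks diagonal in A1 all coincide, so
      their average is the common value.\<close>
    define \<sigma> where "\<sigma> = (\<lambda>(a, b) (a', b'). (\<Sum>t\<in>UNIV. trace_out J ((a, t), b) ((a', t), b')) / of_real d1)"
    show ?thesis
    proof (rule super_op)
      show "psd UNIV J" using J(1) by (simp add: K_def)
      show "contract (C j) J = D j" if "j \<in> {1..n}" for j
        using L(3)[OF that] by (simp add: fun_eq_iff)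
      show "(\<Sum>p\<in>UNIV. J ((a, s), (b, p)) ((a', s'), (b', p))) = (if s = s' then \<sigma> (a, b) (a', b') else 0)"
        for a s b a' s' b'
        using L(1)[of "((a, s), b)" "((a', s'), b')"]
        by (simp add: P_def oscale_apply twirl_def \<sigma>_def trace_out_def split: if_splits)
      show "(\<Sum>a\<in>UNIV. \<sigma> (a, b) (a, b')) = (if b = b' then 1 else 0)" for b b'
      proof -
        have "(\<Sum>a\<in>UNIV. \<sigma> (a, b) (a, b')) = ptrace_fst (trace_out J) b b' / of_real d1"
          by (simp add: \<sigma>_def ptrace_fst_def sum_UNIV_prod sum_divide_distrib)
        then show ?thesis using d1 by (simp add: L(2))
      qed
    qed
  next
    case y
    define y1 where "y1 u u' = y (Inl (Inl (u, u')))" for u u'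
    define y2 where "y2 b b' = y (Inl (Inr (b, b')))" for b b'
    \<comment> \<open>The sign matches \<open>gap\<close>, which subtracts the terms with
      \<open>H j\<close>.\<close>
    define H where "H j = (\<lambda>v v'. - y (Inr (j, v, v')))" for j
    \<comment> \<open>The adjoints of \<open>P\<close> and of the normalisation map, applied to
      their multipliers. Self-adjointness of \<open>twirl\<close> gives the adjoint of
      \<open>P\<close> the same shape as \<open>P\<close>.\<close>
    define F where "F = y1 + oscale (of_real (- 1 / d1)) (twirl y1) + id_otensor y2"
    define S where "S = (\<Sum>j\<in>{1..n}. pair (H j) (D j))"
    \<comment> \<open>The lower bound for the real part of the pairing of the gap with
      \<open>J\<close> on \<open>K\<close>, obtained by moving the constants of the separation
      inequality to the other side.\<close>
    define \<beta> where "\<beta> = d1 * Re (tr y2) - Re S + \<epsilon>"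
    have sum: "(\<Sum>c\<in>I. y c * (L c J - r c)) = pair (gap 1 n C H F) J - (of_real d1 * tr y2 - S)" for J
    proof -
      have "(\<Sum>c\<in>I. y c * (L c J - r c)) = pair y1 (P J)
        + (\<Sum>b\<in>UNIV. \<Sum>b'\<in>UNIV. y2 b b' * (ptrace_fst (trace_out J) b b' - (if b = b' then of_real d1 else 0)))
        + (\<Sum>j\<in>{1..n}. \<Sum>v\<in>UNIV. \<Sum>v'\<in>UNIV. - H j v v' * (contract (C j) J v v' - D j v v'))"
      proof -
        have 1: "(\<Sum>c\<in>UNIV. y (Inl (Inl c)) * (L (Inl (Inl c)) J - r (Inl (Inl c)))) = pair y1 (P J)"
          by (subst sum_UNIV_prod) (simp add: L_def r_def pair_def y1_def)
        have 2: "(\<Sum>c\<in>UNIV. y (Inl (Inr c)) * (L (Inl (Inr c)) J - r (Inl (Inr c))))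
          = (\<Sum>b\<in>UNIV. \<Sum>b'\<in>UNIV. y2 b b' * (ptrace_fst (trace_out J) b b' - (if b = b' then of_real d1 else 0)))"
          by (subst sum_UNIV_prod) (simp add: L_def r_def y2_def)
        have 3: "(\<Sum>c\<in>{1..n} \<times> UNIV. y (Inr c) * (L (Inr c) J - r (Inr c)))
          = (\<Sum>j\<in>{1..n}. \<Sum>v\<in>UNIV. \<Sum>v'\<in>UNIV. - H j v v' * (contract (C j) J v v' - D j v v'))"
          unfolding sum.cartesian_product'
          by (intro sum.cong refl, subst sum_UNIV_prod) (simp add: L_def r_def H_def)
        show ?thesis
          unfolding I_def by (simp only: sum.Plus finite_Plus finite finite_cartesian_product finite_atLeastAtMost o_def 1 2 3)
      qed
      also have "pair y1 (P J) = pair (y1 + oscale (of_real (- 1 / d1)) (twirl y1)) (trace_out J)"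
        by (simp only: P_def pair_add_right pair_oscale_right pair_add_left pair_oscale_left pair_twirl)
      also have "(\<Sum>b\<in>UNIV. \<Sum>b'\<in>UNIV. y2 b b' * (ptrace_fst (trace_out J) b b' - (if b = b' then of_real d1 else 0)))
        = pair (id_otensor y2) (trace_out J) - of_real d1 * tr y2"
        unfolding pair_ptrace_fst[symmetric]
        by (simp add: pair_def tr_def algebra_simps sum_subtractf sum_distrib_left if_distrib[of "\<lambda>z. z * _"] if_distrib[of "\<lambda>z. _ * z"] cong: if_cong)
      also have "(\<Sum>j\<in>{1..n}. \<Sum>v\<in>UNIV. \<Sum>v'\<in>UNIV. - H j v v' * (contract (C j) J v v' - D j v v'))
        = S - (\<Sum>j\<in>{1..n}. pair (H j) (contract (C j) J))"
        by (simp add: S_def pair_def algebra_simps sum_subtractf)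
      finally show ?thesis
        unfolding pair_gap F_def pair_add_left by simp
    qed
    let ?W = "gap 1 n C (\<lambda>j. hpart (H j)) (hpart F)"
    have "psd UNIV (\<lambda>i j. ?W i j - (if i = j then of_real (\<beta> / d) else 0))"
    proof (rule psd_minus_scalar)
      show "hermitian ?W" unfolding hpart_gap[OF C, symmetric] by (rule hermitian_hpart)
      show "d > 0" by (rule d)
      fix J :: "(('a0 \<times> 'a1) \<times> ('b0 \<times> 'b1)) op"
      assume J: "psd UNIV J" "tr J = of_real d"
      then have "Re (pair (gap 1 n C H F) J - (of_real d1 * tr y2 - S)) \<ge> \<epsilon>"
        using y(2)[of J] by (simp add: sum K_def)
      moreover have "Re (pair (gap 1 n C H F) J) = Re (pair ?W J)"
        unfolding hpart_gap[OF C, symmetric] by (rule hermitian_pair_real[OF psd_hermitian[OF finite J(1)]])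
      ultimately show "Re (pair ?W J) \<ge> \<beta>" by (simp add: \<beta>_def)
    qed
    \<comment> \<open>Since all operators in \<open>K\<close> have trace \<open>d\<close>, the bound
      \<open>\<beta>\<close> becomes positivity once \<open>\<beta> / d\<close> times the identity
      is subtracted. This fits into \<open>G\<close> because \<open>gap\<close> tensors it with the
      identity on B1.\<close>
    define G where "G = (\<lambda>u u'. hpart F u u' - (if u = u' then of_real (\<beta> / d) else 0))"
    define \<tau> where "\<tau> = (\<lambda>b b'. of_real d1 * (hpart y2 b b' - (if b = b' then of_real (\<beta> / d) else 0)))"
    show ?thesis
    proof (rule witness)
      show "\<epsilon> > 0" by (rule y(1))
      show "hermitian (hpart (H j))" for j by (rule hermitian_hpart)
      have "gap 1 n C (\<lambda>j. hpart (H j)) G = (\<lambda>i j. ?W i j - (if i = j then of_real (\<beta> / d) else 0))"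
        by (auto simp: fun_eq_iff gap_def G_def)
      then show "psd UNIV (gap 1 n C (\<lambda>j. hpart (H j)) G)"
        using \<open>psd UNIV (\<lambda>i j. ?W i j - (if i = j then of_real (\<beta> / d) else 0))\<close> by metis
    next
      fix a a' b b'
      \<comment> \<open>Tracing out A1 annihilates \<open>y1\<close> minus its twirl divided by
        \<open>d1\<close>, so only the normalisation multiplier survives.\<close>
      have F: "(\<Sum>s\<in>UNIV. F ((a, s), b) ((a', s), b')) = (if a = a' then of_real d1 * y2 b b' else 0)" for a a' b b'
        by (simp add: F_def oscale_apply twirl_def id_otensor_def sum.distrib sum_subtractf d1_def)
      have "(\<Sum>s\<in>UNIV. hpart F ((a, s), b) ((a', s), b'))
        = ((\<Sum>s\<in>UNIV. F ((a, s), b) ((a', s), b')) + cnj (\<Sum>s\<in>UNIV. F ((a', s), b') ((a, s), b))) / 2"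
        by (simp add: hpart_def sum.distrib flip: sum_divide_distrib)
      also have "\<dots> = (if a = a' then of_real d1 * hpart y2 b b' else 0)"
        unfolding F by (simp add: hpart_def algebra_simps)
      finally show "(\<Sum>s\<in>UNIV. G ((a, s), b) ((a', s), b')) = (if a = a' then \<tau> b b' else 0)"
        by (auto simp: G_def \<tau>_def sum_subtractf d1_def algebra_simps)
    next
      have S': "(\<Sum>j\<in>{1..n}. pair (hpart (H j)) (D j)) = of_real (Re S)"
        using D by (simp add: pair_hpart S_def)
      have "tr \<tau> = of_real d1 * (of_real (Re (tr y2)) - of_nat CARD('b0) * of_real (\<beta> / d))"
      proof -
        have "(\<Sum>b\<in>UNIV. hpart y2 b b) = of_real (Re (tr y2))"
          by (simp add: hpart_def tr_def complex_add_cnj)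
        then show ?thesis
          by (simp add: \<tau>_def tr_def sum_subtractf flip: sum_distrib_left)
      qed
      \<comment> \<open>As \<open>d\<close> is \<open>d1\<close> times d_B0, the scalar part
        contributes exactly \<open>\<beta>\<close>; inserting its definition leaves
        \<open>Re S - \<epsilon>\<close>.\<close>
      also have "\<dots> = of_real (d1 * Re (tr y2) - \<beta>)"
        using d1 by (simp add: d_def field_simps)
      finally show "tr \<tau> = (\<Sum>j\<in>{1..n}. pair (hpart (H j)) (D j)) - of_real \<epsilon>"
        unfolding S' by (simp add: \<beta>_def)
    qed
  qed
qed

text \<open>Each \<open>L j\<close> equals \<open>t\<close> times the sum of \<open>H j\<close> and
  \<open>e j\<close> \<otimes> I. Adding the matching \<open>C j\<close> \<otimes>
  \<open>e j\<close> to \<open>G\<close> makes the new terms cancel in the gap, which is only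
  rescaled. The \<open>C j\<close> and \<open>D j\<close> have identity marginals, so the trace of
  the marginal and the pairings gain the same traces of the \<open>e j\<close>, and the strict
  difference survives with factor \<open>t\<close>.\<close>

lemma channel_witness:
  fixes C :: "nat \<Rightarrow> ('a0::finite \<times> 'a1::finite) op" and D :: "nat \<Rightarrow> ('b0::finite \<times> 'b1::finite) op"
  assumes C: "\<And>j a a'. j \<in> {1..n} \<Longrightarrow> (\<Sum>s\<in>UNIV. C j (a, s) (a', s)) = (if a = a' then 1 else 0)"
    and D: "\<And>j b b'. j \<in> {1..n} \<Longrightarrow> (\<Sum>p\<in>UNIV. D j (b, p) (b', p)) = (if b = b' then 1 else 0)"
    and \<epsilon>: "\<epsilon> > 0" and H: "\<And>j. hermitian (H j)" and gap: "psd UNIV (gap 1 n C H G)"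
    and G: "\<And>a b a' b'. (\<Sum>s\<in>UNIV. G ((a, s), b) ((a', s), b')) = (if a = a' then \<tau> b b' else 0)"
    and tr: "tr \<tau> = (\<Sum>j\<in>{1..n}. pair (H j) (D j)) - of_real \<epsilon>"
  obtains L G' \<kappa> \<delta> where "\<delta> > 0" "\<And>j. j \<in> {1..n} \<Longrightarrow> psd UNIV (L j)"
      "\<And>j b b'. j \<in> {1..n} \<Longrightarrow> (\<Sum>p\<in>UNIV. L j (b, p) (b', p)) = (if b = b' then 1 else 0)"
      "psd UNIV (gap 1 n C L G')"
      "\<And>a b a' b'. (\<Sum>s\<in>UNIV. G' ((a, s), b) ((a', s), b')) = (if a = a' then \<kappa> b b' else 0)"
      "tr \<kappa> = (\<Sum>j\<in>{1..n}. pair (L j) (D j)) - of_real \<delta>"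
proof -
  let ?k = "of_nat CARD('b1) :: complex"
  define h where "h j b b' = (\<Sum>p\<in>UNIV. H j (b, p) (b', p)) / ?k" for j b b'
  \<comment> \<open>Subtracting \<open>H j\<close> from its B1-average tensored with the identity
    gives an operator with zero partial trace over B1; hence only the multiple of the identity
    contributes to the marginal of \<open>L j\<close>.\<close>
  define H' where "H' j = (\<lambda>(b, p) (b', q). (if p = q then h j b b' else 0) - H j (b, p) (b', q))" for j
  \<comment> \<open>Large enough to dominate every \<open>H' j\<close> at once; the summand 1 makes
    it positive even if all of them vanish. The factor \<open>t\<close> then normalises the marginal
    of \<open>L j\<close> to the identity.\<close>
  define m where "m = 1 + (\<Sum>j\<in>{1..n}. \<Sum>y\<in>UNIV. \<Sum>y'\<in>UNIV. cmod (H' j y y'))"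
  define t where "t = 1 / (real CARD('b1) * m)"
  define L where "L j = oscale (of_real t) (\<lambda>y y'. (if y = y' then of_real m else 0) - H' j y y')" for j
  define e where "e j b b' = (if b = b' then of_real m else 0) - h j b b'" for j b b'
  define G' where "G' = (\<lambda>(x, b) (x', b'). of_real t * (G (x, b) (x', b') + (\<Sum>j\<in>{1..n}. C j x x' * e j b b')))"
  define \<kappa> where "\<kappa> = (\<lambda>b b'. of_real t * (\<tau> b b' + (\<Sum>j\<in>{1..n}. e j b b')))"
  have m: "m > 0" unfolding m_def by (intro add_pos_nonneg sum_nonneg) auto
  then have t: "t > 0" by (simp add: t_def)
  have tm: "of_real t * (?k * of_real m) = 1"
    using m by (simp add: t_def)
  have cnjH: "cnj (H j y' y) = H j y y'" for j y y' using H unfolding hermitian_def by metis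
  have hermH': "hermitian (H' j)" for j
  proof -
    have "H' j (b, p) (b', q) = cnj (H' j (b', q) (b, p))" for b p b' q
      by (simp add: H'_def h_def cnjH)
    then show ?thesis unfolding hermitian_def split_paired_All by blast
  qed
  show ?thesis
  proof (rule that)
    show "t * \<epsilon> > 0" using t \<epsilon> by simp
    show "psd UNIV (L j)" if "j \<in> {1..n}" for j
      unfolding L_def
    proof (intro psd_scale psd_diagonally_dominated hermH')
      have "(\<Sum>y\<in>UNIV. \<Sum>y'\<in>UNIV. cmod (H' j y y')) \<le> (\<Sum>j\<in>{1..n}. \<Sum>y\<in>UNIV. \<Sum>y'\<in>UNIV. cmod (H' j y y'))"
        using that by (intro member_le_sum[of j "{1..n}" "\<lambda>j. \<Sum>y\<in>UNIV. \<Sum>y'\<in>UNIV. cmod (H' j y y')"]) (auto intro!: sum_nonneg)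
      then show "(\<Sum>y\<in>UNIV. \<Sum>y'\<in>UNIV. cmod (H' j y y')) \<le> m" by (simp add: m_def)
    qed (use t in simp)
    show "(\<Sum>p\<in>UNIV. L j (b, p) (b', p)) = (if b = b' then 1 else 0)" for j b b'
    proof -
      have "(\<Sum>p\<in>UNIV. L j (b, p) (b', p)) = of_real t * (if b = b' then ?k * of_real m else 0)"
        by (simp add: L_def oscale_apply H'_def h_def sum_subtractf flip: sum_distrib_left)
      then show ?thesis using tm by simp
    qed
    have "gap 1 n C L G' = oscale (of_real t) (gap 1 n C H G)"
    proof -
      have "gap 1 n C L G' (x, b, p) (x', b', q) = of_real t * gap 1 n C H G (x, b, p) (x', b', q)" for x b p x' b' q
      proof -
        have "L j (b, p) (b', q) = of_real t * ((if p = q then e j b b' else 0) + H j (b, p) (b', q))" for j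
          by (simp add: L_def oscale_apply H'_def e_def)
        then have "(\<Sum>j\<in>{1..n}. C j x x' * L j (b, p) (b', q))
          = of_real t * ((\<Sum>j\<in>{1..n}. if p = q then C j x x' * e j b b' else 0) + (\<Sum>j\<in>{1..n}. C j x x' * H j (b, p) (b', q)))"
          unfolding sum.distrib[symmetric] sum_distrib_left by (intro sum.cong refl) (simp add: algebra_simps)
        then show ?thesis by (simp add: gap_def G'_def algebra_simps)
      qed
      then show ?thesis by (simp add: fun_eq_iff oscale_apply)
    qed
    then show "psd UNIV (gap 1 n C L G')" using psd_scale[OF gap] t by simp
    show "(\<Sum>s\<in>UNIV. G' ((a, s), b) ((a', s), b')) = (if a = a' then \<kappa> b b' else 0)" for a b a' b'
    proof -
      have "(\<Sum>s\<in>UNIV. \<Sum>j\<in>{1..n}. C j (a, s) (a', s) * e j b b') = (\<Sum>j\<in>{1..n}. (\<Sum>s\<in>UNIV. C j (a, s) (a', s)) * e j b b')"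
        unfolding sum_distrib_right by (rule sum.swap)
      also have "\<dots> = (if a = a' then \<Sum>j\<in>{1..n}. e j b b' else 0)" by (simp add: C)
      finally show ?thesis
        by (simp add: G'_def \<kappa>_def sum.distrib G flip: sum_distrib_left)
    qed
    show "tr \<kappa> = (\<Sum>j\<in>{1..n}. pair (L j) (D j)) - of_real (t * \<epsilon>)"
    proof -
      have "pair (L j) (D j) = of_real t * ((\<Sum>b\<in>UNIV. e j b b) + pair (H j) (D j))" if "j \<in> {1..n}" for j
      proof -
        have "pair (L j) (D j) = of_real t * ((\<Sum>b\<in>UNIV. \<Sum>p\<in>UNIV. \<Sum>b'\<in>UNIV. \<Sum>q\<in>UNIV.
            (if p = q then e j b b' * D j (b, p) (b', q) else 0)) + pair (H j) (D j))"
          unfolding pair_def sum_UNIV_prod sum.distrib[symmetric] sum_distrib_left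
          by (intro sum.cong refl) (simp add: L_def oscale_apply H'_def e_def algebra_simps)
        also have "(\<Sum>b\<in>UNIV. \<Sum>p\<in>UNIV. \<Sum>b'\<in>UNIV. \<Sum>q\<in>UNIV. (if p = q then e j b b' * D j (b, p) (b', q) else 0))
            = (\<Sum>b\<in>UNIV. \<Sum>b'\<in>UNIV. \<Sum>p\<in>UNIV. e j b b' * D j (b, p) (b', p))"
          by (simp, intro sum.cong refl sum.swap)
        also have "\<dots> = (\<Sum>b\<in>UNIV. e j b b)"
          by (simp add: D[OF that] if_distrib[of "\<lambda>z. _ * z"] flip: sum_distrib_left cong: if_cong)
        finally show ?thesis .
      qed
      then have "(\<Sum>j\<in>{1..n}. pair (L j) (D j)) = of_real t * ((\<Sum>j\<in>{1..n}. \<Sum>b\<in>UNIV. e j b b) + (\<Sum>j\<in>{1..n}. pair (H j) (D j)))"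
        by (simp add: sum_distrib_left sum.distrib distrib_left)
      moreover have "tr \<kappa> = of_real t * (tr \<tau> + (\<Sum>b\<in>UNIV. \<Sum>j\<in>{1..n}. e j b b))"
        by (simp add: tr_def \<kappa>_def sum.distrib sum_distrib_left distrib_left)
      then have "tr \<kappa> = of_real t * (tr \<tau> + (\<Sum>j\<in>{1..n}. \<Sum>b\<in>UNIV. e j b b))"
        by (subst sum.swap)
      ultimately show ?thesis by (simp add: tr algebra_simps)
    qed
  qed
qed

section \<open>Separating channels and the equivalence\<close>

lemma gap_reindex:
  assumes "inj g"
  shows "gap c n C (\<lambda>j. reindex (map_prod f g) (L j)) (oscale c (reindex (map_prod id f) G))
    = oscale c (reindex (map_prod id (map_prod f g)) (gap 1 n C L G))"
  using assms by (simp add: fun_eq_iff gap_def reindex_def oscale_apply inj_eq right_diff_distrib)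

lemma Hmin_ext_separating_channels:
  fixes \<Psi> :: "nat \<Rightarrow> 'a0::finite op \<Rightarrow> 'a1::finite op" and \<Phi> :: "nat \<Rightarrow> 'b0::finite op \<Rightarrow> 'b1::finite op"
    and f :: "'b0 \<Rightarrow> 'r0::finite" and g :: "'b1 \<Rightarrow> 'r1::finite"
  assumes n: "n \<ge> 1" and \<Psi>: "\<forall>j\<in>{1..n}. channel (\<Psi> j)" and \<Phi>: "\<forall>j\<in>{1..n}. channel (\<Phi> j)"
    and f: "bij f" and g: "bij g"
    and none: "\<nexists>\<Theta>. superchannel \<Theta> \<and> (\<forall>j\<in>{1..n}. \<Phi> j = \<Theta> (\<Psi> j))"
  obtains \<Lambda> :: "nat \<Rightarrow> 'r0::finite op \<Rightarrow> 'r1::finite op" where "\<forall>j\<in>{1..n}. channel (\<Lambda> j)"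
    "\<not> Hmin_ext (average_tensor n \<Psi> \<Lambda>) \<le> Hmin_ext (average_tensor n \<Phi> \<Lambda>)"
proof -
  let ?C = "\<lambda>j. choi UNIV (\<Psi> j)" and ?D = "\<lambda>j. choi UNIV (\<Phi> j)"
  have C: "\<forall>j\<in>{1..n}. hermitian (?C j)" and D: "\<forall>j\<in>{1..n}. hermitian (?D j)"
    using psd_hermitian[OF finite] channelD(2) \<Psi> \<Phi> by blast+
  have margC: "(\<Sum>s\<in>UNIV. ?C j (a, s) (a', s)) = (if a = a' then 1 else 0)" if "j \<in> {1..n}" for j a a'
    using channelD(4) \<Psi> that by blast
  have margD: "(\<Sum>s\<in>UNIV. ?D j (b, s) (b', s)) = (if b = b' then 1 else 0)" if "j \<in> {1..n}" for j b b'
    using channelD(4) \<Phi> that by blast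
  from C D show ?thesis
  proof (cases rule: super_op_or_witness)
    case (super_op J \<sigma>)
    have "superchannel (super_of J)" by (rule superchannel_super_of[OF super_op(1-3)])
    moreover have "\<Phi> j = super_of J (\<Psi> j)" if "j \<in> {1..n}" for j
    proof -
      have "super_of J (\<Psi> j) = lmap UNIV (?D j)"
        using super_op(4)[OF that] by (simp add: super_of_def contract_def)
      then show ?thesis using lmap_choi[OF channelD(1)] \<Phi> that by metis
    qed
    ultimately show ?thesis using none by blast
  next
    case (witness G0 H \<tau> \<epsilon>)
    show ?thesis
    proof (rule channel_witness[OF margC margD witness])
      fix L G \<kappa> and \<delta> :: real
      assume \<delta>: "\<delta> > 0" and L: "\<And>j. j \<in> {1..n} \<Longrightarrow> psd UNIV (L j)"
        "\<And>j b b'. j \<in> {1..n} \<Longrightarrow> (\<Sum>p\<in>UNIV. L j (b, p) (b', p)) = (if b = b' then 1 else 0)"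
        and gap: "psd UNIV (gap 1 n ?C L G)"
        and G: "\<And>a b a' b'. (\<Sum>s\<in>UNIV. G ((a, s), b) ((a', s), b')) = (if a = a' then \<kappa> b b' else 0)"
        and tr: "tr \<kappa> = (\<Sum>j\<in>{1..n}. pair (L j) (?D j)) - of_real \<delta>"
      \<comment> \<open>The witness lives on a copy of B; the inverse bijections carry it to
        R.\<close>
      let ?f = "inv f" and ?g = "inv g"
      have f': "bij ?f" and g': "bij ?g" using f g by (simp_all add: bij_imp_bij_inv)
      \<comment> \<open>Divided by d_R0 and \<open>n\<close>, the real part of \<open>S\<close> is
        the separating threshold: the operator \<gamma> built below for the \<open>\<Psi> j\<close>
        has a trace lower by a multiple of \<delta>, while every feasible operator for the
        \<open>\<Phi> j\<close> has at least this trace.\<close>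
      define S where "S = (\<Sum>j\<in>{1..n}. pair (L j) (?D j))"
      define L' where "L' j = reindex (map_prod ?f ?g) (L j)" for j
      define \<Lambda> where "\<Lambda> j = lmap UNIV (L' j)" for j
      have choi_\<Lambda>: "choi UNIV (\<Lambda> j) = L' j" for j
        unfolding \<Lambda>_def using choi_lmap[of UNIV "L' j" UNIV] by simp
      have \<Lambda>: "\<forall>j\<in>{1..n}. channel (\<Lambda> j)"
      proof
        fix j assume j: "j \<in> {1..n}"
        show "channel (\<Lambda> j)"
          unfolding \<Lambda>_def
        proof (rule channel_lmap)
          show "psd UNIV (L' j)" unfolding L'_def by (rule psd_UNIV_reindex[OF L(1)[OF j]])
          show "(\<Sum>p\<in>UNIV. L' j (r, p) (r', p)) = (if r = r' then 1 else 0)" for r r'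
          proof -
            have "(\<Sum>p\<in>UNIV. L' j (r, p) (r', p)) = (\<Sum>p\<in>UNIV. L j (?f r, ?g p) (?f r', ?g p))"
              by (simp add: L'_def reindex_def)
            also have "\<dots> = (\<Sum>p\<in>UNIV. L j (?f r, p) (?f r', p))"
              by (rule sum.reindex_bij_betw[OF g'])
            also have "\<dots> = (if r = r' then 1 else 0)"
              unfolding L(2)[OF j] using f' by (simp add: bij_def inj_eq)
            finally show ?thesis .
          qed
        qed
      qed
      \<comment> \<open>The normalisation of the Choi state of the average; the witness itself was
        obtained with factor 1.\<close>
      define c where "c = 1 / (real CARD('a0) * real CARD('r0) * real n)"
      have c: "complex_of_real c = 1 / (of_nat CARD('a0) * of_nat CARD('r0) * of_nat n)" "c \<ge> 0"
        by (simp_all add: c_def)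
      define \<gamma> where "\<gamma> = oscale (of_real c) (reindex (map_prod id ?f) G)"
      have "psd UNIV (gap (of_real c) n ?C (\<lambda>j. choi UNIV (\<Lambda> j)) \<gamma>)"
        unfolding choi_\<Lambda> L'_def \<gamma>_def gap_reindex[OF bij_is_inj[OF g']]
        by (intro psd_scale psd_UNIV_reindex gap c)
      moreover from this have "hermitian \<gamma>"
        by (rule hermitian_of_gap) (use channelD(2) \<Psi> \<Lambda> in blast)+
      moreover have marg: "(\<Sum>p\<in>UNIV. \<gamma> ((a, p), r) ((a', p), r')) = (if a = a' then of_real c * \<kappa> (?f r) (?f r') else 0)"
        for a a' r r'
        by (simp add: \<gamma>_def oscale_apply reindex_def G flip: sum_distrib_left)
      moreover have marg': "(\<Sum>x\<in>UNIV. \<gamma> (x, r) (x, r')) = of_nat CARD('a0) * (of_real c * \<kappa> (?f r) (?f r'))" for r r'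
        by (simp add: sum_UNIV_prod marg)
      ultimately have feas: "\<gamma> \<in> Hmin_feasible (average_tensor n \<Psi> \<Lambda>)"
        by (subst Hmin_feasible_average[OF \<Psi> \<Lambda>]) (auto simp: c(1))
      have "tr \<gamma> = (\<Sum>r\<in>UNIV. of_nat CARD('a0) * (of_real c * \<kappa> (?f r) (?f r)))"
        unfolding marg'[symmetric] tr_prod by (rule sum.swap)
      also have "\<dots> = of_nat CARD('a0) * of_real c * tr \<kappa>"
        unfolding tr_def sum.reindex_bij_betw[OF f', of "\<lambda>b. of_nat CARD('a0) * (of_real c * \<kappa> b b)"]
        by (simp add: sum_distrib_left mult.assoc)
      also have "of_nat CARD('a0) * of_real c = (of_real (1 / (real CARD('r0) * real n)) :: complex)"
        by (simp add: c_def)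
      finally have "Re (tr \<gamma>) = (Re S - \<delta>) / (real CARD('r0) * real n)"
        by (simp add: tr S_def)
      also have "\<dots> < Re S / (real CARD('r0) * real n)"
        using \<delta> n by (intro divide_strict_right_mono) auto
      also have "\<dots> \<le> Inf ((\<lambda>\<gamma>. Re (tr \<gamma>)) ` Hmin_feasible (average_tensor n \<Phi> \<Lambda>))"
      proof (rule cInf_greatest)
        show "(\<lambda>\<gamma>. Re (tr \<gamma>)) ` Hmin_feasible (average_tensor n \<Phi> \<Lambda>) \<noteq> {}"
          using Hmin_feasible_nonempty[OF \<Phi> \<Lambda>] by simp
        have "L' j (map_prod f g y) (map_prod f g y') = L j y y'" for j y y'
          using f g by (cases y; cases y') (simp add: L'_def reindex_def bij_def)
        then have "S = (\<Sum>j\<in>{1..n}. \<Sum>y\<in>UNIV. \<Sum>y'\<in>UNIV. ?D j y y' *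
            choi UNIV (\<Lambda> j) (map_prod f g y) (map_prod f g y'))"
          unfolding choi_\<Lambda> by (simp add: S_def pair_def mult.commute)
        then show "Re S / (real CARD('r0) * real n) \<le> x"
          if "x \<in> (\<lambda>\<gamma>. Re (tr \<gamma>)) ` Hmin_feasible (average_tensor n \<Phi> \<Lambda>)" for x
          using that Hmin_feasible_trace_ge_pairing[OF \<Phi> \<Lambda> _ f g] by auto
      qed
      finally have "Re (tr \<gamma>) < Inf ((\<lambda>\<gamma>. Re (tr \<gamma>)) ` Hmin_feasible (average_tensor n \<Phi> \<Lambda>))" .
      moreover have "Inf ((\<lambda>\<gamma>. Re (tr \<gamma>)) ` Hmin_feasible (average_tensor n \<Psi> \<Lambda>)) \<le> Re (tr \<gamma>)"
      proof (rule cInf_lower)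
        show "bdd_below ((\<lambda>\<gamma>. Re (tr \<gamma>)) ` Hmin_feasible (average_tensor n \<Psi> \<Lambda>))"
          using Hmin_feasible_trace_ge[OF n \<Psi> \<Lambda>] by (auto intro!: bdd_belowI)
      qed (use feas in simp)
      ultimately have "\<not> Hmin_ext (average_tensor n \<Psi> \<Lambda>) \<le> Hmin_ext (average_tensor n \<Phi> \<Lambda>)"
        unfolding Hmin_ext_le_iff[OF n \<Psi> \<Phi> \<Lambda>] by linarith
      with \<Lambda> show ?thesis by (rule that)
    qed
  qed
qed

text \<open>Every trace attained by a feasible operator for the \<open>\<Psi> j\<close> is attained
  by one for the \<open>\<Phi> j\<close>, so the infimum for the \<open>\<Phi> j\<close> is no
  larger.\<close>

lemma Hmin_ext_superchannel_mono:
  fixes \<Psi> :: "nat \<Rightarrow> 'a0::finite op \<Rightarrow> 'a1::finite op" and \<Phi> :: "nat \<Rightarrow> 'b0::finite op \<Rightarrow> 'b1::finite op"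
    and \<Lambda> :: "nat \<Rightarrow> 'r0::finite op \<Rightarrow> 'r1::finite op"
  assumes n: "n \<ge> 1" and \<Psi>: "\<forall>j\<in>{1..n}. channel (\<Psi> j)" and \<Phi>: "\<forall>j\<in>{1..n}. channel (\<Phi> j)"
    and \<Lambda>: "\<forall>j\<in>{1..n}. channel (\<Lambda> j)"
    and \<Theta>: "superchannel \<Theta>" "\<forall>j\<in>{1..n}. \<Phi> j = \<Theta> (\<Psi> j)"
  shows "Hmin_ext (average_tensor n \<Psi> \<Lambda>) \<le> Hmin_ext (average_tensor n \<Phi> \<Lambda>)"
proof -
  have \<Theta>\<Psi>: "\<forall>j\<in>{1..n}. channel (\<Theta> (\<Psi> j))" using \<Theta>(2) \<Phi> by metis
  \<comment> \<open>The two families agree on \<open>{1..n}\<close> only, which is all that the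
    average sees.\<close>
  have avg: "average_tensor n \<Phi> \<Lambda> = average_tensor n (\<lambda>j. \<Theta> (\<Psi> j)) \<Lambda>"
  proof
    fix X
    have "(\<Sum>j\<in>{1..n}. ltensor UNIV UNIV (\<Phi> j) (\<Lambda> j) X) = (\<Sum>j\<in>{1..n}. ltensor UNIV UNIV (\<Theta> (\<Psi> j)) (\<Lambda> j) X)"
      by (rule sum.cong) (use \<Theta>(2) in auto)
    then show "average_tensor n \<Phi> \<Lambda> X = average_tensor n (\<lambda>j. \<Theta> (\<Psi> j)) \<Lambda> X"
      by (simp only: average_tensor_def)
  qed
  have "bdd_below ((\<lambda>\<gamma>. Re (tr \<gamma>)) ` Hmin_feasible (average_tensor n \<Phi> \<Lambda>))"
    using Hmin_feasible_trace_ge[OF n \<Phi> \<Lambda>] by (auto intro!: bdd_belowI)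
  moreover have "Re (tr \<gamma>) \<in> (\<lambda>\<gamma>. Re (tr \<gamma>)) ` Hmin_feasible (average_tensor n \<Phi> \<Lambda>)"
    if \<gamma>: "\<gamma> \<in> Hmin_feasible (average_tensor n \<Psi> \<Lambda>)" for \<gamma>
  proof (rule Hmin_feasible_superchannel[OF n \<Theta>(1) \<Psi> \<Theta>\<Psi> \<Lambda> \<gamma>])
    fix \<gamma>' assume "\<gamma>' \<in> Hmin_feasible (average_tensor n (\<lambda>j. \<Theta> (\<Psi> j)) \<Lambda>)" "tr \<gamma>' = tr \<gamma>"
    then show ?thesis unfolding avg by (metis imageI)
  qed
  ultimately have "Inf ((\<lambda>\<gamma>. Re (tr \<gamma>)) ` Hmin_feasible (average_tensor n \<Phi> \<Lambda>)) \<le> Re (tr \<gamma>)"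
    if "\<gamma> \<in> Hmin_feasible (average_tensor n \<Psi> \<Lambda>)" for \<gamma>
    using that by (blast intro: cInf_lower)
  then show ?thesis
    unfolding Hmin_ext_le_iff[OF n \<Psi> \<Phi> \<Lambda>]
    using Hmin_feasible_nonempty[OF \<Psi> \<Lambda>] by (intro cInf_greatest) auto
qed

theorem corollary1:
  fixes n :: nat
    and \<Psi> :: "nat \<Rightarrow> 'a0::finite op \<Rightarrow> 'a1::finite op"
    and \<Phi> :: "nat \<Rightarrow> 'b0::finite op \<Rightarrow> 'b1::finite op"
  assumes "n \<ge> 1"
    and "\<And>j. j \<in> {1..n} \<Longrightarrow> channel (\<Psi> j)"
    and "\<And>j. j \<in> {1..n} \<Longrightarrow> channel (\<Phi> j)"
    and "CARD('r0::finite) = CARD('b0)"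
    and "CARD('r1::finite) = CARD('b1)"
  shows "(\<exists>\<Theta>. superchannel \<Theta> \<and> (\<forall>j\<in>{1..n}. \<Phi> j = \<Theta> (\<Psi> j))) \<longleftrightarrow>
    (\<forall>\<Lambda> :: nat \<Rightarrow> 'r0 op \<Rightarrow> 'r1 op. (\<forall>j\<in>{1..n}. channel (\<Lambda> j)) \<longrightarrow>
       Hmin_ext (average_tensor n \<Psi> \<Lambda>) \<le> Hmin_ext (average_tensor n \<Phi> \<Lambda>))"
proof -
  have \<Psi>: "\<forall>j\<in>{1..n}. channel (\<Psi> j)" and \<Phi>: "\<forall>j\<in>{1..n}. channel (\<Phi> j)"
    using assms(2,3) by blast+
  \<comment> \<open>Equal dimensions identify R with B; the maximally entangled vector of B and R is
    taken along these bijections.\<close>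
  obtain f :: "'b0 \<Rightarrow> 'r0" where f: "bij f"
    using finite_same_card_bij[of "UNIV :: 'b0 set" "UNIV :: 'r0 set"] assms(4) by auto
  obtain g :: "'b1 \<Rightarrow> 'r1" where g: "bij g"
    using finite_same_card_bij[of "UNIV :: 'b1 set" "UNIV :: 'r1 set"] assms(5) by auto
  show ?thesis
  proof
    assume "\<exists>\<Theta>. superchannel \<Theta> \<and> (\<forall>j\<in>{1..n}. \<Phi> j = \<Theta> (\<Psi> j))"
    then obtain \<Theta> where "superchannel \<Theta>" "\<forall>j\<in>{1..n}. \<Phi> j = \<Theta> (\<Psi> j)" by blast
    then show "\<forall>\<Lambda> :: nat \<Rightarrow> 'r0 op \<Rightarrow> 'r1 op. (\<forall>j\<in>{1..n}. channel (\<Lambda> j)) \<longrightarrow>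
       Hmin_ext (average_tensor n \<Psi> \<Lambda>) \<le> Hmin_ext (average_tensor n \<Phi> \<Lambda>)"
      using Hmin_ext_superchannel_mono[OF assms(1) \<Psi> \<Phi>] by blast
  next
    assume le: "\<forall>\<Lambda> :: nat \<Rightarrow> 'r0 op \<Rightarrow> 'r1 op. (\<forall>j\<in>{1..n}. channel (\<Lambda> j)) \<longrightarrow>
       Hmin_ext (average_tensor n \<Psi> \<Lambda>) \<le> Hmin_ext (average_tensor n \<Phi> \<Lambda>)"
    show "\<exists>\<Theta>. superchannel \<Theta> \<and> (\<forall>j\<in>{1..n}. \<Phi> j = \<Theta> (\<Psi> j))"
    proof (rule ccontr)
      assume "\<nexists>\<Theta>. superchannel \<Theta> \<and> (\<forall>j\<in>{1..n}. \<Phi> j = \<Theta> (\<Psi> j))"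
      then obtain \<Lambda> :: "nat \<Rightarrow> 'r0 op \<Rightarrow> 'r1 op" where "\<forall>j\<in>{1..n}. channel (\<Lambda> j)"
        "\<not> Hmin_ext (average_tensor n \<Psi> \<Lambda>) \<le> Hmin_ext (average_tensor n \<Phi> \<Lambda>)"
        by (rule Hmin_ext_separating_channels[OF assms(1) \<Psi> \<Phi> f g])
      with le show False by blast
    qed
  qed
qed

end
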